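(* Let $\mathfrak{X}$ be a Banach space, let $Y\subset S(\mathfrak{X}^* )$ be a set that norms $\mathfrak{X}$ within some fixed constant greater than one, and let $\mathcal{Y}$ be a (linear) subspace of $\mathfrak{X}^*$ that contains $Y$. Let $T: L_1\to\mathfrak{X}$ be an operator that is not completely continuous, and let $\{\tau_n\}_{n\ge 0}$ be a sequence of real numbers larger than $1$. Then there exist (A) a dyadic splitting $\mathcal{A}=\{A^n_k\}$ (of some set $A^0_1\in\Sigma^+$), (B) a sequence $\{x^*_n\}_{n\ge 0}$ in $S(\mathfrak{X}^* )\cap\mathcal{Y}$, (C) for each $n\ge 0$, a finite set $\{z^*_{n,i}\}_{i=1}^{p_n}$ in $S(\mathfrak{X}^* )$, such that, for the Haar system $\{h_j\}_{j\ge 1}$ and the blocking $\{H_n\}_{n\ge 0}$ corresponding to $\mathcal{A}$, for some $\delta>0$, and for each $n,m\ge 0$: (1) $x^*_n(Th)=\delta\cdot\delta_{n,m}$ for each $h\in H_m$ (where $\delta_{n,m}$ is the Kronecker delta); (2) $\{T^*x^*_n\}_{n\ge0}$ is weak*-null in $L_\infty$; (3) $\{T^*x^*_n\}_{n\ge0}$ is equivalent to the standard unit vector basis of $\ell_1$; (4) $\{z^*_{n,i}\}_{i=1}^{p_n}$ norms $\operatorname{span}\big(\bigcup_{j=0}^n TH_j\big)$ within $\tau_n$; (5) $TH_{n+1}\subset{}^\perp\{z^*_{n,i}\}_{i=1}^{p_n}$, i.e. $z^*_{n,i}(Th)=0$ for all $h\in H_{n+1}$ and $1\le i\le p_n$.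 Moreover, condition (3) implies that $\{x^*_n\}_{n\ge 0}$ is also equivalent to the standard unit vector basis of $\ell_1$; and if $\prod_n\tau_n$ is finite, then conditions (4) and (5) guarantee that $\{\operatorname{span} TH_n\}_{n\ge 0}$ forms a finite dimensional decomposition (of its closed linear span) with constant at most $\prod_n\tau_n$.
   Context: Scalars are real. "Operator" means bounded linear operator between Banach spaces. An operator is completely continuous if it carries weakly convergent sequences into norm convergent sequences. $(\Omega,\Sigma,\mu)$ is the Lebesgue measure space on $[0,1]$, $\Sigma^+$ is the collection of sets in $\Sigma$ with positive measure, $L_1=L_1(\Omega,\Sigma,\mu)$, and $L_\infty=L_1^*$. $\mathfrak{X}^*$ is the dual of $\mathfrak{X}$ and $S(\cdot)$ denotes the unit sphere. Norming: a set $N\subset S(\mathfrak{X}^* )$ norms a subspace $\mathfrak{X}_0\subset\mathfrak{X}$ within $\tau>1$ if for each $x\in\mathfrak{X}_0$ there is $x^*\in N$ such that $\|x\|\le\tau\, x^*(x)$. Dyadic splitting: a system $\mathcal{A}=\{A^n_k\in\Sigma: n=0,1,2,\ldots,\ k=1,\ldots,2^n\}$ is a dyadic splitting of $A^0_1\in\Sigma^+$ if each $A^n_k$ is partitioned into the two sets $A^{n+1}_{2k-1}$ and $A^{n+1}_{2k}$ of equal measure, for each admissible $n$ and $k$ (so $\mu(A^n_k)=2^{-n}\mu(A^0_1)$). Haar system and blocking corresponding to $\mathcal{A}$: $h_1=\frac{1}{\mu(A^0_1)}1_{A^0_1}$ and $h_{2^n+k}=\frac{2^n}{\mu(A^0_1)}\big(1_{A^{n+1}_{2k-1}}-1_{A^{n+1}_{2k}}\big)$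 for $n=0,1,2,\ldots$ and $k=1,\ldots,2^n$; and $H_n=\{h_j: 2^{n-1}<j\le 2^n\}$ for $n\ge 0$ (so $H_0=\{h_1\}$). A sequence $\{v_n\}$ in a Banach space is equivalent to the unit vector basis of $\ell_1$ if there are constants $c,C>0$ with $c\sum|a_n|\le\|\sum a_nv_n\|\le C\sum|a_n|$ for all finitely supported scalar sequences $(a_n)$. A sequence of finite dimensional subspaces $\{E_n\}_{n\ge 0}$ forms a finite dimensional decomposition (of its closed linear span) with constant at most $K$ if every element of the closed span has a unique expansion $\sum_n e_n$ with $e_n\in E_n$ and the partial-sum projections all have norm at most $K$. *)

theory Defs
  imports "HOL-Analysis.Analysis" "HOL-Library.Discrete_Functions"
begin

section \<open>The Banach space of integrable functions on the unit interval\<close>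

abbreviation unit_leb :: "real measure" where
  "unit_leb \<equiv> lebesgue_on {0..1}"

definition L1_rel :: "(real \<Rightarrow> real) \<Rightarrow> (real \<Rightarrow> real) \<Rightarrow> bool" where
  "L1_rel f g \<longleftrightarrow>
     integrable unit_leb f \<and> integrable unit_leb g \<and> (AE t in unit_leb. f t = g t)"

lemma part_equivp_L1_rel: "part_equivp L1_rel"
proof (rule part_equivpI)
  show "\<exists>f. L1_rel f f"
    by (rule exI[of _ "\<lambda>_. 0"]) (simp add: L1_rel_def)
  show "symp L1_rel"
    by (auto simp: symp_def L1_rel_def)
  show "transp L1_rel"
    by (auto simp: transp_def L1_rel_def)
qed

quotient_type L1 = "real \<Rightarrow> real" / partial: L1_rel
  by (rule part_equivp_L1_rel)

instantiation L1 :: real_normed_vector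
begin

lift_definition zero_L1 :: L1 is "\<lambda>_. 0"
  by (simp add: L1_rel_def)

lift_definition plus_L1 :: "L1 \<Rightarrow> L1 \<Rightarrow> L1" is "\<lambda>f g t. f t + g t"
  by (auto simp: L1_rel_def)

lift_definition minus_L1 :: "L1 \<Rightarrow> L1 \<Rightarrow> L1" is "\<lambda>f g t. f t - g t"
  by (auto simp: L1_rel_def)

lift_definition uminus_L1 :: "L1 \<Rightarrow> L1" is "\<lambda>f t. - f t"
  by (auto simp: L1_rel_def)

lift_definition scaleR_L1 :: "real \<Rightarrow> L1 \<Rightarrow> L1" is "\<lambda>c f t. c * f t"
  by (auto simp: L1_rel_def)

lift_definition norm_L1 :: "L1 \<Rightarrow> real" is "\<lambda>f. \<integral>t. \<bar>f t\<bar> \<partial>unit_leb"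
  by (auto simp: L1_rel_def intro!: integral_cong_AE)

definition dist_L1 :: "L1 \<Rightarrow> L1 \<Rightarrow> real" where
  "dist_L1 f g = norm (f - g)"

definition sgn_L1 :: "L1 \<Rightarrow> L1" where
  "sgn_L1 f = inverse (norm f) *\<^sub>R f"

definition uniformity_L1 :: "(L1 \<times> L1) filter" where
  "uniformity_L1 = (INF e\<in>{0<..}. principal {(f, g). dist f g < e})"

definition open_L1 :: "L1 set \<Rightarrow> bool" where
  "open_L1 U = (\<forall>f\<in>U. \<forall>\<^sub>F (f', g) in uniformity. f' = f \<longrightarrow> g \<in> U)"

instance
proof
  fix f g h :: L1 and a b :: real
  show "f + g + h = f + (g + h)"
    by transfer (auto simp: L1_rel_def add.assoc)
  show "f + g = g + f"
    by transfer (auto simp: L1_rel_def add.commute)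
  show "0 + f = f"
    by transfer (auto simp: L1_rel_def)
  show "- f + f = 0"
    by transfer (auto simp: L1_rel_def)
  show "f - g = f + - g"
    by transfer (auto simp: L1_rel_def)
  show "a *\<^sub>R (f + g) = a *\<^sub>R f + a *\<^sub>R g"
    by transfer (auto simp: L1_rel_def algebra_simps)
  show "(a + b) *\<^sub>R f = a *\<^sub>R f + b *\<^sub>R f"
    by transfer (auto simp: L1_rel_def algebra_simps)
  show "a *\<^sub>R b *\<^sub>R f = (a * b) *\<^sub>R f"
    by transfer (auto simp: L1_rel_def mult.assoc)
  show "1 *\<^sub>R f = f"
    by transfer (auto simp: L1_rel_def)
  show "dist f g = norm (f - g)"
    by (rule dist_L1_def)
  show "sgn f = inverse (norm f) *\<^sub>R f"
    by (rule sgn_L1_def)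
  show "uniformity = (INF e\<in>{0<..}. principal {(f, g :: L1). dist f g < e})"
    by (rule uniformity_L1_def)
  show "open U = (\<forall>f\<in>U. \<forall>\<^sub>F (f', g) in uniformity. f' = f \<longrightarrow> g \<in> U)" for U :: "L1 set"
    by (rule open_L1_def)
  show "norm f = 0 \<longleftrightarrow> f = 0"
  proof transfer
    fix f assume "L1_rel f f"
    then have f: "integrable unit_leb f" by (simp add: L1_rel_def)
    then have "((\<integral>t. \<bar>f t\<bar> \<partial>unit_leb) = 0) = (AE t in unit_leb. \<bar>f t\<bar> = 0)"
      by (intro integral_nonneg_eq_0_iff_AE) auto
    then show "((\<integral>t. \<bar>f t\<bar> \<partial>unit_leb) = 0) = L1_rel f (\<lambda>_. 0)"
      using f by (simp add: L1_rel_def)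
  qed
  show "norm (f + g) \<le> norm f + norm g"
  proof transfer
    fix f g assume "L1_rel f f" "L1_rel g g"
    then have f: "integrable unit_leb f" and g: "integrable unit_leb g"
      by (auto simp: L1_rel_def)
    have "(\<integral>t. \<bar>f t + g t\<bar> \<partial>unit_leb) \<le> (\<integral>t. \<bar>f t\<bar> + \<bar>g t\<bar> \<partial>unit_leb)"
      using f g by (intro integral_mono) auto
    also have "\<dots> = (\<integral>t. \<bar>f t\<bar> \<partial>unit_leb) + (\<integral>t. \<bar>g t\<bar> \<partial>unit_leb)"
      using f g by simp
    finally show "(\<integral>t. \<bar>f t + g t\<bar> \<partial>unit_leb)
        \<le> (\<integral>t. \<bar>f t\<bar> \<partial>unit_leb) + (\<integral>t. \<bar>g t\<bar> \<partial>unit_leb)" .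
  qed
  show "norm (a *\<^sub>R f) = \<bar>a\<bar> * norm f"
    by transfer (simp add: abs_mult)
qed

end

lemma norm_abs_L1:
  assumes "integrable unit_leb f"
  shows "norm (abs_L1 f) = (\<integral>t. \<bar>f t\<bar> \<partial>unit_leb)"
  using assms by (simp add: norm_L1.abs_eq L1_rel_def)

lemma abs_L1_diff:
  assumes "integrable unit_leb f" "integrable unit_leb g"
  shows "abs_L1 f - abs_L1 g = abs_L1 (\<lambda>t. f t - g t)"
  using assms by (simp add: minus_L1.abs_eq L1_rel_def)

lemma L1_cases:
  obtains f where "integrable unit_leb f" "F = abs_L1 f"
  using Quotient3_L1 by (metis L1_rel_def Quotient3_def)

instance L1 :: banach
proof
  fix X :: "nat \<Rightarrow> L1"
  assume X: "Cauchy X"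
  have "\<forall>n. \<exists>f. integrable unit_leb f \<and> X n = abs_L1 f"
    by (meson L1_cases)
  then obtain u where u: "\<And>n. integrable unit_leb (u n)" "\<And>n. X n = abs_L1 (u n)"
    by metis
  have "\<exists>N. \<forall>m\<ge>N. norm (X m - X N) < (1/2)^k" for k :: nat
    using X unfolding Cauchy_altdef2 dist_norm by simp
  then obtain N where N: "\<And>k m. m \<ge> N k \<Longrightarrow> norm (X m - X (N k)) < (1/2)^k"
    by metis
  define r where "r = rec_nat (N 0) (\<lambda>k m. max (Suc m) (N (Suc k)))"
  have r_Suc: "r (Suc k) = max (Suc (r k)) (N (Suc k))" for k
    by (simp add: r_def)
  have r_mono: "strict_mono r"
    by (simp add: strict_mono_Suc_iff r_Suc less_max_iff_disj)
  have r_ge: "r k \<ge> N k" for k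
    by (cases k) (simp_all add: r_def)
  have r_ge_Suc: "r (Suc k) \<ge> N k" for k
    using r_ge[of k] by (simp add: r_Suc le_max_iff_disj)
  define f where "f k t = u (r (Suc k)) t - u (r k) t" for k t
  have f_int: "integrable unit_leb (f k)" for k
    unfolding f_def using u by simp
  have f_meas [measurable]: "f k \<in> borel_measurable unit_leb" for k
    using f_int by (rule borel_measurable_integrable)
  have f_norm: "(\<integral>t. norm (f k t) \<partial>unit_leb) \<le> 2 * (1/2)^k" for k
  proof -
    have "(\<integral>t. norm (f k t) \<partial>unit_leb) = norm (X (r (Suc k)) - X (r k))"
      unfolding u abs_L1_diff[OF u(1) u(1)]
      using norm_abs_L1[OF f_int[of k]] by (simp add: f_def [abs_def])
    also have "\<dots> = norm ((X (r (Suc k)) - X (N k)) - (X (r k) - X (N k)))"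
      by simp
    also have "\<dots> \<le> norm (X (r (Suc k)) - X (N k)) + norm (X (r k) - X (N k))"
      by (rule norm_triangle_ineq4)
    also have "\<dots> \<le> (1/2)^k + (1/2)^k"
      using N[OF r_ge[of k]] N[OF r_ge_Suc[of k]] by linarith
    finally show ?thesis by simp
  qed
  have f_sum: "summable (\<lambda>k. \<integral>t. norm (f k t) \<partial>unit_leb)"
    by (rule summable_comparison_test'[where g="\<lambda>k. 2 * (1/2)^k" and N=0])
       (use f_norm in \<open>auto intro!: summable_mult summable_geometric\<close>)
  have nn: "(\<integral>\<^sup>+t. ennreal (norm (f k t)) \<partial>unit_leb) = ennreal (\<integral>t. norm (f k t) \<partial>unit_leb)" for k
    using f_int by (intro nn_integral_eq_integral) auto
  have "(\<integral>\<^sup>+t. (\<Sum>k. ennreal (norm (f k t))) \<partial>unit_leb) = (\<Sum>k. ennreal (\<integral>t. norm (f k t) \<partial>unit_leb))"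
    by (subst nn_integral_suminf) (measurable, simp only: nn)
  also have "\<dots> = ennreal (\<Sum>k. \<integral>t. norm (f k t) \<partial>unit_leb)"
    using f_sum by (intro suminf_ennreal2) auto
  finally have "(\<integral>\<^sup>+t. (\<Sum>k. ennreal (norm (f k t))) \<partial>unit_leb) \<noteq> \<infinity>"
    by simp
  moreover have "(\<lambda>t. \<Sum>k. ennreal (norm (f k t))) \<in> borel_measurable unit_leb"
    by measurable
  ultimately have "AE t in unit_leb. (\<Sum>k. ennreal (norm (f k t))) \<noteq> \<infinity>"
    by (intro nn_integral_PInf_AE)
  then have f_AE: "AE t in unit_leb. summable (\<lambda>k. norm (f k t))"
    by eventually_elim (auto intro!: summable_suminf_not_top)
  define S where "S t = (\<Sum>k. f k t)" for t
  have S_int: "integrable unit_leb S"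
    unfolding S_def by (rule integrable_suminf[OF f_int f_AE f_sum])
  define g where "g t = u (r 0) t + S t" for t
  have g_int: "integrable unit_leb g"
    unfolding g_def using u S_int by simp
  have u_eq: "u (r n) t = u (r 0) t + (\<Sum>k<n. f k t)" for n t
    by (induction n) (auto simp: f_def)
  have "(\<lambda>n. \<integral>t. \<bar>u (r n) t - g t\<bar> \<partial>unit_leb) \<longlonglongrightarrow> (\<integral>t. 0 \<partial>unit_leb)"
  proof (rule integral_dominated_convergence[where w="\<lambda>t. \<Sum>k. norm (f k t)"])
    show "integrable unit_leb (\<lambda>t. \<Sum>k. norm (f k t))"
      using f_int f_AE f_sum by (intro integrable_suminf) auto
    show "AE t in unit_leb. (\<lambda>n. \<bar>u (r n) t - g t\<bar>) \<longlonglongrightarrow> 0"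
      using f_AE
    proof eventually_elim
      case (elim t)
      then have "(\<lambda>n. \<Sum>k<n. f k t) \<longlonglongrightarrow> S t"
        unfolding S_def by (intro summable_LIMSEQ) (rule summable_norm_cancel)
      then have "(\<lambda>n. (\<Sum>k<n. f k t) - S t) \<longlonglongrightarrow> 0"
        by (simp add: LIM_zero)
      moreover have "u (r n) t - g t = (\<Sum>k<n. f k t) - S t" for n
        by (subst u_eq) (simp add: g_def)
      ultimately show ?case
        by (simp only: tendsto_rabs_zero)
    qed
    show "AE t in unit_leb. norm \<bar>u (r n) t - g t\<bar> \<le> (\<Sum>k. norm (f k t))" for n
      using f_AE
    proof eventually_elim
      case (elim t)
      have s: "summable (\<lambda>k. f k t)"
        using elim by (rule summable_norm_cancel)
      have "S t = (\<Sum>k. f (k + n) t) + (\<Sum>k<n. f k t)"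
        unfolding S_def by (rule suminf_split_initial_segment[OF s])
      then have "norm \<bar>u (r n) t - g t\<bar> = norm (\<Sum>k. f (k + n) t)"
        by (simp add: u_eq[of n t] g_def)
      also have "\<dots> \<le> (\<Sum>k. norm (f (k + n) t))"
        by (rule summable_norm) (rule summable_ignore_initial_segment[OF elim])
      also have "\<dots> \<le> (\<Sum>k. norm (f k t))"
        using suminf_split_initial_segment[OF elim, of n] by (simp add: sum_nonneg)
      finally show ?case .
    qed
  qed (use u g_int in auto)
  moreover have "norm (X (r n) - abs_L1 g) = (\<integral>t. \<bar>u (r n) t - g t\<bar> \<partial>unit_leb)" for n
    using u g_int by (simp add: abs_L1_diff norm_abs_L1)
  ultimately have "(\<lambda>n. norm (X (r n) - abs_L1 g)) \<longlonglongrightarrow> 0"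
    by simp
  then have "(X \<circ> r) \<longlonglongrightarrow> abs_L1 g"
    by (simp add: o_def tendsto_norm_zero_iff LIM_zero_cancel)
  then have "X \<longlonglongrightarrow> abs_L1 g"
    using Cauchy_converges_subseq[OF X r_mono] by blast
  then show "convergent X"
    by (auto simp: convergent_def)
qed

section \<open>Notions for normed spaces\<close>

type_synonym 'a dual = "'a \<Rightarrow>\<^sub>L real"

definition adjoint_op :: "('a::real_normed_vector \<Rightarrow>\<^sub>L 'b::real_normed_vector) \<Rightarrow> 'b dual \<Rightarrow> 'a dual"
  where "adjoint_op T \<phi> = \<phi> o\<^sub>L T"

definition weakly_convergent :: "(nat \<Rightarrow> 'a::real_normed_vector) \<Rightarrow> bool" where
  "weakly_convergent v \<longleftrightarrow> (\<exists>l. \<forall>\<phi> :: 'a dual. (\<lambda>n. \<phi> (v n)) \<longlonglongrightarrow> \<phi> l)"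

definition weak_star_null :: "(nat \<Rightarrow> 'a::real_normed_vector dual) \<Rightarrow> bool" where
  "weak_star_null \<phi> \<longleftrightarrow> (\<forall>v. (\<lambda>n. \<phi> n v) \<longlonglongrightarrow> 0)"

definition completely_continuous :: "('a::real_normed_vector \<Rightarrow>\<^sub>L 'b::real_normed_vector) \<Rightarrow> bool"
  where "completely_continuous T \<longleftrightarrow>
    (\<forall>v. weakly_convergent v \<longrightarrow> convergent (\<lambda>n. T (v n)))"

definition norms_within :: "'a::real_normed_vector dual set \<Rightarrow> 'a set \<Rightarrow> real \<Rightarrow> bool" where
  "norms_within N X\<^sub>0 \<tau> \<longleftrightarrow>
     \<tau> > 1 \<and> N \<subseteq> sphere 0 1 \<and> (\<forall>v\<in>X\<^sub>0. \<exists>\<phi>\<in>N. norm v \<le> \<tau> * \<phi> v)"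

definition preannihilator :: "'a::real_normed_vector dual set \<Rightarrow> 'a set" where
  "preannihilator N = {v. \<forall>\<phi>\<in>N. \<phi> v = 0}"

definition equivalent_l1_basis :: "(nat \<Rightarrow> 'a::real_normed_vector) \<Rightarrow> bool" where
  "equivalent_l1_basis v \<longleftrightarrow>
     (\<exists>c C. 0 < c \<and> 0 < C \<and>
       (\<forall>a :: nat \<Rightarrow> real. finite {n. a n \<noteq> 0} \<longrightarrow>
          c * (\<Sum>n | a n \<noteq> 0. \<bar>a n\<bar>) \<le> norm (\<Sum>n | a n \<noteq> 0. a n *\<^sub>R v n) \<and>
          norm (\<Sum>n | a n \<noteq> 0. a n *\<^sub>R v n) \<le> C * (\<Sum>n | a n \<noteq> 0. \<bar>a n\<bar>)))"

text \<open>The last conjunct bounds the partial-sum projections, by uniqueness of the expansions.\<close>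

definition fdd_of_closed_span :: "(nat \<Rightarrow> 'a::real_normed_vector set) \<Rightarrow> real \<Rightarrow> bool" where
  "fdd_of_closed_span E K \<longleftrightarrow>
     (\<forall>n. \<exists>B. finite B \<and> E n = span B) \<and>
     (\<forall>v \<in> closure (span (\<Union>n. E n)). \<exists>!e. (\<forall>n. e n \<in> E n) \<and> e sums v) \<and>
     0 \<le> K \<and>
     (\<forall>v e N. (\<forall>n. e n \<in> E n) \<and> e sums v \<longrightarrow> norm (\<Sum>n\<le>N. e n) \<le> K * norm v)"

section \<open>Dyadic splittings and their Haar systems\<close>

text \<open>Only the sets \<open>A n k\<close> with \<open>1 \<le> k \<le> 2 ^ n\<close> are relevant.\<close>

definition dyadic_splitting :: "(nat \<Rightarrow> nat \<Rightarrow> real set) \<Rightarrow> bool" where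
  "dyadic_splitting A \<longleftrightarrow>
     (\<forall>n. \<forall>k\<in>{1..2^n}. A n k \<in> sets unit_leb) \<and>
     measure unit_leb (A 0 1) > 0 \<and>
     (\<forall>n. \<forall>k\<in>{1..2^n}.
        A (Suc n) (2*k - 1) \<union> A (Suc n) (2*k) = A n k \<and>
        A (Suc n) (2*k - 1) \<inter> A (Suc n) (2*k) = {} \<and>
        measure unit_leb (A (Suc n) (2*k - 1)) = measure unit_leb (A (Suc n) (2*k)))"

text \<open>For \<open>j \<ge> 2\<close>, the unique way to write \<open>j = 2 ^ n + k\<close> with \<open>1 \<le> k \<le> 2 ^ n\<close>
  has \<open>n = floor_log (j - 1)\<close>. The index \<open>j = 0\<close> is not used.\<close>

definition haar_fun :: "(nat \<Rightarrow> nat \<Rightarrow> real set) \<Rightarrow> nat \<Rightarrow> real \<Rightarrow> real" where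
  "haar_fun A j t =
     (if j \<le> 1 then indicator (A 0 1) t / measure unit_leb (A 0 1)
      else let n = floor_log (j - 1); k = j - 2 ^ n in
        2 ^ n / measure unit_leb (A 0 1) *
          (indicator (A (Suc n) (2*k - 1)) t - indicator (A (Suc n) (2*k)) t))"

definition haar :: "(nat \<Rightarrow> nat \<Rightarrow> real set) \<Rightarrow> nat \<Rightarrow> L1" where
  "haar A j = abs_L1 (haar_fun A j)"

text \<open>The condition \<open>2 ^ n < 2 * j\<close> expresses \<open>2 ^ (n - 1) < j\<close>, also for \<open>n = 0\<close>.\<close>

definition haar_block :: "(nat \<Rightarrow> nat \<Rightarrow> real set) \<Rightarrow> nat \<Rightarrow> L1 set" where
  "haar_block A n = haar A ` {j. 2 ^ n < 2 * j \<and> j \<le> 2 ^ n}"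

lemma haar_fun_1: "haar_fun A 1 t = indicator (A 0 1) t / measure unit_leb (A 0 1)"
  by (simp add: haar_fun_def)

lemma haar_fun_dyadic:
  assumes "1 \<le> k" "k \<le> 2 ^ n"
  shows "haar_fun A (2 ^ n + k) t = 2 ^ n / measure unit_leb (A 0 1) *
           (indicator (A (Suc n) (2*k - 1)) t - indicator (A (Suc n) (2*k)) t)"
proof -
  have "floor_log (2 ^ n + k - 1) = n"
    using assms by (intro floor_log_eqI) auto
  moreover have "\<not> 2 ^ n + k \<le> 1"
  proof -
    have "(1::nat) \<le> 2 ^ n" by simp
    then show ?thesis using assms(1) by linarith
  qed
  ultimately show ?thesis
    by (simp add: haar_fun_def Let_def)
qed

lemma haar_block_0: "haar_block A 0 = {haar A 1}"
proof -
  have "{j. 2 ^ 0 < 2 * j \<and> j \<le> 2 ^ 0} = {1::nat}" by auto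
  then show ?thesis by (simp add: haar_block_def)
qed

lemma haar_block_Suc: "haar_block A (Suc n) = (\<lambda>k. haar A (2 ^ n + k)) ` {1..2 ^ n}"
proof -
  have "{j. 2 ^ Suc n < 2 * j \<and> j \<le> 2 ^ Suc n} = (\<lambda>k. 2 ^ n + k) ` {1..2 ^ n :: nat}"
  proof (intro equalityI subsetI)
    fix j :: nat assume "j \<in> {j. 2 ^ Suc n < 2 * j \<and> j \<le> 2 ^ Suc n}"
    then show "j \<in> (\<lambda>k. 2 ^ n + k) ` {1..2 ^ n}"
      by (intro image_eqI[of _ _ "j - 2 ^ n"]) auto
  qed auto
  then show ?thesis by (simp only: haar_block_def image_image)
qed

lemma integrable_haar_fun:
  assumes A: "dyadic_splitting A" and j: "j \<ge> 1"
  shows "integrable unit_leb (haar_fun A j)"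
proof -
  have ind: "integrable unit_leb (indicator (A n k) :: real \<Rightarrow> real)"
    if "1 \<le> k" "k \<le> 2 ^ n" for n k
  proof -
    have "A n k \<in> sets unit_leb"
      using A that by (auto simp: dyadic_splitting_def)
    moreover have "emeasure unit_leb (A n k) < \<infinity>"
      using finite_measure.emeasure_finite[OF finite_measure_lebesgue_on[OF lmeasurable_interval(1)],
          of 0 1 "A n k"]
      by (simp add: less_top)
    ultimately show ?thesis by simp
  qed
  show ?thesis
  proof (cases "j = 1")
    case True
    then have "haar_fun A j = (\<lambda>t. indicator (A 0 1) t / measure unit_leb (A 0 1))"
      by (simp add: haar_fun_def fun_eq_iff)
    then show ?thesis using ind[of 1 0] by simp
  next
    case False
    define n where "n = floor_log (j - 1)"
    define k where "k = j - 2 ^ n"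
    have "2 ^ n \<le> j - 1" "j - 1 < 2 * 2 ^ n"
      using False j floor_log_exp2_le[of "j - 1"] floor_log_exp2_gt[of "j - 1"]
      by (auto simp: n_def)
    then have k: "1 \<le> k" "k \<le> 2 ^ n" and jk: "j = 2 ^ n + k"
      using False j by (auto simp: k_def)
    have "haar_fun A j = (\<lambda>t. 2 ^ n / measure unit_leb (A 0 1) *
           (indicator (A (Suc n) (2*k - 1)) t - indicator (A (Suc n) (2*k)) t))"
      unfolding jk using haar_fun_dyadic[OF k] by blast
    moreover have "integrable unit_leb (indicator (A (Suc n) (2*k - 1)) :: real \<Rightarrow> real)"
      "integrable unit_leb (indicator (A (Suc n) (2*k)) :: real \<Rightarrow> real)"
      using k by (intro ind; simp)+
    ultimately show ?thesis by simp
  qed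
qed

end

theory Submission
  imports Defs "HOL-Library.Diagonal_Subsequence"
begin

text \<open>
The proof extracts from \<open>T\<close> an oscillation that is present on every subset of a set \<open>B\<close>, and then
splits \<open>B\<close> level by level along it.

A weakly null sequence \<open>f k\<close> witnesses that \<open>T\<close> is not completely continuous. It is uniformly integrable
(\<open>weakly_null_uniformly_integrable\<close>), so its terms can be truncated to uniformly bounded simple
functions. Choosing functionals in \<open>Y\<close> that norm \<open>T (f k)\<close>, passing to weak* convergent subsequences and
taking differences, one gets functionals \<open>v k\<close> in the span of \<open>Y\<close> and simple functions \<open>u k\<close> bounded by
one such that \<open>v k o\<^sub>L T\<close> is weak* null, \<open>u k\<close> is weakly null, and \<open>v k (T (u k))\<close> stays away from zero.
A weak* limit of the functionals \<open>f \<mapsto> v k (T (u k f))\<close> is given by a bounded function, and where this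
function is bounded below by a positive constant the oscillation is hereditary: for each
subset \<open>C\<close> of positive measure, \<open>v k (T (u k 1\<^sub>C))\<close> is eventually at least a fixed multiple of the measure
of \<open>C\<close> (\<open>oscillation_of_non_completely_continuous\<close>).

Suppose the sets of one level have been chosen inside \<open>B\<close>. One large \<open>k\<close> serves all of them. Since
\<open>v k o\<^sub>L T\<close> is weak* null, a small perturbation within the subspace makes it vanish on the finitely many
Haar functions that exist already; since \<open>u k\<close> is weakly null, a small perturbation of its restriction to
each set makes it orthogonal to the constants and to all earlier functionals, including the norming
ones (\<open>controlled_correction\<close>). A version of Lyapunov's theorem (\<open>simple_function_to_sign\<close>) replaces the
perturbed restriction by the difference of the indicators of two halves, without changing its value under
the finitely many functionals involved. These halves form the next level (\<open>splitting_step\<close>). Since the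
construction keeps the new functionals zero on the images of the old Haar functions and the old functionals
zero on the images of the new ones, it gives the biorthogonality and the annihilation statements. The
norming sets exist by the Hahn--Banach theorem and the compactness of finite dimensional balls.

Equivalence of the functionals to the basis of \<open>l\<^sub>1\<close> is a consequence of biorthogonality alone, since normalized
indicators of dyadic sets are signed sums of Haar functions, one from each block, and
all choices of signs after the first term occur (\<open>l1_basis_of_haar_biorthogonal\<close>). The statement on decompositions follows from the
inequality \<open>norm u \<le> \<tau> n * norm (u + w)\<close> for \<open>u\<close> in the span of the images of the first
blocks and \<open>w\<close> in that of the next (\<open>fdd_from_one_step_estimates\<close>).
\<close>

section \<open>Hahn--Banach\<close>

text \<open>The extension step of the Hahn--Banach theorem. A partial functional is represented by its graph,
a subspace \<open>M\<close> of the product with the scalars; domination by the norm already forces such a subspace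
to be single valued. The value \<open>c\<close> at a new point \<open>x\<close> exists because every lower constraint
lies below every upper one, by the triangle inequality.\<close>

lemma dominated_graph_extension:
  fixes M :: "('a::real_normed_vector \<times> real) set"
  assumes M: "subspace M" and dom: "\<And>v r. (v, r) \<in> M \<Longrightarrow> r \<le> norm v"
  shows "\<exists>c. \<forall>v r t. (v, r) \<in> M \<longrightarrow> r + t * c \<le> norm (v + t *\<^sub>R x)"
proof -
  have le: "r - norm (v - x) \<le> norm (w + x) - s" if "(v, r) \<in> M" "(w, s) \<in> M" for v r w s
  proof -
    have "(v + w, r + s) \<in> M"
      using subspace_add[OF M that] by simp
    then have "r + s \<le> norm ((v - x) + (w + x))"
      using dom by simp
    also have "\<dots> \<le> norm (v - x) + norm (w + x)"
      by (rule norm_triangle_ineq)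
    finally show ?thesis by simp
  qed
  define c where "c = (SUP (v, r)\<in>M. r - norm (v - x))"
  have zero: "(0, 0) \<in> M"
    using subspace_0[OF M] by (simp add: zero_prod_def)
  have low: "r - norm (v - x) \<le> c" if "(v, r) \<in> M" for v r
  proof -
    have "bdd_above ((\<lambda>(v, r). r - norm (v - x)) ` M)"
      using le[OF _ zero] by (intro bdd_aboveI2[where M = "norm x"]) force
    then show ?thesis
      unfolding c_def using that by (intro cSUP_upper2[where x = "(v, r)"]) auto
  qed
  have up: "c \<le> norm (w + x) - s" if "(w, s) \<in> M" for w s
    unfolding c_def using zero le[OF _ that] by (intro cSUP_least) auto
  have "r + t * c \<le> norm (v + t *\<^sub>R x)" if vr: "(v, r) \<in> M" for v r t
  proof (cases t "0::real" rule: linorder_cases)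
    case equal
    then show ?thesis using dom[OF vr] by simp
  next
    case greater
    have "(v /\<^sub>R t, r / t) \<in> M"
      using subspace_scale[OF M vr, of "inverse t"] by (simp add: divide_inverse_commute)
    from up[OF this] have "t * c \<le> t * (norm (v /\<^sub>R t + x) - r / t)"
      using greater by simp
    also have "\<dots> = norm (t *\<^sub>R (v /\<^sub>R t + x)) - r"
      using greater by (simp add: right_diff_distrib)
    also have "t *\<^sub>R (v /\<^sub>R t + x) = v + t *\<^sub>R x"
      using greater by (simp add: scaleR_right_distrib)
    finally show ?thesis by simp
  next
    case less
    have "(v /\<^sub>R (- t), r / (- t)) \<in> M"
      using subspace_scale[OF M vr, of "inverse (- t)"] by (simp add: divide_inverse_commute)
    from low[OF this] have "- t * (r / (- t) - norm (v /\<^sub>R (- t) - x)) \<le> - t * c"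
      using less by (intro mult_left_mono) auto
    moreover have "- t * norm (v /\<^sub>R (- t) - x) = norm (v + t *\<^sub>R x)"
    proof -
      have "- t * norm (v /\<^sub>R (- t) - x) = norm ((- t) *\<^sub>R (v /\<^sub>R (- t) - x))"
        unfolding norm_scaleR using less by simp
      also have "(- t) *\<^sub>R (v /\<^sub>R (- t) - x) = v + t *\<^sub>R x"
        using less by (simp add: scaleR_right_diff_distrib)
      finally show ?thesis .
    qed
    moreover have "- t * (r / (- t) - norm (v /\<^sub>R (- t) - x)) = r - (- t * norm (v /\<^sub>R (- t) - x))"
      unfolding right_diff_distrib using less by simp
    ultimately show ?thesis
      by linarith
  qed
  then show ?thesis by blast
qed

text \<open>A maximal dominated graph, which exists by Zorn's lemma, has full domain by the extension step.\<close>

lemma norming_functional: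
  fixes v\<^sub>0 :: "'a::real_normed_vector"
  assumes "v\<^sub>0 \<noteq> 0"
  shows "\<exists>\<phi> :: 'a dual. norm \<phi> = 1 \<and> blinfun_apply \<phi> v\<^sub>0 = norm v\<^sub>0"
proof -
  define \<G> where "\<G> = {G :: ('a \<times> real) set. subspace G \<and>
    (v\<^sub>0, norm v\<^sub>0) \<in> G \<and> (\<forall>(v, r)\<in>G. r \<le> norm v)}"
  have "\<exists>M\<in>\<G>. \<forall>G\<in>\<G>. M \<subseteq> G \<longrightarrow> G = M"
  proof (rule subset_Zorn_nonempty)
    have "span {(v\<^sub>0, norm v\<^sub>0)} \<in> \<G>"
    proof -
      have "\<bar>c\<bar> * norm v\<^sub>0 \<ge> c * norm v\<^sub>0" for c
        by (intro mult_right_mono) auto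
      then have "r \<le> norm v" if "(v, r) \<in> span {(v\<^sub>0, norm v\<^sub>0)}" for v r
        using that by (auto simp: span_singleton)
      then show ?thesis
        by (auto simp: \<G>_def span_base)
    qed
    then show "\<G> \<noteq> {}" by blast
  next
    fix \<C> assume ne: "\<C> \<noteq> {}" and chain: "subset.chain \<G> \<C>"
    then have sub: "\<C> \<subseteq> \<G>" and tot: "\<And>G H. G \<in> \<C> \<Longrightarrow> H \<in> \<C> \<Longrightarrow> G \<subseteq> H \<or> H \<subseteq> G"
      by (auto simp: subset.chain_def)
    have "subspace (\<Union>\<C>)"
    proof (rule subspaceI)
      show "0 \<in> \<Union>\<C>"
        using ne sub subspace_0 by (fastforce simp: \<G>_def)
    next
      fix p q assume "p \<in> \<Union>\<C>" "q \<in> \<Union>\<C>"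
      then obtain G H where GH: "p \<in> G" "G \<in> \<C>" "q \<in> H" "H \<in> \<C>" by blast
      with tot[of G H] obtain K where "K \<in> \<C>" "p \<in> K" "q \<in> K" by blast
      moreover have "subspace K"
        using \<open>K \<in> \<C>\<close> sub by (auto simp: \<G>_def)
      ultimately show "p + q \<in> \<Union>\<C>"
        using subspace_add by blast
    next
      fix p c assume "p \<in> \<Union>\<C>"
      then obtain G where G: "p \<in> G" "G \<in> \<C>" by blast
      moreover have "subspace G"
        using G sub by (auto simp: \<G>_def)
      ultimately show "c *\<^sub>R p \<in> \<Union>\<C>"
        using subspace_scale by blast
    qed
    then show "\<Union>\<C> \<in> \<G>"
      using ne sub by (fastforce simp: \<G>_def)
  qed
  then obtain M where M: "M \<in> \<G>" and maxi: "\<And>G. G \<in> \<G> \<Longrightarrow> M \<subseteq> G \<Longrightarrow> G = M"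
    by blast
  have sub: "subspace M" and v0: "(v\<^sub>0, norm v\<^sub>0) \<in> M"
    and dom: "\<And>v r. (v, r) \<in> M \<Longrightarrow> r \<le> norm v"
    using M by (auto simp: \<G>_def)
  have total: "\<exists>c. (x, c) \<in> M" for x
  proof -
    obtain c where c: "\<And>v r t. (v, r) \<in> M \<Longrightarrow> r + t * c \<le> norm (v + t *\<^sub>R x)"
      using dominated_graph_extension[OF sub dom, of x] by blast
    define G where "G = {p + q | p q. p \<in> M \<and> q \<in> span {(x, c)}}"
    have MG: "M \<subseteq> G"
    proof
      fix p assume "p \<in> M"
      then have "p + 0 \<in> G"
        unfolding G_def using span_zero by blast
      then show "p \<in> G" by simp
    qed
    have "subspace G"
      unfolding G_def by (rule subspace_sums[OF sub subspace_span])
    moreover have "r \<le> norm v" if "(v, r) \<in> G" for v r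
      using that c by (auto simp: G_def span_singleton)
    ultimately have "G \<in> \<G>"
      using MG v0 by (auto simp: \<G>_def)
    with maxi MG have "G = M" by blast
    moreover have "(0, 0) + (x, c) \<in> G"
      unfolding G_def using subspace_0[OF sub] span_base[of "(x, c)" "{(x, c)}"]
      by (force simp: zero_prod_def)
    ultimately show ?thesis by auto
  qed
  \<comment> \<open>two values at one point differ by a value at the origin, which domination makes zero\<close>
  have unique: "r = s" if "(v, r) \<in> M" "(v, s) \<in> M" for v r s
    using dom[of 0 "r - s"] dom[of 0 "s - r"] subspace_diff[OF sub that]
      subspace_diff[OF sub that(2,1)] by simp
  define f where "f x = (THE r. (x, r) \<in> M)" for x
  have f: "(x, f x) \<in> M" for x
  proof -
    obtain c where "(x, c) \<in> M"
      using total by blast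
    then have "f x = c"
      unfolding f_def using unique by (intro the_equality)
    then show ?thesis
      using \<open>(x, c) \<in> M\<close> by simp
  qed
  have f_eq: "f x = r" if "(x, r) \<in> M" for x r
    using unique f that by blast
  have "linear f"
  proof (rule linearI)
    show "f (x + y) = f x + f y" for x y
      using subspace_add[OF sub f[of x] f[of y]] by (intro f_eq) simp
    show "f (c *\<^sub>R x) = c *\<^sub>R f x" for c x
      using subspace_scale[OF sub f[of x], of c] by (intro f_eq) simp
  qed
  moreover have bound: "\<bar>f x\<bar> \<le> norm x" for x
  proof -
    have "(- x, - f x) \<in> M"
      using subspace_scale[OF sub f[of x], of "-1"] by simp
    then show ?thesis
      using dom[OF f[of x]] dom[of "- x" "- f x"] by simp
  qed
  ultimately have bl: "bounded_linear f"
    by (intro bounded_linear_intro[where K = 1]) (auto simp: linear_add linear_scale)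
  define \<phi> where "\<phi> = Blinfun f"
  have app: "blinfun_apply \<phi> = f"
    unfolding \<phi>_def using bl by (rule bounded_linear_Blinfun_apply)
  have fv: "f v\<^sub>0 = norm v\<^sub>0"
    using v0 by (rule f_eq)
  have "norm \<phi> \<le> 1"
    using bound by (intro norm_blinfun_bound) (auto simp: app)
  moreover have "norm v\<^sub>0 \<le> norm \<phi> * norm v\<^sub>0"
    using norm_blinfun[of \<phi> v\<^sub>0] by (simp add: app fv)
  ultimately have "norm \<phi> = 1"
    using assms by (simp add: mult_le_cancel_right1)
  then show ?thesis
    using app fv by auto
qed

section \<open>Finite dimensional subspaces of normed spaces\<close>

lemma closed_if_compact_Int_cball:
  fixes V :: "'a::real_normed_vector set"
  assumes "\<And>r. compact (V \<inter> cball 0 r)"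
  shows "closed V"
  unfolding closed_sequential_limits
proof (intro allI impI)
  fix v l assume v: "(\<forall>n. v n \<in> V) \<and> v \<longlonglongrightarrow> l"
  then have "Bseq v"
    by (metis convergent_def convergent_imp_Bseq)
  then obtain r where "\<And>n. norm (v n) \<le> r"
    by (auto simp: Bseq_def)
  then have "\<forall>n. v n \<in> V \<inter> cball 0 r"
    using v by auto
  then have "l \<in> V \<inter> cball 0 r"
    using compact_imp_closed[OF assms] v unfolding closed_sequential_limits by blast
  then show "l \<in> V" by blast
qed

text \<open>Induction over the generators. If \<open>x\<close> is outside the span of \<open>S\<close>, which is closed by the
induction hypothesis, it has positive distance from it; hence elements of a ball in the larger span have
bounded components, and the ball is cut out of a sum of two compact sets.\<close>

lemma compact_span_Int_cball:
  fixes S :: "'a::real_normed_vector set"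
  assumes "finite S"
  shows "compact (span S \<inter> cball 0 r)"
  using assms
proof (induction S arbitrary: r)
  case empty
  then show ?case
    by (cases "0 \<le> r") simp_all
next
  case (insert x S)
  show ?case
  proof (cases "x \<in> span S")
    case True
    then show ?thesis
      using insert.IH by (simp add: span_redundant)
  next
    case False
    have "closed (span S)"
      by (rule closed_if_compact_Int_cball[OF insert.IH])
    then obtain d where d: "d > 0" "ball x d \<subseteq> - span S"
      using False open_contains_ball[of "- span S"] by auto
    define Q where "Q = {w + u | w u. w \<in> span S \<inter> cball 0 (r + r / d * norm x) \<and>
      u \<in> (\<lambda>t. t *\<^sub>R x) ` {- (r / d)..r / d}}"
    have "compact Q"
      unfolding Q_def
      by (intro compact_sums insert.IH compact_continuous_image continuous_intros compact_Icc)
    moreover have "closed (cball (0::'a) r)"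
      by simp
    ultimately have "compact (Q \<inter> cball 0 r)"
      by (rule compact_Int_closed)
    moreover have "span (insert x S) \<inter> cball 0 r = Q \<inter> cball 0 r"
    proof (intro equalityI subsetI)
      fix v assume v: "v \<in> span (insert x S) \<inter> cball 0 r"
      then obtain t where w: "v - t *\<^sub>R x \<in> span S"
        by (auto simp: span_insert)
      \<comment> \<open>the coefficient of \<open>x\<close> is controlled by the distance from \<open>x\<close> to the span\<close>
      have "\<bar>t\<bar> * d \<le> norm v"
      proof (cases "t = 0")
        case False
        have "(- inverse t) *\<^sub>R (v - t *\<^sub>R x) \<in> span S"
          using w by (rule span_scale)
        then have "(- inverse t) *\<^sub>R (v - t *\<^sub>R x) \<notin> ball x d"
          using d(2) by blast
        then have "d \<le> norm (x - (- inverse t) *\<^sub>R (v - t *\<^sub>R x))"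
          by (simp add: dist_norm)
        then have "\<bar>t\<bar> * d \<le> norm (t *\<^sub>R (x - (- inverse t) *\<^sub>R (v - t *\<^sub>R x)))"
          by (simp add: mult_left_mono)
        also have "t *\<^sub>R (x - (- inverse t) *\<^sub>R (v - t *\<^sub>R x)) = v"
          using False by (simp add: algebra_simps)
        finally show ?thesis .
      qed simp
      then have t: "\<bar>t\<bar> \<le> r / d"
        using v d(1) by (simp add: pos_le_divide_eq)
      have "norm (v - t *\<^sub>R x) \<le> norm v + \<bar>t\<bar> * norm x"
        using norm_triangle_ineq4[of v "t *\<^sub>R x"] by simp
      also have "\<dots> \<le> r + r / d * norm x"
        using v t by (intro add_mono mult_right_mono) auto
      finally have "v - t *\<^sub>R x \<in> span S \<inter> cball 0 (r + r / d * norm x)"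
        using w by simp
      moreover have "t *\<^sub>R x \<in> (\<lambda>t. t *\<^sub>R x) ` {- (r / d)..r / d}"
        using t by (intro imageI) (simp add: abs_le_iff)
      ultimately have "(v - t *\<^sub>R x) + t *\<^sub>R x \<in> Q"
        unfolding Q_def by blast
      then show "v \<in> Q \<inter> cball 0 r"
        using v by simp
    next
      fix v assume "v \<in> Q \<inter> cball 0 r"
      then obtain w t where v: "v = w + t *\<^sub>R x" "w \<in> span S" "v \<in> cball 0 r"
        by (auto simp: Q_def)
      have "w \<in> span (insert x S)"
        using v(2) span_mono[of S "insert x S"] by auto
      then have "v \<in> span (insert x S)"
        unfolding v(1) by (rule span_add[OF _ span_scale[OF span_base]]) simp
      then show "v \<in> span (insert x S) \<inter> cball 0 r"
        using v(3) by simp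
    qed
    ultimately show ?thesis by simp
  qed
qed

lemma closed_finite_span:
  fixes S :: "'a::real_normed_vector set"
  assumes "finite S"
  shows "closed (span S)"
  by (rule closed_if_compact_Int_cball[OF compact_span_Int_cball[OF assms]])

text \<open>A finite net of the compact unit sphere of the span, together with a norming functional for each of
its points, norms the whole span: the loss is governed by the mesh \<open>1 - 1 / \<tau>\<close>. The given functional
\<open>\<phi>\<^sub>0\<close> is added to the set only to keep it nonempty when the span is trivial.\<close>

lemma finite_norming_set:
  fixes S :: "'a::real_normed_vector set" and \<phi>\<^sub>0 :: "'a dual"
  assumes "finite S" "\<tau> > 1" "norm \<phi>\<^sub>0 = 1"
  shows "\<exists>N. finite N \<and> norms_within N (span S) \<tau>"
proof -
  define U where "U = span S \<inter> sphere 0 1"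
  have U_eq: "U = span S \<inter> cball 0 1 \<inter> sphere 0 1"
    by (auto simp: U_def)
  have "compact U"
    unfolding U_eq
  proof (rule compact_Int_closed[OF compact_span_Int_cball[OF assms(1)]])
    have "closed {v :: 'a. norm v = 1}"
      by (intro closed_Collect_eq continuous_intros)
    then show "closed (sphere 0 1 :: 'a set)"
      by (simp add: sphere_def)
  qed
  moreover have "U \<subseteq> (\<Union>v\<in>U. ball v (1 - 1 / \<tau>))"
  proof
    fix v assume "v \<in> U"
    then show "v \<in> (\<Union>v\<in>U. ball v (1 - 1 / \<tau>))"
      using assms(2) by (intro UN_I[of v]) auto
  qed
  ultimately obtain V where V: "finite V" "V \<subseteq> U" "U \<subseteq> (\<Union>v\<in>V. ball v (1 - 1 / \<tau>))"
    by (elim compactE_image[of U U "\<lambda>v. ball v (1 - 1 / \<tau>)"]) (simp, blast)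
  have "\<exists>\<phi> :: 'a dual. norm \<phi> = 1 \<and> blinfun_apply \<phi> v = norm v" if "v \<in> V" for v
  proof (rule norming_functional)
    have "norm v = 1"
      using that V(2) by (auto simp: U_def)
    then show "v \<noteq> 0" by auto
  qed
  then obtain F :: "'a \<Rightarrow> 'a dual" where F: "\<And>v. v \<in> V \<Longrightarrow> norm (F v) = 1"
    "\<And>v. v \<in> V \<Longrightarrow> blinfun_apply (F v) v = norm v"
    by metis
  define N where "N = insert \<phi>\<^sub>0 (F ` V)"
  have "\<exists>\<phi>\<in>N. norm v \<le> \<tau> * \<phi> v" if v: "v \<in> span S" for v
  proof (cases "v = 0")
    case True
    then show ?thesis by (auto simp: N_def)
  next
    case False
    define u where "u = v /\<^sub>R norm v"
    have "u \<in> U"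
      using v False by (auto simp: u_def U_def span_scale)
    then obtain w where w: "w \<in> V" "dist w u < 1 - 1 / \<tau>"
      using V by auto
    have "F w w - F w u \<le> norm (F w (w - u))"
      by (simp add: blinfun.diff_right)
    also have "\<dots> \<le> norm (w - u)"
      using norm_blinfun[of "F w" "w - u"] F(1)[OF w(1)] by simp
    also have "\<dots> < 1 - 1 / \<tau>"
      using w by (simp add: dist_norm)
    finally have "1 / \<tau> < F w u"
      using F(2)[OF w(1)] w(1) V(2) by (auto simp: U_def)
    then have "1 \<le> \<tau> * F w u"
      using assms by (simp add: field_simps)
    then have "norm v * 1 \<le> norm v * (\<tau> * F w u)"
      by (intro mult_left_mono) auto
    also have "\<dots> = \<tau> * F w (norm v *\<^sub>R u)"
      by (simp add: blinfun.scaleR_right)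
    also have "norm v *\<^sub>R u = v"
      using False by (simp add: u_def)
    finally show ?thesis
      using w by (auto simp: N_def)
  qed
  moreover have "finite N" "N \<subseteq> sphere 0 1"
    using V F assms(3) by (auto simp: N_def)
  ultimately show ?thesis
    using assms(2) unfolding norms_within_def by blast
qed

section \<open>Decompositions from one-step norm estimates\<close>

lemma prod_le_prodinf:
  fixes \<tau> :: "nat \<Rightarrow> real"
  assumes "convergent_prod \<tau>" "\<And>n. \<tau> n > 1"
  shows "(\<Prod>n\<in>{N..<M}. \<tau> n) \<le> prodinf \<tau>"
proof -
  have ge: "1 \<le> \<tau> n" and nn: "0 \<le> \<tau> n" for n
    using assms(2)[of n] by auto
  have pos: "0 \<le> (\<Prod>n\<in>A. \<tau> n)" and ge1: "1 \<le> (\<Prod>n\<in>A. \<tau> n)" for A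
    using nn ge by (auto intro: prod_nonneg prod_ge_1)
  have "(\<Prod>n\<in>{N..<M}. \<tau> n) \<le> (\<Prod>n\<in>{N..<M}. \<tau> n) * (\<Prod>n\<in>{..M} - {N..<M}. \<tau> n)"
    using mult_left_mono[OF ge1 pos] by simp
  also have "\<dots> = (\<Prod>n\<le>M. \<tau> n)"
    by (subst prod.subset_diff[of "{N..<M}" "{..M}"]) (auto simp: mult.commute)
  also have "\<dots> \<le> prodinf \<tau>"
  proof (rule LIMSEQ_le_const)
    show "(\<lambda>n. \<Prod>i\<le>n. \<tau> i) \<longlonglongrightarrow> prodinf \<tau>"
      using convergent_prod_LIMSEQ[OF assms(1)] .
    show "\<exists>L. \<forall>n\<ge>L. (\<Prod>n\<le>M. \<tau> n) \<le> (\<Prod>i\<le>n. \<tau> i)"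
    proof (intro exI allI impI)
      fix n assume "M \<le> n"
      have "(\<Prod>n\<le>M. \<tau> n) \<le> (\<Prod>n\<le>M. \<tau> n) * (\<Prod>i\<in>{..n} - {..M}. \<tau> i)"
        using mult_left_mono[OF ge1 pos] by simp
      also have "\<dots> = (\<Prod>i\<le>n. \<tau> i)"
        using \<open>M \<le> n\<close> by (subst prod.subset_diff[of "{..M}" "{..n}"]) (auto simp: mult.commute)
      finally show "(\<Prod>n\<le>M. \<tau> n) \<le> (\<Prod>i\<le>n. \<tau> i)" .
    qed
  qed
  finally show ?thesis .
qed

lemma span_Union_expansion:
  fixes E :: "nat \<Rightarrow> 'a::real_normed_vector set"
  assumes "\<And>n. subspace (E n)" "v \<in> span (\<Union>n. E n)"
  shows "\<exists>e M. (\<forall>n. e n \<in> E n) \<and> (\<forall>n>M. e n = 0) \<and> v = (\<Sum>n\<le>M. e n)"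
  using assms(2)
proof (induction rule: span_induct_alt)
  case base
  show ?case
    using assms(1) by (intro exI[of _ "\<lambda>_. 0"] exI[of _ 0]) (auto simp: subspace_0)
next
  case (step c x y)
  obtain m where m: "x \<in> E m" using step by blast
  obtain e M where e: "\<And>n. e n \<in> E n" "\<And>n. n > M \<Longrightarrow> e n = 0" "y = (\<Sum>n\<le>M. e n)"
    using step by blast
  define d where "d n = (if n = m then c *\<^sub>R x else 0)" for n
  have "d n \<in> E n" for n
    using m assms(1) by (auto simp: d_def subspace_0 subspace_scale)
  moreover have "(\<Sum>n\<le>max M m. d n + e n) = c *\<^sub>R x + y"
  proof -
    have "(\<Sum>n\<le>max M m. e n) = (\<Sum>n\<le>M. e n)"
      using e(2) by (intro sum.mono_neutral_right) auto
    moreover have "(\<Sum>n\<le>max M m. d n) = c *\<^sub>R x"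
      by (simp add: d_def sum.delta)
    ultimately show ?thesis
      by (simp add: sum.distrib e(3))
  qed
  moreover have "d n + e n = 0" if "n > max M m" for n
    using that e(2) by (auto simp: d_def)
  ultimately show ?case
    using e(1) assms(1)
    by (intro exI[of _ "\<lambda>n. d n + e n"] exI[of _ "max M m"]) (auto simp: subspace_add)
qed

text \<open>Iterating the one-step estimate bounds \<open>\<Sum>n\<le>N. e n\<close> by the product of the \<open>\<tau> n\<close> times any longer
sum, and hence times the norm of the sum of the series. Uniqueness of expansions follows at once. For
existence, approximate a point of the closure by finite expansions: by the same bound, their partial
sums of each fixed order converge, and the limits lie in the \<open>E n\<close> because these are closed.\<close>

lemma fdd_from_one_step_estimates:
  fixes E :: "nat \<Rightarrow> 'a::banach set" and \<tau> :: "nat \<Rightarrow> real"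
  assumes fin: "\<And>n. \<exists>B. finite B \<and> E n = span B"
    and step: "\<And>n u w. u \<in> span (\<Union>j\<le>n. E j) \<Longrightarrow> w \<in> E (Suc n) \<Longrightarrow> norm u \<le> \<tau> n * norm (u + w)"
    and \<tau>: "convergent_prod \<tau>" "\<And>n. \<tau> n > 1"
  shows "fdd_of_closed_span E (prodinf \<tau>)"
proof -
  define K where "K = prodinf \<tau>"
  have sub: "subspace (E n)" for n
    using fin[of n] by auto
  have K1: "1 \<le> K"
    using prod_le_prodinf[OF \<tau>, of 0 0] by (simp add: K_def)
  have partial_step: "norm (\<Sum>n\<le>N. e n) \<le> (\<Prod>n\<in>{N..<N+k}. \<tau> n) * norm (\<Sum>n\<le>N+k. e n)"
    if e: "\<And>n. e n \<in> E n" for e N k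
  proof (induction k)
    case (Suc k)
    have "(\<Sum>n\<le>N+k. e n) \<in> span (\<Union>j\<le>N+k. E j)"
      using e by (intro span_sum span_base) auto
    from step[OF this e]
    have "norm (\<Sum>n\<le>N+k. e n) \<le> \<tau> (N+k) * norm (\<Sum>n\<le>N + Suc k. e n)"
      by simp
    then have "(\<Prod>n\<in>{N..<N+k}. \<tau> n) * norm (\<Sum>n\<le>N+k. e n)
        \<le> (\<Prod>n\<in>{N..<N+k}. \<tau> n) * (\<tau> (N+k) * norm (\<Sum>n\<le>N + Suc k. e n))"
      using less_imp_le[OF less_trans[OF zero_less_one \<tau>(2)]]
      by (intro mult_left_mono prod_nonneg) auto
    with Suc show ?case
      by (simp add: mult.assoc)
  qed simp
  have partial: "norm (\<Sum>n\<le>N. e n) \<le> K * norm (\<Sum>n\<le>M. e n)"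
    if e: "\<And>n. e n \<in> E n" and "N \<le> M" for e N M
  proof -
    obtain k where k: "M = N + k"
      using \<open>N \<le> M\<close> le_Suc_ex by blast
    show ?thesis
      using order.trans[OF partial_step[OF e] mult_right_mono[OF prod_le_prodinf[OF \<tau>]]]
      unfolding k K_def by simp
  qed
  have partial_sums: "norm (\<Sum>n\<le>N. e n) \<le> K * norm v" if e: "\<And>n. e n \<in> E n" and v: "e sums v" for e v N
  proof (rule LIMSEQ_le_const)
    show "(\<lambda>M. K * norm (\<Sum>n\<le>M. e n)) \<longlonglongrightarrow> K * norm v"
      using v unfolding sums_def_le by (intro tendsto_intros)
    show "\<exists>M\<^sub>0. \<forall>M\<ge>M\<^sub>0. norm (\<Sum>n\<le>N. e n) \<le> K * norm (\<Sum>n\<le>M. e n)"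
      using partial[OF e] by blast
  qed
  have unique: "e = e'" if "\<And>n. e n \<in> E n" "e sums v" "\<And>n. e' n \<in> E n" "e' sums v" for e e' v
  proof -
    define f where "f n = e n - e' n" for n
    have "f n \<in> E n" for n
      using that sub by (auto simp: f_def subspace_diff)
    moreover have "f sums 0"
      unfolding f_def using sums_diff[OF that(2,4)] by simp
    ultimately have zero: "(\<Sum>n\<le>N. f n) = 0" for N
      using partial_sums[of f 0 N] by simp
    have "f n = 0" for n
      using zero[of n] zero[of "n - 1"] by (cases n) auto
    then show ?thesis
      by (auto simp: f_def fun_eq_iff)
  qed
  have exists: "\<exists>e. (\<forall>n. e n \<in> E n) \<and> e sums v" if v: "v \<in> closure (span (\<Union>n. E n))" for v
  proof -
    obtain x where x: "\<And>i. x i \<in> span (\<Union>n. E n)" "x \<longlonglongrightarrow> v"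
      using v unfolding closure_sequential by auto
    have "\<exists>e M. (\<forall>n. e n \<in> E n) \<and> (\<forall>n>M. e n = 0) \<and> x i = (\<Sum>n\<le>M. e n)" for i
      using span_Union_expansion[OF sub x(1)] .
    then obtain e M where e: "\<And>i n. e i n \<in> E n" "\<And>i n. n > M i \<Longrightarrow> e i n = 0"
      and x_eq: "\<And>i. x i = (\<Sum>n\<le>M i. e i n)"
      by metis
    have x_eq': "(\<Sum>n\<le>N. e i n) = x i" if "N \<ge> M i" for i N
      unfolding x_eq using e(2) that by (intro sum.mono_neutral_right) auto
    \<comment> \<open>the partial sums depend on the approximant in a Lipschitz way, uniformly in their order\<close>
    define P where "P N i = (\<Sum>n\<le>N. e i n)" for N i
    have P_lip: "norm (P N i - P N j) \<le> K * norm (x i - x j)" for N i j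
    proof -
      define L where "L = max N (max (M i) (M j))"
      have "norm (\<Sum>n\<le>N. e i n - e j n) \<le> K * norm (\<Sum>n\<le>L. e i n - e j n)"
        using e sub by (intro partial subspace_diff) (auto simp: L_def)
      then show ?thesis
        by (simp add: sum_subtractf P_def x_eq' L_def)
    qed
    have "Cauchy (P N)" for N
    proof (rule CauchyI)
      fix r :: real assume "r > 0"
      then have "r / K > 0" using K1 by simp
      then obtain i0 where "\<And>i j. i \<ge> i0 \<Longrightarrow> j \<ge> i0 \<Longrightarrow> norm (x i - x j) < r / K"
        using LIMSEQ_imp_Cauchy[OF x(2)] unfolding Cauchy_iff by meson
      then have "K * norm (x i - x j) < r" if "i \<ge> i0" "j \<ge> i0" for i j
        using that K1 by (simp add: field_simps)
      then show "\<exists>i0. \<forall>i\<ge>i0. \<forall>j\<ge>i0. norm (P N i - P N j) < r"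
        using P_lip le_less_trans by meson
    qed
    then have "\<exists>l. P N \<longlonglongrightarrow> l" for N
      by (simp add: Cauchy_convergent_iff convergent_def)
    then obtain Q where Q: "\<And>N. P N \<longlonglongrightarrow> Q N"
      by metis
    \<comment> \<open>the coordinates are recovered as differences of consecutive limits of partial sums\<close>
    define d where "d n = Q n - (if n = 0 then 0 else Q (n - 1))" for n
    have d_lim: "(\<lambda>i. e i n) \<longlonglongrightarrow> d n" for n
    proof (cases n)
      case 0
      then show ?thesis using Q[of 0] by (simp add: d_def P_def [abs_def])
    next
      case (Suc m)
      have "(\<lambda>i. P n i - P m i) \<longlonglongrightarrow> Q n - Q m"
        by (intro tendsto_diff Q)
      then show ?thesis by (simp add: d_def P_def Suc)
    qed
    have "closed (E n)" for n
      using fin[of n] closed_finite_span by auto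
    then have "d n \<in> E n" for n
      using closed_sequentially[of "E n" "\<lambda>i. e i n" "d n"] d_lim e(1) by simp
    moreover have Q_eq: "(\<Sum>n\<le>N. d n) = Q N" for N
      by (induction N) (auto simp: d_def)
    moreover have "(\<lambda>N. \<Sum>n\<le>N. d n) \<longlonglongrightarrow> v"
    proof (rule LIMSEQ_I)
      fix r :: real assume "r > 0"
      then have "r / (K + 1) > 0" using K1 by simp
      then obtain i where i: "norm (x i - v) < r / (K + 1)"
        using LIMSEQ_D[OF x(2)] by blast
      have "norm (Q N - v) < r" if N: "N \<ge> M i" for N
      proof -
        have "(\<lambda>j. norm (P N i - P N j)) \<longlonglongrightarrow> norm (P N i - Q N)"
          by (intro tendsto_intros Q)
        moreover have "(\<lambda>j. K * norm (x i - x j)) \<longlonglongrightarrow> K * norm (x i - v)"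
          by (intro tendsto_intros x)
        ultimately have "norm (P N i - Q N) \<le> K * norm (x i - v)"
          using P_lip by (intro LIMSEQ_le) auto
        moreover have "P N i = x i"
          using x_eq'[OF N] by (simp add: P_def)
        ultimately have "norm (Q N - x i) \<le> K * norm (x i - v)"
          by (simp add: norm_minus_commute)
        then have "norm (Q N - v) \<le> (K + 1) * norm (x i - v)"
          using norm_triangle_ineq[of "Q N - x i" "x i - v"] by (simp add: algebra_simps)
        also have "\<dots> < r"
          using i K1 by (simp add: pos_less_divide_eq mult.commute)
        finally show ?thesis .
      qed
      then show "\<exists>N0. \<forall>N\<ge>N0. norm ((\<Sum>n\<le>N. d n) - v) < r"
        unfolding Q_eq by blast
    qed
    ultimately show ?thesis
      unfolding sums_def_le by blast
  qed
  show ?thesis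
    unfolding fdd_of_closed_span_def
  proof (intro conjI allI ballI impI)
    show "\<exists>!e. (\<forall>n. e n \<in> E n) \<and> e sums v" if v: "v \<in> closure (span (\<Union>n. E n))" for v
      using exists[OF that] unique by blast
    show "0 \<le> prodinf \<tau>"
      using K1 by (simp add: K_def)
  qed (use fin partial_sums in \<open>auto simp: K_def\<close>)
qed

section \<open>Correcting finitely many functionals\<close>

text \<open>A quantitative right inverse for finitely many functionals: the values of \<open>f\<close> under them are attained
by some \<open>e\<close> whose size is controlled by these values alone. So an element on which the functionals
are small can be moved by a small amount to make them vanish exactly. The predicate \<open>P u a\<close> plays
the role of ``\<open>u\<close> lies in the subspace and has size at most \<open>a\<close>''; it covers both a subspace of a
dual with the norm, and simple functions supported in a set with the supremum norm, inside the
space of integrable functions. In the induction, a new functional is either determined by the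
old ones, or there is an element \<open>u\<close> that only the new one sees.\<close>

lemma controlled_correction:
  fixes P :: "'v::real_vector \<Rightarrow> real \<Rightarrow> bool" and L :: "'i \<Rightarrow> 'v \<Rightarrow> real"
  assumes "finite I"
    and zero: "P 0 0"
    and mono: "\<And>u a b. P u a \<Longrightarrow> a \<le> b \<Longrightarrow> P u b"
    and add: "\<And>u v a b. P u a \<Longrightarrow> P v b \<Longrightarrow> P (u + v) (a + b)"
    and scale: "\<And>u a c. P u a \<Longrightarrow> P (c *\<^sub>R u) (\<bar>c\<bar> * a)"
    and lin: "\<And>i. i \<in> I \<Longrightarrow> linear (L i)"
    and bounded: "\<And>i. i \<in> I \<Longrightarrow> \<exists>b\<ge>0. \<forall>u a. P u a \<longrightarrow> \<bar>L i u\<bar> \<le> b * a"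
  shows "\<exists>K\<ge>0. \<forall>f a. P f a \<longrightarrow> (\<exists>e. (\<forall>i\<in>I. L i e = L i f) \<and> P e (K * (\<Sum>i\<in>I. \<bar>L i f\<bar>)))"
  using assms(1) lin bounded
proof (induction I)
  case empty
  then show ?case using zero by (intro exI[of _ 0]) auto
next
  case (insert j I)
  have "\<exists>K\<ge>0. \<forall>f a. P f a \<longrightarrow> (\<exists>e. (\<forall>i\<in>I. L i e = L i f) \<and> P e (K * (\<Sum>i\<in>I. \<bar>L i f\<bar>)))"
    using insert.prems by (intro insert.IH) auto
  then obtain K where K: "K \<ge> 0"
    "\<And>f a. P f a \<Longrightarrow> \<exists>e. (\<forall>i\<in>I. L i e = L i f) \<and> P e (K * (\<Sum>i\<in>I. \<bar>L i f\<bar>))"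
    by blast
  obtain b where b: "b \<ge> 0" "\<And>u a. P u a \<Longrightarrow> \<bar>L j u\<bar> \<le> b * a"
    using insert.prems(2)[of j] by auto
  have lin: "linear (L i)" if "i \<in> insert j I" for i
    using insert.prems that by blast
  show ?case
  proof (cases "\<exists>u a. P u a \<and> (\<forall>i\<in>I. L i u = 0) \<and> L j u \<noteq> 0")
    case False
    have "\<exists>e. (\<forall>i\<in>insert j I. L i e = L i f) \<and> P e (K * (\<Sum>i\<in>insert j I. \<bar>L i f\<bar>))"
      if f: "P f a" for f a
    proof -
      obtain e where e: "\<And>i. i \<in> I \<Longrightarrow> L i e = L i f" "P e (K * (\<Sum>i\<in>I. \<bar>L i f\<bar>))"
        using K(2)[OF f] by blast
      \<comment> \<open>all old functionals vanish on the difference, hence so does the new one\<close>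
      define g where "g = e + (-1) *\<^sub>R f"
      have "P g (K * (\<Sum>i\<in>I. \<bar>L i f\<bar>) + \<bar>-1\<bar> * a)"
        unfolding g_def by (intro add scale e f)
      moreover have Lg: "L i g = L i e - L i f" if "i \<in> insert j I" for i
        using linear_diff[OF lin[OF that], of e f] by (simp add: g_def)
      moreover have "\<forall>i\<in>I. L i g = 0"
        using Lg e(1) by simp
      ultimately have "L j g = 0"
        using False by blast
      then have "L j e = L j f"
        using Lg[of j] by simp
      moreover have "P e (K * (\<Sum>i\<in>insert j I. \<bar>L i f\<bar>))"
        using insert.hyps K(1) by (intro mono[OF e(2)] mult_left_mono) auto
      ultimately show ?thesis
        using e(1) by blast
    qed
    then show ?thesis using K(1) by blast
  next
    case True
    then obtain u\<^sub>0 a\<^sub>0 where u0: "P u\<^sub>0 a\<^sub>0" "\<And>i. i \<in> I \<Longrightarrow> L i u\<^sub>0 = 0" "L j u\<^sub>0 \<noteq> 0"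
      by blast
    define u where "u = inverse (L j u\<^sub>0) *\<^sub>R u\<^sub>0"
    define c where "c = \<bar>inverse (L j u\<^sub>0)\<bar> * \<bar>a\<^sub>0\<bar>"
    have "P u\<^sub>0 \<bar>a\<^sub>0\<bar>"
      by (rule mono[OF u0(1)]) simp
    then have u: "P u c" "c \<ge> 0"
      unfolding u_def c_def by (simp_all add: scale del: abs_inverse)
    have uj: "L j u = 1" and uI: "\<And>i. i \<in> I \<Longrightarrow> L i u = 0"
      using u0(2,3) lin unfolding u_def by (simp_all add: linear_scale)
    define K' where "K' = K + (1 + b * K) * c"
    have K': "K \<le> K'" "c \<le> K'" "K + b * K * c \<le> K'"
      using K(1) b(1) u(2) by (auto simp: K'_def algebra_simps)
    have "\<exists>e. (\<forall>i\<in>insert j I. L i e = L i f) \<and> P e (K' * (\<Sum>i\<in>insert j I. \<bar>L i f\<bar>))"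
      if f: "P f a" for f a
    proof -
      define s where "s = (\<Sum>i\<in>I. \<bar>L i f\<bar>)"
      have "s \<ge> 0" by (simp add: s_def sum_nonneg)
      obtain e where e: "\<And>i. i \<in> I \<Longrightarrow> L i e = L i f" "P e (K * s)"
        using K(2)[OF f] unfolding s_def by blast
      define t where "t = L j f - L j e"
      have "\<bar>t\<bar> \<le> \<bar>L j f\<bar> + b * (K * s)"
        unfolding t_def using b(2)[OF e(2)] by linarith
      then have "K * s + \<bar>t\<bar> * c \<le> K * s + (\<bar>L j f\<bar> + b * (K * s)) * c"
        using u(2) by (intro add_left_mono mult_right_mono)
      also have "\<dots> = (K + b * K * c) * s + c * \<bar>L j f\<bar>"
        by (simp add: algebra_simps)
      also have "\<dots> \<le> K' * s + K' * \<bar>L j f\<bar>"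
        using K' \<open>s \<ge> 0\<close> by (intro add_mono mult_right_mono) auto
      also have "\<dots> = K' * (\<Sum>i\<in>insert j I. \<bar>L i f\<bar>)"
        using insert.hyps by (simp add: s_def algebra_simps)
      finally have "P (e + t *\<^sub>R u) (K' * (\<Sum>i\<in>insert j I. \<bar>L i f\<bar>))"
        by (rule mono[rotated]) (intro add scale e u)
      moreover have "L i (e + t *\<^sub>R u) = L i f" if "i \<in> insert j I" for i
        using that lin[OF that] e(1) uj uI by (auto simp: linear_add linear_scale t_def)
      ultimately show ?thesis by blast
    qed
    then show ?thesis using K' K(1) by (meson order.trans)
  qed
qed

section \<open>Integrable functions and their functionals\<close>

interpretation unit_leb: finite_measure unit_leb
  by (rule finite_measure_lebesgue_on) simp

lemma measure_unit_leb_le_1: "measure unit_leb E \<le> 1"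
proof -
  have "measure unit_leb E \<le> measure unit_leb (space unit_leb)"
    by (rule unit_leb.bounded_measure)
  also have "\<dots> = 1"
    by (simp add: measure_restrict_space)
  finally show ?thesis .
qed

lemma abs_L1_eq_iff:
  assumes "integrable unit_leb f" "integrable unit_leb g"
  shows "abs_L1 f = abs_L1 g \<longleftrightarrow> (AE t in unit_leb. f t = g t)"
  using Quotient3_rel[OF Quotient3_L1, of f g] assms by (auto simp: L1_rel_def)

lemma integrable_rep_L1: "integrable unit_leb (rep_L1 u)"
  using Quotient3_rep_reflp[OF Quotient3_L1, of u] by (simp add: L1_rel_def)

lemma abs_rep_L1: "abs_L1 (rep_L1 u) = u"
  by (rule Quotient3_abs_rep[OF Quotient3_L1])

lemma abs_L1_add:
  assumes "integrable unit_leb f" "integrable unit_leb g"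
  shows "abs_L1 f + abs_L1 g = abs_L1 (\<lambda>t. f t + g t)"
  using assms by (simp add: plus_L1.abs_eq L1_rel_def)

lemma abs_L1_scaleR:
  assumes "integrable unit_leb f"
  shows "c *\<^sub>R abs_L1 f = abs_L1 (\<lambda>t. c * f t)"
  using assms by (simp add: scaleR_L1.abs_eq L1_rel_def)

lemma abs_L1_zero: "abs_L1 (\<lambda>_. 0) = 0"
  by (simp add: zero_L1.abs_eq)

definition ind :: "real set \<Rightarrow> L1" where
  "ind E = abs_L1 (indicator E)"

lemma integrable_indicator_unit:
  "E \<in> sets unit_leb \<Longrightarrow> integrable unit_leb (indicator E :: real \<Rightarrow> real)"
  by (simp add: unit_leb.emeasure_finite less_top[symmetric])

lemma sets_unit_leb_Int: "E \<in> sets unit_leb \<Longrightarrow> E \<inter> {0..1} = E"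
  using sets.sets_into_space[of E unit_leb] by auto

lemma norm_ind: "E \<in> sets unit_leb \<Longrightarrow> norm (ind E) = measure unit_leb E"
  by (simp add: ind_def norm_abs_L1 integrable_indicator_unit sets_unit_leb_Int)

lemma ind_empty: "ind {} = 0"
proof -
  have "(indicator {} :: real \<Rightarrow> real) = (\<lambda>_. 0)"
    by auto
  then show ?thesis
    by (simp add: ind_def abs_L1_zero)
qed

lemma ind_Un:
  assumes "A \<in> sets unit_leb" "B \<in> sets unit_leb" "A \<inter> B = {}"
  shows "ind (A \<union> B) = ind A + ind B"
proof -
  have "(indicator (A \<union> B) :: real \<Rightarrow> real) = (\<lambda>t. indicator A t + indicator B t)"
    using assms(3) by (auto simp: indicator_def fun_eq_iff)
  then show ?thesis
    using assms by (simp add: ind_def abs_L1_add integrable_indicator_unit)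
qed

lemma ind_Diff:
  assumes "A \<in> sets unit_leb" "B \<in> sets unit_leb" "B \<subseteq> A"
  shows "ind (A - B) = ind A - ind B"
proof -
  have "ind A = ind (B \<union> (A - B))"
    using assms by (simp add: Un_absorb1)
  also have "\<dots> = ind B + ind (A - B)"
    using assms by (intro ind_Un) auto
  finally show ?thesis by simp
qed

lemma ind_finite_Union:
  assumes "finite I" "\<And>i. i \<in> I \<Longrightarrow> A i \<in> sets unit_leb" "disjoint_family_on A I"
  shows "ind (\<Union>i\<in>I. A i) = (\<Sum>i\<in>I. ind (A i))"
  using assms
proof (induction I)
  case empty
  then show ?case by (simp add: ind_empty)
next
  case (insert i I)
  have "ind (A i \<union> (\<Union>i\<in>I. A i)) = ind (A i) + ind (\<Union>i\<in>I. A i)"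
    using insert by (intro ind_Un) (auto simp: disjoint_family_on_def)
  moreover have "disjoint_family_on A I"
    using insert.prems(2) by (auto simp: disjoint_family_on_def)
  ultimately show ?case
    using insert by simp
qed

lemma ind_incseq_limit:
  assumes "\<And>n. A n \<in> sets unit_leb" "incseq A"
  shows "(\<lambda>n. ind (A n)) \<longlonglongrightarrow> ind (\<Union>n. A n)"
proof -
  have [measurable]: "(\<Union>n. A n) \<in> sets unit_leb"
    using assms(1) by blast
  have "norm (ind (A n) - ind (\<Union>n. A n)) = measure unit_leb (\<Union>n. A n) - measure unit_leb (A n)" for n
  proof -
    have "norm (ind (A n) - ind (\<Union>n. A n)) = norm (ind ((\<Union>n. A n) - A n))"
      using assms(1) by (subst ind_Diff) (auto simp: norm_minus_commute)
    also have "\<dots> = measure unit_leb ((\<Union>n. A n) - A n)"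
      using assms(1) by (intro norm_ind) auto
    also have "\<dots> = measure unit_leb (\<Union>n. A n) - measure unit_leb (A n)"
      using assms(1) by (intro unit_leb.finite_measure_Diff) auto
    finally show ?thesis .
  qed
  moreover have "(\<lambda>n. measure unit_leb (A n)) \<longlonglongrightarrow> measure unit_leb (\<Union>n. A n)"
    using assms by (intro unit_leb.finite_Lim_measure_incseq) auto
  then have "(\<lambda>n. measure unit_leb (\<Union>n. A n) - measure unit_leb (A n)) \<longlonglongrightarrow> 0"
    using tendsto_diff[OF tendsto_const, of "\<lambda>n. measure unit_leb (A n)"
        "measure unit_leb (\<Union>n. A n)" sequentially "measure unit_leb (\<Union>n. A n)"] by simp
  ultimately have "(\<lambda>n. norm (ind (A n) - ind (\<Union>n. A n))) \<longlonglongrightarrow> 0"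
    by simp
  then show ?thesis
    by (simp add: tendsto_norm_zero_iff LIM_zero_iff)
qed

lemma ind_sums:
  assumes "range A \<subseteq> sets unit_leb" "disjoint_family A"
  shows "(\<lambda>n. ind (A n)) sums ind (\<Union>n. A n)"
proof -
  have "(\<lambda>n. ind (\<Union>i<n. A i)) \<longlonglongrightarrow> ind (\<Union>n. \<Union>i<n. A i)"
    using assms(1) by (intro ind_incseq_limit incseq_SucI UN_mono) auto
  moreover have "ind (\<Union>i<n. A i) = (\<Sum>i<n. ind (A i))" for n
    using assms by (intro ind_finite_Union) (auto simp: disjoint_family_on_def)
  moreover have "(\<Union>n. \<Union>i<n. A i) = (\<Union>n. A n)"
    by auto
  ultimately show ?thesis
    by (simp add: sums_def)
qed

lemma dominated_L1_limit:
  assumes f: "integrable unit_leb f" and s: "\<And>i. integrable unit_leb (s i)"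
    and w: "integrable unit_leb w"
    and lim: "AE t in unit_leb. (\<lambda>i. s i t) \<longlonglongrightarrow> f t"
    and dom: "\<And>i. AE t in unit_leb. \<bar>s i t\<bar> \<le> w t"
  shows "(\<lambda>i. abs_L1 (s i)) \<longlonglongrightarrow> abs_L1 f"
proof -
  have "(\<lambda>i. \<integral>t. \<bar>s i t - f t\<bar> \<partial>unit_leb) \<longlonglongrightarrow> (\<integral>t. 0 \<partial>unit_leb)"
  proof (rule integral_dominated_convergence[where w = "\<lambda>t. w t + \<bar>f t\<bar>"])
    show "AE t in unit_leb. (\<lambda>i. \<bar>s i t - f t\<bar>) \<longlonglongrightarrow> 0"
      using lim by eventually_elim (simp add: LIM_zero tendsto_rabs_zero)
    show "AE t in unit_leb. norm \<bar>s i t - f t\<bar> \<le> w t + \<bar>f t\<bar>" for i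
      using dom[of i] by eventually_elim simp
  qed (use f s w in auto)
  then have "(\<lambda>i. norm (abs_L1 (s i) - abs_L1 f)) \<longlonglongrightarrow> 0"
    using f s by (simp add: abs_L1_diff norm_abs_L1)
  then show ?thesis
    by (simp add: tendsto_norm_zero_iff LIM_zero_iff)
qed

text \<open>Simple functions are dense.\<close>

lemma L1_closed_subspace_UNIV:
  assumes "closed V" "subspace V" and ind: "\<And>E. E \<in> sets unit_leb \<Longrightarrow> ind E \<in> V"
  shows "V = UNIV"
proof -
  have "abs_L1 f \<in> V" if "integrable unit_leb f" for f
    using that
  proof (induction rule: integrable_induct)
    case (base A c)
    have "abs_L1 (\<lambda>t. indicator A t *\<^sub>R c) = c *\<^sub>R ind A"
      using base by (simp add: ind_def abs_L1_scaleR integrable_indicator_unit mult.commute)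
    then show ?case
      using base ind assms(2) by (simp add: subspace_scale)
  next
    case (add f g)
    then show ?case
      using subspace_add[OF assms(2)] by (metis abs_L1_add)
  next
    case (lim f s)
    have "(\<lambda>i. abs_L1 (s i)) \<longlonglongrightarrow> abs_L1 f"
      using lim by (intro dominated_L1_limit[where w = "\<lambda>t. 2 * \<bar>f t\<bar>"]) auto
    then show ?case
      using closed_sequentially[OF assms(1), of "\<lambda>i. abs_L1 (s i)"] lim by simp
  qed
  then show ?thesis
    by (metis UNIV_eq_I abs_rep_L1 integrable_rep_L1)
qed

lemma L1_functional_eqI:
  fixes l l' :: "L1 \<Rightarrow>\<^sub>L 'b::real_normed_vector"
  assumes "\<And>E. E \<in> sets unit_leb \<Longrightarrow> l (ind E) = l' (ind E)"
  shows "l = l'"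
proof -
  have "closed {u. l u = l' u}"
    by (intro closed_Collect_eq continuous_intros)
  moreover have "subspace {u. l u = l' u}"
    by (auto simp: subspace_def blinfun.bilinear_simps)
  ultimately have "{u. l u = l' u} = UNIV"
    by (rule L1_closed_subspace_UNIV) (simp add: assms)
  then show ?thesis
    by (intro blinfun_eqI) blast
qed

text \<open>The bound is required everywhere, not just almost everywhere, so that it can be used pointwise.\<close>

definition bdd_meas :: "real \<Rightarrow> (real \<Rightarrow> real) \<Rightarrow> bool" where
  "bdd_meas K \<phi> \<longleftrightarrow> \<phi> \<in> borel_measurable unit_leb \<and> (\<forall>t. \<bar>\<phi> t\<bar> \<le> K)"

lemma bdd_meas_nonneg: "bdd_meas K \<phi> \<Longrightarrow> 0 \<le> K"
  unfolding bdd_meas_def using abs_ge_zero order.trans by blast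

lemma bdd_meas_mult_integrable:
  assumes "bdd_meas K \<phi>" "integrable unit_leb f"
  shows "integrable unit_leb (\<lambda>t. \<phi> t * f t)"
proof (rule Bochner_Integration.integrable_bound)
  show "integrable unit_leb (\<lambda>t. K * f t)"
    using assms by simp
  show "(\<lambda>t. \<phi> t * f t) \<in> borel_measurable unit_leb"
    using assms by (auto simp: bdd_meas_def)
  show "AE t in unit_leb. norm (\<phi> t * f t) \<le> norm (K * f t)"
    using assms bdd_meas_nonneg[OF assms(1)]
    by (auto simp: bdd_meas_def abs_mult intro!: AE_I2 mult_right_mono)
qed

lemma bdd_meas_mult_integral_le:
  assumes "bdd_meas K \<phi>" "integrable unit_leb f"
  shows "(\<integral>t. \<bar>\<phi> t * f t\<bar> \<partial>unit_leb) \<le> K * (\<integral>t. \<bar>f t\<bar> \<partial>unit_leb)"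
proof -
  have "(\<integral>t. \<bar>\<phi> t * f t\<bar> \<partial>unit_leb) \<le> (\<integral>t. K * \<bar>f t\<bar> \<partial>unit_leb)"
  proof (rule integral_mono)
    show "integrable unit_leb (\<lambda>t. \<bar>\<phi> t * f t\<bar>)"
      using bdd_meas_mult_integrable[OF assms] by (rule integrable_abs)
    show "integrable unit_leb (\<lambda>t. K * \<bar>f t\<bar>)"
      using assms(2) by simp
    show "\<bar>\<phi> t * f t\<bar> \<le> K * \<bar>f t\<bar>" for t
      using assms(1) by (auto simp: abs_mult bdd_meas_def intro!: mult_right_mono)
  qed
  then show ?thesis by simp
qed

lemma integrable_bdd_meas: "bdd_meas K \<phi> \<Longrightarrow> integrable unit_leb \<phi>"
  using bdd_meas_mult_integrable[of K \<phi> "\<lambda>_. 1"] by simp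

lemma bdd_meas_indicator: "E \<in> sets unit_leb \<Longrightarrow> bdd_meas 1 (indicator E)"
  by (auto simp: bdd_meas_def indicator_def)

lemma norm_bdd_meas_le:
  assumes "bdd_meas K \<phi>"
  shows "norm (abs_L1 \<phi>) \<le> K"
proof -
  have "(\<integral>t. \<bar>\<phi> t\<bar> \<partial>unit_leb) \<le> (\<integral>t. K \<partial>unit_leb)"
    using assms integrable_bdd_meas[OF assms] by (intro integral_mono) (auto simp: bdd_meas_def)
  then show ?thesis
    using norm_abs_L1[OF integrable_bdd_meas[OF assms]] by (simp add: measure_restrict_space)
qed

definition mult_op :: "(real \<Rightarrow> real) \<Rightarrow> L1 \<Rightarrow>\<^sub>L L1" where
  "mult_op \<phi> = Blinfun (\<lambda>u. abs_L1 (\<lambda>t. \<phi> t * rep_L1 u t))"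

lemma
  assumes \<phi>: "bdd_meas K \<phi>"
  shows mult_op_abs: "integrable unit_leb f \<Longrightarrow> mult_op \<phi> (abs_L1 f) = abs_L1 (\<lambda>t. \<phi> t * f t)"
    and norm_mult_op_le: "norm (mult_op \<phi>) \<le> K"
proof -
  define M where "M u = abs_L1 (\<lambda>t. \<phi> t * rep_L1 u t)" for u
  note int = bdd_meas_mult_integrable[OF \<phi>]
  have M_abs: "M (abs_L1 f) = abs_L1 (\<lambda>t. \<phi> t * f t)" if f: "integrable unit_leb f" for f
  proof -
    have "AE t in unit_leb. rep_L1 (abs_L1 f) t = f t"
      using abs_L1_eq_iff[OF integrable_rep_L1 f] abs_rep_L1 by blast
    then have "AE t in unit_leb. \<phi> t * rep_L1 (abs_L1 f) t = \<phi> t * f t"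
      by eventually_elim simp
    then show ?thesis
      using abs_L1_eq_iff[OF int[OF integrable_rep_L1] int[OF f]] by (simp add: M_def)
  qed
  have M_norm: "norm (M u) \<le> norm u * K" for u
  proof (cases u rule: L1_cases)
    case (1 f)
    then show ?thesis
      using bdd_meas_mult_integral_le[OF \<phi>, of f] norm_abs_L1[OF int[of f]]
      by (simp add: M_abs norm_abs_L1 mult.commute[of _ K])
  qed
  have "bounded_linear M"
  proof (rule bounded_linear_intro)
    fix u v
    show "M (u + v) = M u + M v"
    proof (cases u rule: L1_cases; cases v rule: L1_cases)
      fix f g assume "integrable unit_leb f" "u = abs_L1 f" "integrable unit_leb g" "v = abs_L1 g"
      then show ?thesis
        using int by (simp add: M_abs abs_L1_add distrib_left)
    qed
    show "M (c *\<^sub>R u) = c *\<^sub>R M u" for c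
      using int by (cases u rule: L1_cases) (simp add: M_abs abs_L1_scaleR mult.left_commute)
  qed (rule M_norm)
  then have app: "blinfun_apply (mult_op \<phi>) = M"
    unfolding mult_op_def M_def [abs_def] by (rule bounded_linear_Blinfun_apply)
  show "mult_op \<phi> (abs_L1 f) = abs_L1 (\<lambda>t. \<phi> t * f t)" if "integrable unit_leb f"
    using M_abs[OF that] by (simp add: app)
  show "norm (mult_op \<phi>) \<le> K"
    using M_norm bdd_meas_nonneg[OF \<phi>] by (intro norm_blinfun_bound) (auto simp: app mult.commute)
qed

definition integ :: "L1 dual" where
  "integ = Blinfun (\<lambda>u. \<integral>t. rep_L1 u t \<partial>unit_leb)"

lemma integ_abs:
  assumes "integrable unit_leb f"
  shows "integ (abs_L1 f) = (\<integral>t. f t \<partial>unit_leb)"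
proof -
  define I where "I u = (\<integral>t. rep_L1 u t \<partial>unit_leb)" for u
  have I_abs: "I (abs_L1 f) = (\<integral>t. f t \<partial>unit_leb)" if f: "integrable unit_leb f" for f
    unfolding I_def using f integrable_rep_L1 abs_L1_eq_iff[OF integrable_rep_L1 f] abs_rep_L1
    by (intro integral_cong_AE) auto
  have "bounded_linear I"
  proof (rule bounded_linear_intro)
    fix u v
    show "I (u + v) = I u + I v"
    proof (cases u rule: L1_cases; cases v rule: L1_cases)
      fix f g assume "integrable unit_leb f" "u = abs_L1 f" "integrable unit_leb g" "v = abs_L1 g"
      then show ?thesis
        by (simp add: I_abs abs_L1_add)
    qed
    show "I (c *\<^sub>R u) = c *\<^sub>R I u" for c
      by (cases u rule: L1_cases) (simp add: I_abs abs_L1_scaleR)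
    show "norm (I u) \<le> norm u * 1"
      by (cases u rule: L1_cases) (simp add: I_abs norm_abs_L1)
  qed
  then have "blinfun_apply integ = I"
    unfolding integ_def I_def [abs_def] by (rule bounded_linear_Blinfun_apply)
  then show ?thesis
    using I_abs[OF assms] by simp
qed

lemma integ_ind: "E \<in> sets unit_leb \<Longrightarrow> integ (ind E) = measure unit_leb E"
  by (simp add: ind_def integ_abs integrable_indicator_unit sets_unit_leb_Int)

definition pairing :: "(real \<Rightarrow> real) \<Rightarrow> L1 dual" where
  "pairing \<phi> = integ o\<^sub>L mult_op \<phi>"

lemma pairing_abs:
  assumes "bdd_meas K \<phi>" "integrable unit_leb f"
  shows "pairing \<phi> (abs_L1 f) = (\<integral>t. \<phi> t * f t \<partial>unit_leb)"
  using assms by (simp add: pairing_def mult_op_abs integ_abs bdd_meas_mult_integrable)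

lemma pairing_le:
  assumes "bdd_meas K \<phi>"
  shows "\<bar>pairing \<phi> u\<bar> \<le> K * norm u"
proof (cases u rule: L1_cases)
  case (1 f)
  have "\<bar>\<integral>t. \<phi> t * f t \<partial>unit_leb\<bar> \<le> (\<integral>t. \<bar>\<phi> t * f t\<bar> \<partial>unit_leb)"
    by (rule integral_abs_bound)
  also have "\<dots> \<le> (\<integral>t. K * \<bar>f t\<bar> \<partial>unit_leb)"
    using 1 by (simp add: bdd_meas_mult_integral_le[OF assms])
  finally show ?thesis
    using 1 by (simp add: pairing_abs[OF assms] norm_abs_L1)
qed

text \<open>Adding \<open>norm l\<close> times the measure to \<open>E \<mapsto> l (ind E)\<close> makes it a positive measure, whose
Radon--Nikodym density gives the representing function after the shift is removed. Averages of that function over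
sets are bounded by \<open>norm l\<close>, and therefore so is the function.\<close>

lemma L1_dual_density:
  fixes l :: "L1 dual"
  shows "\<exists>w. bdd_meas (norm l) w \<and> l = pairing w"
proof -
  define K where "K = norm l"
  have l_le: "\<bar>l (ind E)\<bar> \<le> K * measure unit_leb E" if "E \<in> sets unit_leb" for E
    using norm_blinfun[of l "ind E"] that by (simp add: K_def norm_ind)
  define m where "m E = l (ind E) + K * measure unit_leb E" for E
  have m_nonneg: "0 \<le> m E" if "E \<in> sets unit_leb" for E
    using l_le[OF that] by (simp add: m_def)
  define N where "N = measure_of (space unit_leb) (sets unit_leb) (\<lambda>E. ennreal (m E))"
  have sets_N: "sets N = sets unit_leb"
    unfolding N_def by (simp only: sets.sets_measure_of_eq)
  have emeasure_N: "emeasure N E = ennreal (m E)" if E: "E \<in> sets unit_leb" for E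
  proof (rule emeasure_measure_of[OF N_def])
    show "sets unit_leb \<subseteq> Pow (space unit_leb)"
      by (rule sets.space_closed)
    show "E \<in> sets N"
      using E sets_N by simp
    show "positive (sets N) (\<lambda>E. ennreal (m E))"
      by (simp add: positive_def m_def ind_empty)
    show "countably_additive (sets N) (\<lambda>E. ennreal (m E))"
      unfolding countably_additive_def sets_N
    proof (intro allI impI)
      fix A :: "nat \<Rightarrow> real set"
      assume A: "range A \<subseteq> sets unit_leb" "disjoint_family A" "(\<Union>i. A i) \<in> sets unit_leb"
      have "(\<lambda>i. l (ind (A i))) sums l (ind (\<Union>i. A i))"
        by (rule bounded_linear.sums[OF blinfun.bounded_linear_right ind_sums[OF A(1,2)]])
      then have "(\<lambda>i. m (A i)) sums m (\<Union>i. A i)"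
        unfolding m_def using A
        by (intro sums_add sums_mult unit_leb.finite_measure_UNION) auto
      then show "(\<Sum>i. ennreal (m (A i))) = ennreal (m (\<Union>i. A i))"
        using A(1) m_nonneg by (intro suminf_ennreal_eq) auto
    qed
  qed
  have fin: "finite_measure N"
    using emeasure_N[of "space unit_leb"] sets_eq_imp_space_eq[OF sets_N]
    by (intro finite_measureI) simp
  have ac: "absolutely_continuous unit_leb N"
    unfolding absolutely_continuous_def
  proof
    fix E assume "E \<in> null_sets unit_leb"
    then have E: "E \<in> sets unit_leb" "measure unit_leb E = 0"
      by (auto simp: null_sets_def measure_def)
    then show "E \<in> null_sets N"
      using l_le[of E] by (auto simp: null_sets_def emeasure_N sets_N m_def)
  qed
  obtain D where D: "D \<in> borel_measurable unit_leb" "\<And>x. 0 \<le> D x"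
    "AE x in unit_leb. RN_deriv unit_leb N x = ennreal (D x)"
    using unit_leb.real_RN_deriv[OF fin ac sets_N] by metis
  have "density unit_leb D = density unit_leb (RN_deriv unit_leb N)"
    using D by (intro density_cong) auto
  then have dens: "density unit_leb D = N"
    using unit_leb.density_RN_deriv[OF ac sets_N] by simp
  have D_int_nn: "(\<integral>\<^sup>+t. ennreal (D t) * indicator E t \<partial>unit_leb) = ennreal (m E)"
    if "E \<in> sets unit_leb" for E
    using emeasure_density[of "\<lambda>t. ennreal (D t)" unit_leb E] D(1) that emeasure_N[OF that]
    by (simp add: dens)
  have D_int: "has_bochner_integral unit_leb (\<lambda>t. D t * indicator E t) (m E)"
    if "E \<in> sets unit_leb" for E
  proof (rule has_bochner_integral_nn_integral)
    show "(\<lambda>t. D t * indicator E t) \<in> borel_measurable unit_leb"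
      using D(1) that by measurable
    have "(\<integral>\<^sup>+t. ennreal (D t * indicator E t) \<partial>unit_leb) = (\<integral>\<^sup>+t. ennreal (D t) * indicator E t \<partial>unit_leb)"
      by (intro nn_integral_cong) (auto simp: indicator_def)
    then show "(\<integral>\<^sup>+t. ennreal (D t * indicator E t) \<partial>unit_leb) = ennreal (m E)"
      using D_int_nn[OF that] by simp
  qed (use D m_nonneg that in auto)
  define v where "v t = D t - K" for t
  have v_meas [measurable]: "v \<in> borel_measurable unit_leb"
    unfolding v_def using D(1) by simp
  have v_int: "has_bochner_integral unit_leb (\<lambda>t. v t * indicator E t) (l (ind E))"
    if "E \<in> sets unit_leb" for E
  proof -
    have "has_bochner_integral unit_leb (\<lambda>t. K * indicator E t) (K * measure unit_leb E)"
      using that by (intro has_bochner_integral_mult_right has_bochner_integral_real_indicator)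
        (auto simp: unit_leb.emeasure_finite less_top[symmetric])
    from has_bochner_integral_diff[OF D_int[OF that] this] show ?thesis
      by (simp add: v_def m_def left_diff_distrib)
  qed
  have v_integrable: "integrable unit_leb v"
  proof -
    have "integrable unit_leb (\<lambda>t. D t * indicator (space unit_leb) t) = integrable unit_leb D"
      by (intro Bochner_Integration.integrable_cong) auto
    then have "integrable unit_leb D"
      using D_int[of "space unit_leb"] by (simp add: has_bochner_integral_iff)
    then show ?thesis
      unfolding v_def by simp
  qed
  have bound: "AE t in unit_leb. v t \<in> {- K..K}"
  proof (rule unit_leb.averaging_theorem[OF v_integrable])
    fix E assume E: "E \<in> sets unit_leb" "measure unit_leb E > 0"
    have "set_lebesgue_integral unit_leb E v = l (ind E)"
      using v_int[OF E(1)] by (simp add: set_lebesgue_integral_def has_bochner_integral_iff mult.commute)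
    then show "(1 / measure unit_leb E) *\<^sub>R set_lebesgue_integral unit_leb E v \<in> {- K..K}"
      using l_le[OF E(1)] E(2) by (simp add: abs_le_iff pos_divide_le_eq pos_le_divide_eq)
  qed simp
  \<comment> \<open>the bound holds almost everywhere; truncation makes it hold everywhere\<close>
  define w where "w t = max (- K) (min K (v t))" for t
  have "bdd_meas K w"
  proof -
    have "\<bar>max (- K) (min K (v t))\<bar> \<le> K" for t
      using norm_ge_zero[of l] unfolding K_def by linarith
    then show ?thesis
      by (simp add: bdd_meas_def w_def [abs_def])
  qed
  moreover have vw: "AE t in unit_leb. v t = w t"
    using bound by eventually_elim (simp add: w_def)
  have "l = pairing w"
  proof (rule L1_functional_eqI)
    fix E assume E: "E \<in> sets unit_leb"
    have "l (ind E) = (\<integral>t. v t * indicator E t \<partial>unit_leb)"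
      using v_int[OF E] by (simp add: has_bochner_integral_iff)
    also have "\<dots> = (\<integral>t. w t * indicator E t \<partial>unit_leb)"
      using vw E \<open>bdd_meas K w\<close> by (intro integral_cong_AE) (auto simp: bdd_meas_def)
    also have "\<dots> = pairing w (ind E)"
      unfolding ind_def using pairing_abs[OF \<open>bdd_meas K w\<close> integrable_indicator_unit[OF E]] by simp
    finally show "l (ind E) = pairing w (ind E)" .
  qed
  ultimately show ?thesis
    unfolding K_def by blast
qed

section \<open>Separability and weak* sequential compactness\<close>

lemma measure_unit_leb_Ioc_le:
  assumes "a \<le> b"
  shows "measure unit_leb ({a<..b} \<inter> {0..1}) \<le> b - a"
proof -
  have "measure unit_leb ({a<..b} \<inter> {0..1}) = measure lebesgue ({a<..b} \<inter> {0..1})"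
    by (intro measure_restrict_space) auto
  also have "\<dots> \<le> measure lebesgue {a..b}"
    by (intro measure_mono_fmeasurable) auto
  finally show ?thesis
    using assms by simp
qed

lemma sets_unit_leb_borel: "E \<in> sets borel \<Longrightarrow> E \<inter> {0..1} \<in> sets unit_leb"
  by (auto simp: sets_restrict_space Int_commute)

lemma borel_subset_with_same_ind:
  assumes E: "E \<in> sets unit_leb"
  shows "\<exists>S\<in>sets borel. ind E = ind (S \<inter> {0..1})"
proof -
  have "E \<in> sets (completion lborel)"
    using E by (auto simp: sets_restrict_space)
  then obtain S N N' where S: "E = S \<union> N" "N \<subseteq> N'" "N' \<in> null_sets lborel" "S \<in> sets lborel"
    by (rule sets_completionE)
  have SI: "S \<inter> {0..1} \<in> sets unit_leb" "S \<inter> {0..1} \<subseteq> E"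
    using S sets_unit_leb_borel by auto
  have "emeasure lebesgue N' = 0" "N' \<in> sets lebesgue"
    using S(3) by (auto simp: null_sets_def)
  then have "N' \<inter> {0..1} \<in> null_sets unit_leb"
    using S(3) sets_unit_leb_borel[of N']
    by (auto simp: null_sets_def emeasure_restrict_space intro: emeasure_eq_0[of N'])
  then have "measure unit_leb (N' \<inter> {0..1}) = 0" "N' \<inter> {0..1} \<in> sets unit_leb"
    by (auto simp: null_sets_def measure_def)
  moreover have "E - S \<inter> {0..1} \<subseteq> N' \<inter> {0..1}"
    using S sets_unit_leb_Int[OF E] by auto
  ultimately have "measure unit_leb (E - S \<inter> {0..1}) = 0"
    using unit_leb.finite_measure_mono[of "E - S \<inter> {0..1}" "N' \<inter> {0..1}"]
      measure_nonneg[of unit_leb "E - S \<inter> {0..1}"] by simp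
  then have "norm (ind E - ind (S \<inter> {0..1})) = 0"
    using norm_ind[of "E - S \<inter> {0..1}"] E SI by (simp add: ind_Diff)
  then show ?thesis
    using S(4) by auto
qed

text \<open>The indicators of the intervals up to a rational point span a dense subspace: limits give all initial
intervals, which generate the Borel sets and are closed under intersection, and a Lebesgue set
differs from a Borel set by a null set.\<close>

lemma L1_separable:
  "\<exists>D :: nat \<Rightarrow> L1. \<forall>V. closed V \<longrightarrow> subspace V \<longrightarrow> range D \<subseteq> V \<longrightarrow> V = UNIV"
proof -
  define D where "D n = ind ({..real_of_rat (from_nat n)} \<inter> {0..1})" for n :: nat
  have "V = UNIV" if V: "closed V" "subspace V" "range D \<subseteq> V" for V
  proof (rule L1_closed_subspace_UNIV[OF V(1,2)])
    have rat: "ind ({..of_rat q} \<inter> {0..1}) \<in> V" for q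
      using V(3) surj_from_nat unfolding D_def by (metis from_nat_to_nat rangeI subsetD)
    have atMost: "ind ({..a} \<inter> {0..1}) \<in> V" for a
    proof -
      have "ind ({..a} \<inter> {0..1}) \<in> closure V"
        unfolding closure_approachable
      proof (intro allI impI)
        fix e :: real assume "e > 0"
        then obtain q where q: "a < of_rat q" "of_rat q < a + e"
          using of_rat_dense[of a "a + e"] by auto
        have "{..of_rat q} \<inter> {0..1} - {..a} \<inter> {0..1} = {a<..of_rat q} \<inter> {0..1}"
          by auto
        moreover have "ind ({..of_rat q} \<inter> {0..1} - {..a} \<inter> {0..1}) =
            ind ({..of_rat q} \<inter> {0..1}) - ind ({..a} \<inter> {0..1})"
          by (intro ind_Diff sets_unit_leb_borel) (use q(1) in auto)
        ultimately have "ind ({..of_rat q} \<inter> {0..1}) - ind ({..a} \<inter> {0..1}) = ind ({a<..of_rat q} \<inter> {0..1})"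
          by (simp only:)
        then have "dist (ind ({..of_rat q} \<inter> {0..1})) (ind ({..a} \<inter> {0..1})) < e"
          using measure_unit_leb_Ioc_le[of a "of_rat q"] q
          by (simp add: dist_norm norm_ind sets_unit_leb_borel)
        then show "\<exists>v\<in>V. dist v (ind ({..a} \<inter> {0..1})) < e"
          using rat by blast
      qed
      then show ?thesis
        using V(1) by simp
    qed
    have borel: "ind (S \<inter> {0..1}) \<in> V" if "S \<in> sets borel" for S
    proof -
      have gen: "sets borel = sigma_sets UNIV (range (\<lambda>a::real. {..a}))"
        by (subst borel_eq_atMost) (auto intro: sets_measure_of)
      show ?thesis
      proof (rule sigma_sets_induct_disjoint[where P = "\<lambda>S. ind (S \<inter> {0..1}) \<in> V"])
        show "S \<in> sigma_sets UNIV (range (\<lambda>a::real. {..a}))"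
          using that gen by simp
        show "Int_stable (range (\<lambda>a::real. {..a}))"
          by (auto simp: Int_stable_def)
      next
        fix S assume "S \<in> range (\<lambda>a::real. {..a})"
        then show "ind (S \<inter> {0..1}) \<in> V"
          using atMost by auto
      next
        show "ind ({} \<inter> {0..1}) \<in> V"
          using subspace_0[OF V(2)] by (simp add: ind_empty)
      next
        fix S assume S: "S \<in> sigma_sets UNIV (range (\<lambda>a::real. {..a}))" "ind (S \<inter> {0..1}) \<in> V"
        have "(UNIV - S) \<inter> {0..1} = {..1} \<inter> {0..1} - S \<inter> {0..1}"
          by auto
        moreover have "ind ({..1} \<inter> {0..1} - S \<inter> {0..1}) = ind ({..1} \<inter> {0..1}) - ind (S \<inter> {0..1})"
          using S(1) gen by (intro ind_Diff sets_unit_leb_borel) auto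
        ultimately show "ind ((UNIV - S) \<inter> {0..1}) \<in> V"
          using subspace_diff[OF V(2) atMost[of 1] S(2)] by (simp only:)
      next
        fix A :: "nat \<Rightarrow> real set"
        assume A: "disjoint_family A" "range A \<subseteq> sigma_sets UNIV (range (\<lambda>a::real. {..a}))"
          "\<And>i. ind (A i \<inter> {0..1}) \<in> V"
        have "(\<lambda>i. ind (A i \<inter> {0..1})) sums ind (\<Union>i. A i \<inter> {0..1})"
        proof (rule ind_sums)
          show "range (\<lambda>i. A i \<inter> {0..1}) \<subseteq> sets unit_leb"
            using A(2) gen sets_unit_leb_borel by blast
          show "disjoint_family (\<lambda>i. A i \<inter> {0..1})"
            using A(1) by (auto simp: disjoint_family_on_def)
        qed
        then have "(\<lambda>n. \<Sum>i<n. ind (A i \<inter> {0..1})) \<longlonglongrightarrow> ind (\<Union>i. A i \<inter> {0..1})"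
          by (simp add: sums_def)
        moreover have "(\<Sum>i<n. ind (A i \<inter> {0..1})) \<in> V" for n
          using A(3) V(2) by (intro subspace_sum) auto
        ultimately have "ind (\<Union>i. A i \<inter> {0..1}) \<in> V"
          using closed_sequentially[OF V(1), of "\<lambda>n. \<Sum>i<n. ind (A i \<inter> {0..1})"] by simp
        moreover have "(\<Union>i. A i) \<inter> {0..1} = (\<Union>i. A i \<inter> {0..1})"
          by auto
        ultimately show "ind ((\<Union>i. A i) \<inter> {0..1}) \<in> V"
          by (simp only:)
      qed auto
    qed
    show "ind E \<in> V" if "E \<in> sets unit_leb" for E
      using borel_subset_with_same_ind[OF that] borel by auto
  qed
  then show ?thesis by blast
qed

lemma closed_pointwise_limit_set:
  fixes \<phi> :: "nat \<Rightarrow> 'a::real_normed_vector dual"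
  assumes K: "\<And>n. norm (\<phi> n) \<le> K"
  shows "closed {u. convergent (\<lambda>n. \<phi> n u)}" (is "closed ?V")
  unfolding closed_sequential_limits
proof (intro allI impI)
  fix v l assume v: "(\<forall>n. v n \<in> ?V) \<and> v \<longlonglongrightarrow> l"
  have K0: "K \<ge> 0"
    using K[of 0] norm_ge_zero order.trans by blast
  have "Cauchy (\<lambda>n. \<phi> n l)"
  proof (rule CauchyI)
    fix e :: real assume "e > 0"
    then have "e / (4 * (K + 1)) > 0" using K0 by simp
    then obtain i where i: "norm (v i - l) < e / (4 * (K + 1))"
      using LIMSEQ_D[of v l] v by blast
    have close: "\<bar>\<phi> n l - \<phi> n (v i)\<bar> \<le> e / 4" for n
    proof -
      have "\<bar>\<phi> n l - \<phi> n (v i)\<bar> \<le> norm (\<phi> n) * norm (l - v i)"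
        using norm_blinfun[of "\<phi> n" "l - v i"] by (simp add: blinfun.diff_right)
      also have "\<dots> \<le> (K + 1) * (e / (4 * (K + 1)))"
        using K[of n] i K0 by (intro mult_mono) (auto simp: norm_minus_commute)
      also have "\<dots> = e / 4"
        using K0 by (simp add: divide_simps)
      finally show ?thesis .
    qed
    have "Cauchy (\<lambda>n. \<phi> n (v i))"
      using v by (auto intro: convergent_Cauchy)
    then obtain M where M: "\<And>m n. m \<ge> M \<Longrightarrow> n \<ge> M \<Longrightarrow> norm (\<phi> m (v i) - \<phi> n (v i)) < e / 4"
      using CauchyD[of _ "e / 4"] \<open>e > 0\<close> by (metis divide_pos_pos zero_less_numeral)
    have "norm (\<phi> m l - \<phi> n l) < e" if "m \<ge> M" "n \<ge> M" for m n
      using M[OF that] close[of m] close[of n] \<open>e > 0\<close> unfolding real_norm_def by linarith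
    then show "\<exists>M. \<forall>m\<ge>M. \<forall>n\<ge>M. norm (\<phi> m l - \<phi> n l) < e"
      by blast
  qed
  then show "l \<in> ?V"
    by (simp add: Cauchy_convergent_iff)
qed

lemma subspace_pointwise_convergent:
  fixes \<phi> :: "nat \<Rightarrow> 'a::real_normed_vector dual"
  shows "subspace {u. convergent (\<lambda>n. \<phi> n u)}"
  unfolding subspace_def
  by (auto simp: blinfun.bilinear_simps convergent_const intro: convergent_add convergent_mult)

lemma pointwise_limit_functional:
  fixes \<phi> :: "nat \<Rightarrow> 'a::real_normed_vector dual"
  assumes K: "\<And>n. norm (\<phi> n) \<le> K" and conv: "\<And>u. convergent (\<lambda>n. \<phi> n u)"
  shows "\<exists>l :: 'a dual. \<forall>u. (\<lambda>n. \<phi> n u) \<longlonglongrightarrow> l u"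
proof -
  define l where "l u = lim (\<lambda>n. \<phi> n u)" for u
  have l: "(\<lambda>n. \<phi> n u) \<longlonglongrightarrow> l u" for u
    using conv[of u] by (simp add: l_def convergent_LIMSEQ_iff)
  have "bounded_linear l"
  proof (rule bounded_linear_intro)
    show "l (u + v) = l u + l v" for u v
      using LIMSEQ_unique[OF l[of "u + v"]] tendsto_add[OF l[of u] l[of v]]
      by (simp add: blinfun.add_right)
    show "l (c *\<^sub>R u) = c *\<^sub>R l u" for c u
      using LIMSEQ_unique[OF l[of "c *\<^sub>R u"]] tendsto_mult_left[OF l[of u], of c]
      by (simp add: blinfun.scaleR_right)
    show "norm (l u) \<le> norm u * K" for u
    proof (rule LIMSEQ_le_const2)
      show "(\<lambda>n. norm (\<phi> n u)) \<longlonglongrightarrow> norm (l u)"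
        by (intro tendsto_norm l)
      have "norm (\<phi> n u) \<le> norm u * K" for n
        using order.trans[OF norm_blinfun[of "\<phi> n" u] mult_right_mono[OF K[of n] norm_ge_zero]]
        by (simp add: mult.commute)
      then show "\<exists>N. \<forall>n\<ge>N. norm (\<phi> n u) \<le> norm u * K"
        by blast
    qed
  qed
  then have "blinfun_apply (Blinfun l) = l"
    by (rule bounded_linear_Blinfun_apply)
  then show ?thesis
    using l by (intro exI[of _ "Blinfun l"]) simp
qed

text \<open>A diagonal sequence converges on a countable set with dense span, and since the functionals are
bounded, the points of convergence form a closed subspace.\<close>

lemma L1_dual_sequentially_compact:
  fixes \<phi> :: "nat \<Rightarrow> L1 dual"
  assumes K: "\<And>n. norm (\<phi> n) \<le> K"
  shows "\<exists>r l. strict_mono r \<and> (\<forall>u. (\<lambda>n. \<phi> (r n) u) \<longlonglongrightarrow> blinfun_apply l u)"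
proof -
  obtain D :: "nat \<Rightarrow> L1" where
    D: "\<And>V. closed V \<Longrightarrow> subspace V \<Longrightarrow> range D \<subseteq> V \<Longrightarrow> V = UNIV"
    using L1_separable by blast
  interpret subseqs "\<lambda>n s. convergent (\<lambda>i. \<phi> (s i) (D n))"
  proof
    fix n and s :: "nat \<Rightarrow> nat"
    have "\<bar>\<phi> (s i) (D n)\<bar> \<le> K * norm (D n)" for i
      using order.trans[OF norm_blinfun[of "\<phi> (s i)" "D n"] mult_right_mono[OF K norm_ge_zero]]
      by simp
    then have "bounded (range (\<lambda>i. \<phi> (s i) (D n)))"
      by (intro boundedI[of _ "K * norm (D n)"]) auto
    then obtain l r where "strict_mono r" "((\<lambda>i. \<phi> (s i) (D n)) \<circ> r) \<longlonglongrightarrow> l"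
      using bounded_imp_convergent_subsequence by blast
    then show "\<exists>r. strict_mono r \<and> convergent (\<lambda>i. \<phi> ((s \<circ> r) i) (D n))"
      by (auto simp: convergent_def o_def)
  qed
  define r where "r = diagseq"
  have r: "strict_mono r"
    unfolding r_def by (rule subseq_diagseq)
  have conv_D: "convergent (\<lambda>i. \<phi> (r i) (D n))" for n
  proof -
    have "convergent (\<lambda>i. \<phi> ((diagseq \<circ> (+) (Suc n)) i) (D n))"
    proof (rule diagseq_holds)
      fix s t :: "nat \<Rightarrow> nat" and m assume "strict_mono s" "convergent (\<lambda>i. \<phi> (t i) (D m))"
      then show "convergent (\<lambda>i. \<phi> ((t \<circ> s) i) (D m))"
        using convergent_subseq_convergent[of "\<lambda>i. \<phi> (t i) (D m)" s] by (simp add: o_def)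
    qed
    then have "convergent (\<lambda>i. \<phi> (r (i + Suc n)) (D n))"
      by (simp add: r_def o_def add.commute)
    then show ?thesis
      by (subst (asm) convergent_ignore_initial_segment)
  qed
  define V where "V = {u. convergent (\<lambda>n. \<phi> (r n) u)}"
  have "V = UNIV"
  proof (rule D)
    show "closed V"
      unfolding V_def by (rule closed_pointwise_limit_set[OF K])
    show "subspace V"
      unfolding V_def by (rule subspace_pointwise_convergent)
    show "range D \<subseteq> V"
      using conv_D by (auto simp: V_def)
  qed
  then have "convergent (\<lambda>n. \<phi> (r n) u)" for u
    unfolding V_def by blast
  then obtain l :: "L1 dual" where "\<forall>u. (\<lambda>n. \<phi> (r n) u) \<longlonglongrightarrow> l u"
    using pointwise_limit_functional[of "\<lambda>n. \<phi> (r n)", OF K] by blast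
  then show ?thesis
    using r by blast
qed

section \<open>Weakly null sequences in the space of integrable functions\<close>

lemma L1_bounded_approximation:
  fixes u :: L1
  assumes "\<epsilon> > 0"
  shows "\<exists>\<phi> M. bdd_meas M \<phi> \<and> norm (u - abs_L1 \<phi>) < \<epsilon>"
proof (cases u rule: L1_cases)
  case (1 f)
  define \<phi> where "\<phi> n t = max (- real n) (min (real n) (f t))" for n t
  have \<phi>: "bdd_meas (real n) (\<phi> n)" for n
  proof -
    have [measurable]: "f \<in> borel_measurable unit_leb"
      using 1(1) by simp
    have "\<phi> n \<in> borel_measurable unit_leb"
      unfolding \<phi>_def by measurable
    then show ?thesis
      by (auto simp: bdd_meas_def \<phi>_def)
  qed
  have "(\<lambda>n. abs_L1 (\<phi> n)) \<longlonglongrightarrow> abs_L1 f"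
  proof (rule dominated_L1_limit[where w = "\<lambda>t. \<bar>f t\<bar>"])
    show "AE t in unit_leb. (\<lambda>n. \<phi> n t) \<longlonglongrightarrow> f t"
    proof (rule AE_I2)
      fix t
      have "\<forall>\<^sub>F n in sequentially. \<phi> n t = f t"
        using eventually_ge_at_top[of "nat \<lceil>\<bar>f t\<bar>\<rceil>"]
        by eventually_elim (auto simp: \<phi>_def)
      then show "(\<lambda>n. \<phi> n t) \<longlonglongrightarrow> f t"
        by (rule tendsto_eventually)
    qed
    show "AE t in unit_leb. \<bar>\<phi> n t\<bar> \<le> \<bar>f t\<bar>" for n
      by (intro AE_I2) (auto simp: \<phi>_def)
  qed (use 1 integrable_bdd_meas[OF \<phi>] in auto)
  then obtain n where "norm (abs_L1 (\<phi> n) - abs_L1 f) < \<epsilon>"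
    using LIMSEQ_D[OF _ assms] by blast
  then show ?thesis
    using \<phi>[of n] 1(2) by (intro exI[of _ "\<phi> n"] exI[of _ "real n"]) (simp add: norm_minus_commute)
qed

abbreviation clip :: "real \<Rightarrow> real" where
  "clip x \<equiv> max (- 1) (min 1 x)"

lemma bdd_meas_clip: "integrable unit_leb f \<Longrightarrow> bdd_meas 1 (\<lambda>t. clip (f t))"
  by (auto simp: bdd_meas_def)

lemma pairing_cong_AE:
  assumes "bdd_meas K \<phi>" "bdd_meas M \<psi>" "AE t in unit_leb. \<phi> t = \<psi> t"
  shows "pairing \<phi> u = pairing \<psi> u"
proof (cases u rule: L1_cases)
  case (1 f)
  have "(\<integral>t. \<phi> t * f t \<partial>unit_leb) = (\<integral>t. \<psi> t * f t \<partial>unit_leb)"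
    using assms(3) bdd_meas_mult_integrable[OF assms(1) 1(1)] bdd_meas_mult_integrable[OF assms(2) 1(1)]
    by (intro integral_cong_AE) auto
  then show ?thesis
    using 1 assms by (simp add: pairing_abs)
qed

text \<open>For a bounded \<open>u\<close> this is a Lipschitz estimate, because clipping is a contraction; the general case
follows because the clipped functions are uniformly bounded.\<close>

lemma continuous_pairing_clip:
  fixes u :: L1
  shows "continuous_on UNIV (\<lambda>v. pairing (\<lambda>t. clip (rep_L1 v t)) u)"
  unfolding continuous_on_iff
proof (intro ballI allI impI)
  fix v :: L1 and e :: real
  assume "e > 0"
  define \<kappa> where "\<kappa> v t = clip (rep_L1 v t)" for v t
  have \<kappa>: "bdd_meas 1 (\<kappa> v)" for v
    unfolding \<kappa>_def by (intro bdd_meas_clip integrable_rep_L1)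
  obtain \<phi> M where \<phi>: "bdd_meas M \<phi>" "norm (u - abs_L1 \<phi>) < e / 4"
    using L1_bounded_approximation[of "e / 4" u] \<open>e > 0\<close> by auto
  have M0: "0 \<le> M"
    using bdd_meas_nonneg[OF \<phi>(1)] .
  note int_\<phi> = integrable_bdd_meas[OF \<phi>(1)]
  have main: "\<bar>pairing (\<kappa> v) (abs_L1 \<phi>) - pairing (\<kappa> w) (abs_L1 \<phi>)\<bar> \<le> M * norm (v - w)" for v w
  proof -
    have int: "integrable unit_leb (\<lambda>t. \<kappa> v t * \<phi> t)" for v
      using bdd_meas_mult_integrable[OF \<kappa> int_\<phi>] .
    have "\<bar>pairing (\<kappa> v) (abs_L1 \<phi>) - pairing (\<kappa> w) (abs_L1 \<phi>)\<bar> =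
        \<bar>\<integral>t. \<kappa> v t * \<phi> t - \<kappa> w t * \<phi> t \<partial>unit_leb\<bar>"
      using int by (simp add: pairing_abs[OF \<kappa> int_\<phi>])
    also have "\<dots> \<le> (\<integral>t. \<bar>\<kappa> v t * \<phi> t - \<kappa> w t * \<phi> t\<bar> \<partial>unit_leb)"
      by (rule integral_abs_bound)
    also have "\<dots> \<le> (\<integral>t. M * \<bar>rep_L1 v t - rep_L1 w t\<bar> \<partial>unit_leb)"
    proof (rule integral_mono)
      show "integrable unit_leb (\<lambda>t. \<bar>\<kappa> v t * \<phi> t - \<kappa> w t * \<phi> t\<bar>)"
        using int by (intro integrable_abs Bochner_Integration.integrable_diff)
      show "integrable unit_leb (\<lambda>t. M * \<bar>rep_L1 v t - rep_L1 w t\<bar>)"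
        using integrable_rep_L1 by simp
      fix t
      have "\<bar>\<kappa> v t * \<phi> t - \<kappa> w t * \<phi> t\<bar> = \<bar>\<phi> t\<bar> * \<bar>\<kappa> v t - \<kappa> w t\<bar>"
        by (simp add: abs_mult[symmetric] algebra_simps)
      also have "\<dots> \<le> M * \<bar>rep_L1 v t - rep_L1 w t\<bar>"
        using \<phi>(1) by (intro mult_mono) (auto simp: bdd_meas_def \<kappa>_def)
      finally show "\<bar>\<kappa> v t * \<phi> t - \<kappa> w t * \<phi> t\<bar> \<le> M * \<bar>rep_L1 v t - rep_L1 w t\<bar>" .
    qed
    also have "\<dots> = M * norm (v - w)"
      using norm_abs_L1[of "\<lambda>t. rep_L1 v t - rep_L1 w t"] abs_L1_diff[of "rep_L1 v" "rep_L1 w"]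
      by (simp add: integrable_rep_L1 abs_rep_L1)
    finally show ?thesis .
  qed
  have rest: "\<bar>pairing (\<kappa> v) u - pairing (\<kappa> v) (abs_L1 \<phi>)\<bar> < e / 4" for v
    using pairing_le[OF \<kappa>, of v "u - abs_L1 \<phi>"] \<phi>(2) by (simp add: blinfun.diff_right)
  show "\<exists>d>0. \<forall>w\<in>UNIV. dist w v < d \<longrightarrow>
      dist (pairing (\<lambda>t. clip (rep_L1 w t)) u) (pairing (\<lambda>t. clip (rep_L1 v t)) u) < e"
  proof (intro exI conjI ballI impI)
    show "e / (2 * (M + 1)) > 0"
      using M0 \<open>e > 0\<close> by simp
    fix w assume "dist w v < e / (2 * (M + 1))"
    then have "(M + 1) * norm (w - v) < e / 2"
      using M0 by (simp add: dist_norm field_simps)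
    moreover have "M * norm (w - v) \<le> (M + 1) * norm (w - v)"
      by (intro mult_right_mono) auto
    ultimately have "\<bar>pairing (\<kappa> w) u - pairing (\<kappa> v) u\<bar> < e"
      using main[of w v] rest[of w] rest[of v] by linarith
    then show "dist (pairing (\<lambda>t. clip (rep_L1 w t)) u) (pairing (\<lambda>t. clip (rep_L1 v t)) u) < e"
      by (simp add: dist_norm \<kappa>_def [abs_def])
  qed
qed

text \<open>A Baire category argument. By weak convergence, the space is the union of the closed sets \<open>F N\<close> of
all \<open>v\<close> whose clipped version pairs with \<open>f k\<close> to at most \<open>\<epsilon>\<close> for all \<open>k \<ge> N\<close>, so one of
them contains a ball, centred without loss at a bounded function \<open>\<phi>\<close>. Changing \<open>\<phi>\<close> on a set \<open>E\<close>
of small measure to plus or minus the sign of \<open>f k\<close> does not leave the ball, and the two pairings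
differ by twice the integral of \<open>\<bar>f k\<bar>\<close> over \<open>E\<close>. Clipping turns the complete space of integrable
functions into a parameter space for the unit ball of the bounded functions.\<close>

lemma weakly_null_uniformly_integrable:
  fixes f :: "nat \<Rightarrow> L1"
  assumes weak: "\<And>l :: L1 dual. (\<lambda>k. l (f k)) \<longlonglongrightarrow> 0" and "\<epsilon> > 0"
  shows "\<exists>r>0. \<exists>N. \<forall>k\<ge>N. \<forall>E\<in>sets unit_leb. measure unit_leb E < r \<longrightarrow>
    norm (mult_op (indicator E) (f k)) \<le> \<epsilon>"
proof -
  define \<beta> where "\<beta> v k = pairing (\<lambda>t. clip (rep_L1 v t)) (f k)" for v :: L1 and k
  define F where "F N = {v. \<forall>k\<ge>N. \<bar>\<beta> v k\<bar> \<le> \<epsilon>}" for N :: nat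
  have closed_F: "closed (F N)" for N
  proof -
    have "F N = (\<Inter>k\<in>{N..}. {v. \<bar>\<beta> v k\<bar> \<le> \<epsilon>})"
      by (auto simp: F_def)
    also have "closed \<dots>"
      unfolding \<beta>_def
      by (intro closed_INT ballI closed_Collect_le continuous_intros continuous_pairing_clip)
    finally show ?thesis .
  qed
  have "(\<Union>N. F N) = UNIV"
  proof -
    have "\<exists>N. v \<in> F N" for v
    proof -
      have "(\<lambda>k. \<beta> v k) \<longlonglongrightarrow> 0"
        unfolding \<beta>_def by (rule weak)
      from LIMSEQ_D[OF this \<open>\<epsilon> > 0\<close>] obtain N where "\<And>k. k \<ge> N \<Longrightarrow> \<bar>\<beta> v k\<bar> < \<epsilon>"
        by auto
      then show ?thesis
        by (intro exI[of _ N]) (auto simp: F_def less_imp_le)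
    qed
    then show ?thesis by blast
  qed
  moreover have "interior (\<Union>N. F N) = {}" if "\<And>N. interior (F N) = {}"
    using Baire_category_alt[of "euclidean :: L1 topology" "range F"] that closed_F
      completely_metrizable_space_euclidean by auto
  ultimately obtain N where "interior (F N) \<noteq> {}"
    by (metis UNIV_not_empty interior_UNIV)
  then obtain v\<^sub>0 \<rho> where \<rho>: "\<rho> > 0" "ball v\<^sub>0 \<rho> \<subseteq> F N"
    by (meson all_not_in_conv mem_interior)
  obtain \<phi> M where \<phi>: "bdd_meas M \<phi>" "norm (v\<^sub>0 - abs_L1 \<phi>) < \<rho> / 2"
    using L1_bounded_approximation[of "\<rho> / 2" v\<^sub>0] \<rho>(1) by auto
  have M0: "0 \<le> M"
    using bdd_meas_nonneg[OF \<phi>(1)] .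
  have \<phi>_meas: "\<phi> \<in> borel_measurable unit_leb"
    using \<phi>(1) by (simp add: bdd_meas_def)
  define r where "r = \<rho> / (2 * (M + 1))"
  have r: "r > 0" "(M + 1) * r = \<rho> / 2"
    using \<rho>(1) M0 by (auto simp: r_def field_simps)
  have "norm (mult_op (indicator E) (f k)) \<le> \<epsilon>"
    if k: "k \<ge> N" and E: "E \<in> sets unit_leb" "measure unit_leb E < r" for k E
  proof (cases "f k" rule: L1_cases)
    case (1 g)
    have g_meas: "g \<in> borel_measurable unit_leb"
      using 1(1) by simp
    define \<psi> where "\<psi> s t = (if t \<in> E then s * sgn (g t) else \<phi> t)" for s t :: real
    have \<psi>_meas: "\<psi> s \<in> borel_measurable unit_leb" for s
      unfolding \<psi>_def using E(1) \<phi>_meas g_meas by measurable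
    have \<psi>: "bdd_meas (M + 1) (\<psi> s)" if "\<bar>s\<bar> = 1" for s
      using that \<psi>_meas[of s] \<phi>(1) M0
      by (auto simp: bdd_meas_def \<psi>_def abs_mult abs_sgn_eq intro: order.trans)
    note int_\<psi> = integrable_bdd_meas[OF \<psi>] and int_\<phi> = integrable_bdd_meas[OF \<phi>(1)]
    define c where "c s t = clip (\<psi> s t)" for s t
    have c: "bdd_meas 1 (c s)" if "\<bar>s\<bar> = 1" for s
      unfolding c_def by (intro bdd_meas_clip int_\<psi> that)
    have small: "\<bar>pairing (c s) (f k)\<bar> \<le> \<epsilon>" if s: "\<bar>s\<bar> = 1" for s
    proof -
      have "norm (abs_L1 (\<psi> s) - abs_L1 \<phi>) = (\<integral>t. \<bar>\<psi> s t - \<phi> t\<bar> \<partial>unit_leb)"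
        using int_\<psi>[OF s] int_\<phi> by (simp add: abs_L1_diff norm_abs_L1)
      also have "\<dots> \<le> (\<integral>t. (M + 1) * indicator E t \<partial>unit_leb)"
      proof (rule integral_mono)
        show "integrable unit_leb (\<lambda>t. \<bar>\<psi> s t - \<phi> t\<bar>)"
          using int_\<psi>[OF s] int_\<phi> by simp
        show "integrable unit_leb (\<lambda>t. (M + 1) * indicator E t)"
          using integrable_indicator_unit[OF E(1)] by simp
        fix t
        show "\<bar>\<psi> s t - \<phi> t\<bar> \<le> (M + 1) * indicator E t"
        proof (cases "t \<in> E")
          case True
          have "\<bar>\<psi> s t\<bar> \<le> 1"
            using s True by (simp add: \<psi>_def abs_mult abs_sgn_eq)
          moreover have "\<bar>\<phi> t\<bar> \<le> M"
            using \<phi>(1) by (simp add: bdd_meas_def)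
          ultimately have "\<bar>\<psi> s t - \<phi> t\<bar> \<le> M + 1"
            by linarith
          then show ?thesis using True by simp
        qed (simp add: \<psi>_def)
      qed
      also have "\<dots> = (M + 1) * measure unit_leb E"
        using E(1) by (simp add: sets_unit_leb_Int)
      also have "\<dots> < \<rho> / 2"
        using E(2) M0 unfolding r(2)[symmetric] by (intro mult_strict_left_mono) auto
      finally have "dist v\<^sub>0 (abs_L1 (\<psi> s)) < \<rho>"
        using \<phi>(2) norm_triangle_ineq[of "v\<^sub>0 - abs_L1 \<phi>" "abs_L1 \<phi> - abs_L1 (\<psi> s)"]
        by (simp add: dist_norm norm_minus_commute)
      then have "\<bar>\<beta> (abs_L1 (\<psi> s)) k\<bar> \<le> \<epsilon>"
        using \<rho>(2) k by (auto simp: F_def)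
      moreover have "\<beta> (abs_L1 (\<psi> s)) k = pairing (c s) (f k)"
        unfolding \<beta>_def
      proof (rule pairing_cong_AE)
        have "AE t in unit_leb. rep_L1 (abs_L1 (\<psi> s)) t = \<psi> s t"
          using abs_L1_eq_iff[OF integrable_rep_L1 int_\<psi>[OF s]] abs_rep_L1 by blast
        then show "AE t in unit_leb. clip (rep_L1 (abs_L1 (\<psi> s)) t) = c s t"
          by eventually_elim (simp add: c_def)
      qed (use c[OF s] in \<open>auto intro!: bdd_meas_clip integrable_rep_L1\<close>)
      ultimately show ?thesis by simp
    qed
    have int_c: "integrable unit_leb (\<lambda>t. c s t * g t)" if "\<bar>s\<bar> = 1" for s
      using bdd_meas_mult_integrable[OF c[OF that] 1(1)] .
    have "pairing (c 1) (f k) - pairing (c (-1)) (f k) = (\<integral>t. c 1 t * g t - c (-1) t * g t \<partial>unit_leb)"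
      using 1 int_c[of 1] int_c[of "-1"] by (simp add: pairing_abs[OF c])
    also have "\<dots> = (\<integral>t. 2 * \<bar>indicator E t * g t\<bar> \<partial>unit_leb)"
      by (intro Bochner_Integration.integral_cong)
        (auto simp: c_def \<psi>_def indicator_def sgn_if)
    also have "\<dots> = 2 * norm (mult_op (indicator E) (f k))"
      using norm_abs_L1[OF bdd_meas_mult_integrable[OF bdd_meas_indicator[OF E(1)] 1(1)]]
      by (simp add: 1(2) mult_op_abs[OF bdd_meas_indicator[OF E(1)] 1(1)])
    finally show ?thesis
      using small[of 1] small[of "-1"] by simp
  qed
  then show ?thesis
    using r(1) by blast
qed

text \<open>Finitely many intervals of measure below the threshold of uniform integrability cover the whole space.\<close>

lemma weakly_null_eventually_bounded:
  fixes f :: "nat \<Rightarrow> L1"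
  assumes weak: "\<And>l :: L1 dual. (\<lambda>k. l (f k)) \<longlonglongrightarrow> 0"
  shows "\<exists>C N. \<forall>k\<ge>N. norm (f k) \<le> C"
proof -
  obtain r N where r: "r > 0" and small: "\<And>k E. k \<ge> N \<Longrightarrow> E \<in> sets unit_leb \<Longrightarrow> measure unit_leb E < r \<Longrightarrow>
      norm (mult_op (indicator E) (f k)) \<le> 1"
    using weakly_null_uniformly_integrable[OF weak, of 1] by auto
  obtain n :: nat where n: "1 / real (Suc n) < r"
    using r nat_approx_posE by blast
  define I where "I j = {real j / Suc n..(real j + 1) / Suc n} \<inter> {0..1}" for j :: nat
  have I_sets: "I j \<in> sets unit_leb" for j
    unfolding I_def by (rule sets_unit_leb_borel) simp
  have I_small: "measure unit_leb (I j) < r" for j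
  proof -
    have "measure unit_leb (I j) = measure lebesgue (I j)"
      unfolding I_def by (intro measure_restrict_space) auto
    also have "\<dots> \<le> measure lebesgue {real j / Suc n..(real j + 1) / Suc n}"
      unfolding I_def by (intro measure_mono_fmeasurable) auto
    also have "\<dots> = 1 / Suc n"
      by (simp add: field_simps)
    finally show ?thesis using n by linarith
  qed
  have "norm (f k) \<le> real (Suc (Suc n))" if k: "k \<ge> N" for k
  proof (cases "f k" rule: L1_cases)
    case (1 g)
    note int = bdd_meas_mult_integrable[OF bdd_meas_indicator[OF I_sets] 1(1)]
    have "norm (f k) = (\<integral>t. \<bar>g t\<bar> \<partial>unit_leb)"
      using 1 by (simp add: norm_abs_L1)
    also have "\<dots> \<le> (\<integral>t. (\<Sum>j\<le>Suc n. \<bar>indicator (I j) t * g t\<bar>) \<partial>unit_leb)"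
    proof (rule integral_mono)
      show "integrable unit_leb (\<lambda>t. \<bar>g t\<bar>)"
        using 1(1) by simp
      show "integrable unit_leb (\<lambda>t. \<Sum>j\<le>Suc n. \<bar>indicator (I j) t * g t\<bar>)"
        using int by (intro Bochner_Integration.integrable_sum integrable_abs)
      fix t assume "t \<in> space unit_leb"
      then have t: "0 \<le> t" "t \<le> 1" by auto
      define j where "j = nat \<lfloor>real (Suc n) * t\<rfloor>"
      have fl: "real j \<le> real (Suc n) * t" "real (Suc n) * t < real j + 1"
        using t(1) unfolding j_def by (simp_all add: of_nat_nat floor_correct)
      then have "t \<in> I j"
        using t by (auto simp: I_def field_simps)
      moreover have "real (Suc n) * t \<le> real (Suc n)"
        using t(2) by (simp add: mult_left_le)
      then have "j \<le> Suc n"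
        using fl(1) by linarith
      ultimately have "\<bar>g t\<bar> = (\<Sum>i\<in>{j}. \<bar>indicator (I i) t * g t\<bar>)"
        by simp
      also have "\<dots> \<le> (\<Sum>j\<le>Suc n. \<bar>indicator (I j) t * g t\<bar>)"
        using \<open>j \<le> Suc n\<close> by (intro sum_mono2) auto
      finally show "\<bar>g t\<bar> \<le> (\<Sum>j\<le>Suc n. \<bar>indicator (I j) t * g t\<bar>)" .
    qed
    also have "\<dots> = (\<Sum>j\<le>Suc n. \<integral>t. \<bar>indicator (I j) t * g t\<bar> \<partial>unit_leb)"
      using int by (intro Bochner_Integration.integral_sum integrable_abs)
    also have "\<dots> = (\<Sum>j\<le>Suc n. norm (mult_op (indicator (I j)) (f k)))"
      using norm_abs_L1[OF int] mult_op_abs[OF bdd_meas_indicator[OF I_sets] 1(1)] by (simp add: 1(2))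
    also have "\<dots> \<le> (\<Sum>j\<le>Suc n. 1)"
      using small[OF k I_sets I_small] by (intro sum_mono)
    finally show ?thesis by simp
  qed
  then show ?thesis by blast
qed

definition bdd_simple :: "real \<Rightarrow> (real \<Rightarrow> real) \<Rightarrow> bool" where
  "bdd_simple K s \<longleftrightarrow> s \<in> borel_measurable unit_leb \<and> finite (range s) \<and> (\<forall>t. \<bar>s t\<bar> \<le> K)"

lemma bdd_simple_bdd_meas: "bdd_simple K s \<Longrightarrow> bdd_meas K s"
  by (simp add: bdd_simple_def bdd_meas_def)

text \<open>By Markov's inequality the set where \<open>f k\<close> exceeds a large constant has small measure, so by uniform
integrability \<open>f k\<close> may be replaced by zero there; elsewhere it is rounded to multiples of \<open>e\<close>.\<close>

lemma weakly_null_simple_approximation: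
  fixes f :: "nat \<Rightarrow> L1"
  assumes weak: "\<And>l :: L1 dual. (\<lambda>k. l (f k)) \<longlonglongrightarrow> 0" and "\<epsilon> > 0"
  shows "\<exists>M>0. \<exists>N. \<forall>k\<ge>N. \<exists>s. bdd_simple M s \<and> norm (f k - abs_L1 s) \<le> \<epsilon>"
proof -
  define e where "e = \<epsilon> / 2"
  have e: "e > 0" using \<open>\<epsilon> > 0\<close> by (simp add: e_def)
  obtain r N\<^sub>1 where r: "r > 0" and small: "\<And>k E. k \<ge> N\<^sub>1 \<Longrightarrow> E \<in> sets unit_leb \<Longrightarrow> measure unit_leb E < r \<Longrightarrow>
      norm (mult_op (indicator E) (f k)) \<le> e"
    using weakly_null_uniformly_integrable[OF weak e] by blast
  obtain C N\<^sub>2 where C: "\<And>k. k \<ge> N\<^sub>2 \<Longrightarrow> norm (f k) \<le> C"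
    using weakly_null_eventually_bounded[OF weak] by blast
  define M\<^sub>0 where "M\<^sub>0 = (\<bar>C\<bar> + 1) / r"
  have M0: "M\<^sub>0 > 0" "\<bar>C\<bar> < M\<^sub>0 * r"
    using r by (auto simp: M\<^sub>0_def)
  have "\<exists>s. bdd_simple (M\<^sub>0 + e) s \<and> norm (f k - abs_L1 s) \<le> \<epsilon>" if k: "k \<ge> max N\<^sub>1 N\<^sub>2" for k
  proof (cases "f k" rule: L1_cases)
    case (1 g)
    have g_meas [measurable]: "g \<in> borel_measurable unit_leb"
      using 1(1) by simp
    define E where "E = {t \<in> space unit_leb. \<bar>g t\<bar> > M\<^sub>0}"
    have E [measurable]: "E \<in> sets unit_leb"
      unfolding E_def by measurable
    define s where "s t = (if \<bar>g t\<bar> \<le> M\<^sub>0 then e * \<lfloor>g t / e\<rfloor> else 0)" for t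
    have floor_err: "\<bar>x - e * \<lfloor>x / e\<rfloor>\<bar> \<le> e" for x
    proof -
      have "of_int \<lfloor>x / e\<rfloor> \<le> x / e" "x / e \<le> of_int \<lfloor>x / e\<rfloor> + 1"
        by linarith+
      then have "of_int \<lfloor>x / e\<rfloor> * e \<le> x" "x \<le> (of_int \<lfloor>x / e\<rfloor> + 1) * e"
        using e by (simp_all only: pos_le_divide_eq pos_divide_le_eq)
      then show ?thesis by (simp add: algebra_simps)
    qed
    have "s \<in> borel_measurable unit_leb"
      unfolding s_def by measurable
    moreover have "\<bar>s t\<bar> \<le> M\<^sub>0 + e" for t
      using floor_err[of "g t"] M0 e by (auto simp: s_def)
    moreover have "finite (range s)"
    proof (rule finite_subset)
      show "range s \<subseteq> insert 0 ((\<lambda>i. e * real_of_int i) ` {\<lfloor>- M\<^sub>0 / e\<rfloor>..\<lfloor>M\<^sub>0 / e\<rfloor>})"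
      proof
        fix x assume "x \<in> range s"
        then obtain t where x: "x = s t" by blast
        have "- M\<^sub>0 / e \<le> g t / e \<and> g t / e \<le> M\<^sub>0 / e" if "\<bar>g t\<bar> \<le> M\<^sub>0"
          using that e by (intro conjI divide_right_mono) auto
        then show "x \<in> insert 0 ((\<lambda>i. e * real_of_int i) ` {\<lfloor>- M\<^sub>0 / e\<rfloor>..\<lfloor>M\<^sub>0 / e\<rfloor>})"
          unfolding x s_def by (auto intro!: imageI floor_mono)
      qed
    qed simp
    ultimately have s: "bdd_simple (M\<^sub>0 + e) s"
      by (simp add: bdd_simple_def)
    have int_E: "integrable unit_leb (\<lambda>t. indicator E t * g t)"
      using bdd_meas_mult_integrable[OF bdd_meas_indicator[OF E] 1(1)] .
    have int_s: "integrable unit_leb s"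
      using integrable_bdd_meas[OF bdd_simple_bdd_meas[OF s]] .
    have "M\<^sub>0 * measure unit_leb E = (\<integral>t. M\<^sub>0 * indicator E t \<partial>unit_leb)"
      using E by (simp add: sets_unit_leb_Int)
    also have "\<dots> \<le> (\<integral>t. \<bar>g t\<bar> \<partial>unit_leb)"
    proof (rule integral_mono)
      show "M\<^sub>0 * indicator E t \<le> \<bar>g t\<bar>" for t
        by (auto simp: E_def indicator_def)
    qed (use integrable_indicator_unit[OF E] 1(1) in auto)
    also have "\<dots> \<le> C"
      using C[of k] k 1 by (simp add: norm_abs_L1)
    finally have "M\<^sub>0 * measure unit_leb E < M\<^sub>0 * r"
      using M0(2) by linarith
    then have "measure unit_leb E < r"
      using M0(1) by simp
    then have "norm (mult_op (indicator E) (f k)) \<le> e"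
      using small k E by simp
    then have E_small: "(\<integral>t. \<bar>indicator E t * g t\<bar> \<partial>unit_leb) \<le> e"
      using norm_abs_L1[OF int_E] by (simp add: 1(2) mult_op_abs[OF bdd_meas_indicator[OF E] 1(1)])
    have "norm (f k - abs_L1 s) = (\<integral>t. \<bar>g t - s t\<bar> \<partial>unit_leb)"
      using 1 int_s by (simp add: abs_L1_diff norm_abs_L1)
    also have "\<dots> \<le> (\<integral>t. e + \<bar>indicator E t * g t\<bar> \<partial>unit_leb)"
    proof (rule integral_mono)
      show "\<bar>g t - s t\<bar> \<le> e + \<bar>indicator E t * g t\<bar>" if "t \<in> space unit_leb" for t
        using that floor_err[of "g t"] e by (auto simp: s_def E_def indicator_def)
    qed (use 1(1) int_s int_E in auto)
    also have "\<dots> = e + (\<integral>t. \<bar>indicator E t * g t\<bar> \<partial>unit_leb)"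
      using int_E by (simp add: measure_restrict_space)
    also have "\<dots> \<le> \<epsilon>"
      using E_small by (simp add: e_def)
    finally show ?thesis
      using s by blast
  qed
  moreover have "M\<^sub>0 + e > 0"
    using M0 e by simp
  ultimately show ?thesis by blast
qed

section \<open>Halving sets simultaneously for finitely many functionals\<close>

definition halvable :: "L1 dual set \<Rightarrow> bool" where
  "halvable \<Phi> \<longleftrightarrow> (\<forall>C\<in>sets unit_leb. \<exists>D\<in>sets unit_leb. D \<subseteq> C \<and> (\<forall>\<phi>\<in>\<Phi>. \<phi> (ind D) = \<phi> (ind C) / 2))"

definition proportional_chain :: "L1 dual set \<Rightarrow> real set \<Rightarrow> (real \<Rightarrow> real set) \<Rightarrow> bool" where
  "proportional_chain \<Phi> C D \<longleftrightarrow> D 0 = {} \<and> D 1 = C \<and>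
    (\<forall>s t. 0 \<le> s \<longrightarrow> s \<le> t \<longrightarrow> t \<le> 1 \<longrightarrow> D s \<subseteq> D t) \<and>
    (\<forall>t\<in>{0..1}. D t \<in> sets unit_leb \<and> D t \<subseteq> C \<and> (\<forall>\<phi>\<in>\<Phi>. \<phi> (ind (D t)) = t * \<phi> (ind C)))"

text \<open>If \<open>H\<close> halves sets, then the set with index \<open>k \<le> 2 ^ n\<close> at level \<open>n\<close> carries the proportion
\<open>k / 2 ^ n\<close> of \<open>C\<close>.\<close>

fun dyadic_chain :: "(real set \<Rightarrow> real set) \<Rightarrow> real set \<Rightarrow> nat \<Rightarrow> nat \<Rightarrow> real set" where
  "dyadic_chain H C 0 k = (if k = 0 then {} else C)"
| "dyadic_chain H C (Suc n) k =
    (if even k then dyadic_chain H C n (k div 2)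
     else dyadic_chain H C n (k div 2) \<union>
       H (dyadic_chain H C n (Suc (k div 2)) - dyadic_chain H C n (k div 2)))"

text \<open>Iterated halving produces sets for all dyadic proportions; unions of these extend the chain to all
proportions in the unit interval by continuity.\<close>

lemma halvable_chain:
  assumes half: "halvable \<Phi>" and C: "C \<in> sets unit_leb"
  shows "\<exists>D. proportional_chain \<Phi> C D"
proof -
  have "\<forall>C. \<exists>D. C \<in> sets unit_leb \<longrightarrow> D \<in> sets unit_leb \<and> D \<subseteq> C \<and> (\<forall>\<phi>\<in>\<Phi>. \<phi> (ind D) = \<phi> (ind C) / 2)"
    using half unfolding halvable_def by blast
  then obtain H where H: "\<And>C. C \<in> sets unit_leb \<Longrightarrow> H C \<in> sets unit_leb"
    "\<And>C. C \<in> sets unit_leb \<Longrightarrow> H C \<subseteq> C"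
    "\<And>C \<phi>. C \<in> sets unit_leb \<Longrightarrow> \<phi> \<in> \<Phi> \<Longrightarrow> \<phi> (ind (H C)) = \<phi> (ind C) / 2"
    by metis
  define Q where "Q = dyadic_chain H C"
  have Q0: "Q 0 k = (if k = 0 then {} else C)" for k
    by (simp add: Q_def)
  have Q_even: "Q (Suc n) (2 * k) = Q n k" for n k
    by (simp add: Q_def)
  have Q_odd: "Q (Suc n) (Suc (2 * k)) = Q n k \<union> H (Q n (Suc k) - Q n k)" for n k
    by (simp add: Q_def)
  have Q: "Q n k \<in> sets unit_leb \<and> Q n k \<subseteq> C \<and> Q n k \<subseteq> Q n (Suc k) \<and>
      (k \<le> 2 ^ n \<longrightarrow> (\<forall>\<phi>\<in>\<Phi>. \<phi> (ind (Q n k)) = real k / 2 ^ n * \<phi> (ind C)))" for n k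
  proof (induction n arbitrary: k)
    case 0
    have "k \<le> 1 \<Longrightarrow> k = 0 \<or> k = 1" by auto
    then show ?case using C by (auto simp: Q0 ind_empty)
  next
    case (Suc n)
    define j where "j = k div 2"
    have gap: "Q n (Suc j) - Q n j \<in> sets unit_leb"
      using Suc.IH by blast
    show ?case
    proof (cases "even k")
      case True
      then have k: "k = 2 * j" by (simp add: j_def)
      show ?thesis
        unfolding k Q_even Q_odd using Suc.IH[of j] by (auto simp: field_simps)
    next
      case False
      then have k: "k = Suc (2 * j)" by (simp add: j_def)
      have "Q (Suc n) (Suc k) = Q n (Suc j)"
        unfolding k using Q_even[of n "Suc j"] by simp
      moreover have "Q n j \<union> H (Q n (Suc j) - Q n j) \<subseteq> Q n (Suc j)"
        using Suc.IH[of j] H(2)[OF gap] by blast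
      moreover have "\<phi> (ind (Q n j \<union> H (Q n (Suc j) - Q n j))) = real k / 2 ^ Suc n * \<phi> (ind C)"
        if "k \<le> 2 ^ Suc n" "\<phi> \<in> \<Phi>" for \<phi>
      proof -
        have "Suc j \<le> 2 ^ n"
          using that(1) by (simp add: k)
        have "\<phi> (ind (Q n j \<union> H (Q n (Suc j) - Q n j))) =
            \<phi> (ind (Q n j)) + \<phi> (ind (H (Q n (Suc j) - Q n j)))"
          using Suc.IH[of j] H(1,2)[OF gap] by (subst ind_Un) (auto simp: blinfun.add_right)
        also have "\<phi> (ind (H (Q n (Suc j) - Q n j))) = \<phi> (ind (Q n (Suc j)) - ind (Q n j)) / 2"
          using Suc.IH H(3)[OF gap that(2)] by (subst ind_Diff[symmetric]) auto
        also have "\<dots> = (\<phi> (ind (Q n (Suc j))) - \<phi> (ind (Q n j))) / 2"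
          by (simp add: blinfun.diff_right)
        also have "\<phi> (ind (Q n (Suc j))) = real (Suc j) / 2 ^ n * \<phi> (ind C)"
          using Suc.IH[of "Suc j"] \<open>Suc j \<le> 2 ^ n\<close> that(2) by blast
        also have "\<phi> (ind (Q n j)) = real j / 2 ^ n * \<phi> (ind C)"
          using Suc.IH[of j] \<open>Suc j \<le> 2 ^ n\<close> that(2) by auto
        finally show ?thesis
          by (simp add: k field_simps)
      qed
      ultimately show ?thesis
        using Suc.IH[of j] Suc.IH[of "Suc j"] H(1)[OF gap] unfolding k Q_odd by auto
    qed
  qed
  have Q_mono: "Q n j \<subseteq> Q n k" if "j \<le> k" for n j k
    using that Q by (induction rule: dec_induct) blast+
  define a where "a n t = nat \<lfloor>t * 2 ^ n\<rfloor>" for n :: nat and t :: real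
  define D where "D t = (\<Union>n. Q n (a n t))" for t
  have a_le: "real (a n t) \<le> t * 2 ^ n" "t * 2 ^ n < real (a n t) + 1" if "0 \<le> t" for n t
    using that by (simp_all add: a_def of_nat_nat floor_correct)
  have incseq: "incseq (\<lambda>n. Q n (a n t))" if "0 \<le> t" for t
  proof (rule incseq_SucI)
    fix n
    have "real (2 * a n t) \<le> t * 2 ^ Suc n"
      using a_le(1)[OF that, of n] by simp
    then have "real (2 * a n t) < real (a (Suc n) t) + 1"
      using a_le(2)[OF that, of "Suc n"] by linarith
    then have "2 * a n t \<le> a (Suc n) t"
      by linarith
    then show "Q n (a n t) \<le> Q (Suc n) (a (Suc n) t)"
      using Q_mono[of "2 * a n t" "a (Suc n) t" "Suc n"] by (simp add: Q_even)
  qed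
  have "\<phi> (ind (D t)) = t * \<phi> (ind C)" if t: "t \<in> {0..1}" and "\<phi> \<in> \<Phi>" for t \<phi>
  proof -
    have "(\<lambda>n. ind (Q n (a n t))) \<longlonglongrightarrow> ind (D t)"
      unfolding D_def using t Q by (intro ind_incseq_limit incseq) auto
    then have lim: "(\<lambda>n. \<phi> (ind (Q n (a n t)))) \<longlonglongrightarrow> \<phi> (ind (D t))"
      by (rule blinfun.tendsto[OF tendsto_const])
    have "\<phi> (ind (Q n (a n t))) = real (a n t) / 2 ^ n * \<phi> (ind C)" for n
    proof -
      have "t * 2 ^ n \<le> 1 * 2 ^ n"
        using t by (intro mult_right_mono) auto
      moreover have "real (a n t) \<le> t * 2 ^ n"
        using t by (intro a_le(1)) simp
      ultimately have "real (a n t) \<le> 1 * 2 ^ n"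
        by (rule order.trans[rotated])
      then have "a n t \<le> 2 ^ n"
        by simp
      then show ?thesis
        using Q \<open>\<phi> \<in> \<Phi>\<close> by blast
    qed
    moreover have "(\<lambda>n. real (a n t) / 2 ^ n) \<longlonglongrightarrow> t"
    proof (rule tendsto_sandwich)
      show "\<forall>\<^sub>F n in sequentially. t - (1 / 2) ^ n \<le> real (a n t) / 2 ^ n"
      proof (intro always_eventually allI)
        fix n
        have "(t - (1 / 2) ^ n) * 2 ^ n = t * 2 ^ n - 1"
          by (simp add: left_diff_distrib power_mult_distrib[symmetric])
        also have "\<dots> \<le> real (a n t)"
          using a_le(2)[of t n] t by simp
        finally show "t - (1 / 2) ^ n \<le> real (a n t) / 2 ^ n"
          by (simp add: pos_le_divide_eq)
      qed
      show "\<forall>\<^sub>F n in sequentially. real (a n t) / 2 ^ n \<le> t"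
        using a_le(1)[of t] t by (intro always_eventually) (auto simp: field_simps)
      have "(\<lambda>n. t - (1 / 2) ^ n) \<longlonglongrightarrow> t - 0"
        by (intro tendsto_intros LIMSEQ_power_zero) simp
      then show "(\<lambda>n. t - (1 / 2) ^ n) \<longlonglongrightarrow> t"
        by simp
    qed simp
    then have "(\<lambda>n. real (a n t) / 2 ^ n * \<phi> (ind C)) \<longlonglongrightarrow> t * \<phi> (ind C)"
      by (intro tendsto_intros)
    ultimately show ?thesis
      using LIMSEQ_unique[OF lim] by simp
  qed
  moreover have "D t \<in> sets unit_leb \<and> D t \<subseteq> C" for t
    unfolding D_def using Q by blast
  moreover have "D s \<subseteq> D t" if "0 \<le> s" "s \<le> t" for s t
  proof -
    have "a n s \<le> a n t" for n
      unfolding a_def using that by (intro nat_mono floor_mono mult_right_mono) auto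
    then show ?thesis
      unfolding D_def using Q_mono by (intro UN_mono) auto
  qed
  moreover have "D 0 = {}"
  proof -
    have "Q n 0 = {}" for n
      using Q_even[of _ 0] by (induction n) (simp_all add: Q0)
    then show ?thesis by (simp add: D_def a_def)
  qed
  moreover have "D 1 = C"
  proof -
    have "Q 0 (a 0 1) = C"
      by (simp add: Q0 a_def)
    then show ?thesis
      using \<open>\<And>t. D t \<in> sets unit_leb \<and> D t \<subseteq> C\<close>[of 1] unfolding D_def by blast
  qed
  ultimately show ?thesis
    unfolding proportional_chain_def by (intro exI[of _ D]) simp
qed

lemma proportional_chain_sets:
  assumes "proportional_chain \<Phi> C D" "t \<in> {0..1}"
  shows "D t \<in> sets unit_leb" "D t \<subseteq> C" "\<phi> \<in> \<Phi> \<Longrightarrow> \<phi> (ind (D t)) = t * \<phi> (ind C)"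
  using assms unfolding proportional_chain_def by auto

lemma proportional_chain_lipschitz:
  assumes chain: "proportional_chain \<Phi> C D" and "integ \<in> \<Phi>" and C: "C \<in> sets unit_leb"
    and st: "s \<in> {0..1}" "t \<in> {0..1}" "s \<le> t"
  shows "norm (ind (D t) - ind (D s)) \<le> t - s"
proof -
  note s = proportional_chain_sets[OF chain st(1)] and t = proportional_chain_sets[OF chain st(2)]
  have sub: "D s \<subseteq> D t"
    using chain st unfolding proportional_chain_def by auto
  have "norm (ind (D t) - ind (D s)) = measure unit_leb (D t - D s)"
    using s(1) t(1) sub norm_ind[of "D t - D s"] by (simp add: ind_Diff)
  also have "\<dots> = integ (ind (D t)) - integ (ind (D s))"
    using s(1) t(1) sub by (simp add: integ_ind unit_leb.finite_measure_Diff)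
  also have "\<dots> = (t - s) * measure unit_leb C"
    using s(3)[OF \<open>integ \<in> \<Phi>\<close>] t(3)[OF \<open>integ \<in> \<Phi>\<close>] C by (simp add: integ_ind left_diff_distrib)
  also have "\<dots> \<le> (t - s) * 1"
    using st(3) measure_unit_leb_le_1 by (intro mult_left_mono) auto
  finally show ?thesis by simp
qed

lemma halvable_integ: "halvable {integ}"
  unfolding halvable_def
proof
  fix C assume C: "C \<in> sets unit_leb"
  define m where "m x = measure unit_leb (C \<inter> ({0<..x} \<inter> {0..1}))" for x
  have Ioc: "{a<..b} \<inter> {0..1} \<in> sets unit_leb" for a b :: real
    by (rule sets_unit_leb_borel) simp
  have m_diff: "m y - m x \<le> y - x \<and> m x \<le> m y" if "0 \<le> x" "x \<le> y" for x y
  proof -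
    have "C \<inter> ({0<..y} \<inter> {0..1}) = C \<inter> ({0<..x} \<inter> {0..1}) \<union> C \<inter> ({x<..y} \<inter> {0..1})"
      using that by auto
    then have "m y = m x + measure unit_leb (C \<inter> ({x<..y} \<inter> {0..1}))"
      unfolding m_def using C Ioc by (simp only:) (intro unit_leb.finite_measure_Union; force)
    moreover have "measure unit_leb (C \<inter> ({x<..y} \<inter> {0..1})) \<le> measure unit_leb ({x<..y} \<inter> {0..1})"
      using Ioc by (intro unit_leb.finite_measure_mono) auto
    moreover have "measure unit_leb ({x<..y} \<inter> {0..1}) \<le> y - x"
      using that by (intro measure_unit_leb_Ioc_le)
    ultimately show ?thesis
      using measure_nonneg[of unit_leb "C \<inter> ({x<..y} \<inter> {0..1})"] by linarith
  qed
  have "continuous_on {0..1} m"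
    unfolding continuous_on_iff
  proof (intro ballI allI impI)
    fix x e :: real assume x: "x \<in> {0..1}" and "e > 0"
    have "dist (m y) (m x) < e" if "y \<in> {0..1}" "dist y x < e" for y
      using m_diff[of x y] m_diff[of y x] x that unfolding dist_real_def by (cases "x \<le> y") auto
    then show "\<exists>d>0. \<forall>y\<in>{0..1}. dist y x < d \<longrightarrow> dist (m y) (m x) < e"
      using \<open>e > 0\<close> by blast
  qed
  moreover have "m 0 = 0"
    by (simp add: m_def)
  moreover have "m 1 = measure unit_leb C"
  proof -
    have "C \<subseteq> C \<inter> ({0<..1} \<inter> {0..1}) \<union> ({-1<..0} \<inter> {0..1})"
    proof
      fix x assume "x \<in> C"
      then have "x \<in> {0..1}"
        using sets_unit_leb_Int[OF C] by blast
      with \<open>x \<in> C\<close> show "x \<in> C \<inter> ({0<..1} \<inter> {0..1}) \<union> ({-1<..0} \<inter> {0..1})"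
        by auto
    qed
    then have "measure unit_leb C \<le> measure unit_leb (C \<inter> ({0<..1} \<inter> {0..1}) \<union> ({-1<..0} \<inter> {0..1}))"
      using C Ioc by (intro unit_leb.finite_measure_mono) auto
    also have "\<dots> \<le> m 1 + measure unit_leb ({-1<..0} \<inter> {0..1})"
      unfolding m_def using C Ioc by (intro measure_Un_le) auto
    also have "{-1<..0} \<inter> {0..1} = {0::real}"
      by auto
    also have "measure unit_leb {0::real} = measure lebesgue {0::real}"
      by (intro measure_restrict_space) auto
    finally have "measure unit_leb C \<le> m 1"
      by simp
    moreover have "m 1 \<le> measure unit_leb C"
      unfolding m_def using C by (intro unit_leb.finite_measure_mono) auto
    ultimately show ?thesis by simp
  qed
  ultimately obtain x where x: "m x = measure unit_leb C / 2"
    using IVT'[of m 0 "measure unit_leb C / 2" 1] by auto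
  show "\<exists>D\<in>sets unit_leb. D \<subseteq> C \<and> (\<forall>\<phi>\<in>{integ}. \<phi> (ind D) = \<phi> (ind C) / 2)"
  proof (rule bexI[of _ "C \<inter> ({0<..x} \<inter> {0..1})"])
    show "C \<inter> ({0<..x} \<inter> {0..1}) \<in> sets unit_leb"
      using C Ioc by blast
    then show "C \<inter> ({0<..x} \<inter> {0..1}) \<subseteq> C \<and>
        (\<forall>\<phi>\<in>{integ}. \<phi> (ind (C \<inter> ({0<..x} \<inter> {0..1}))) = \<phi> (ind C) / 2)"
      using x C by (simp add: integ_ind m_def)
  qed
qed

text \<open>An argument of ham-sandwich type. Let \<open>E\<close> halve \<open>C\<close> for the old functionals. Emptying \<open>E\<close> along a
proportional chain while filling \<open>C - E\<close> along another moves \<open>E\<close> to \<open>C - E\<close> through sets that all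
halve \<open>C\<close> for the old functionals. The new functional varies continuously along this path, since
the integral is among the old functionals, and its values at the two ends are symmetric about half of its
value on \<open>C\<close>; so it takes that value on the way.\<close>

lemma halvable_insert:
  assumes half: "halvable \<Phi>" and integ: "integ \<in> \<Phi>"
  shows "halvable (insert \<psi> \<Phi>)"
  unfolding halvable_def
proof
  fix C assume C: "C \<in> sets unit_leb"
  have "\<exists>E\<in>sets unit_leb. E \<subseteq> C \<and> (\<forall>\<phi>\<in>\<Phi>. \<phi> (ind E) = \<phi> (ind C) / 2)"
    using half C unfolding halvable_def by (rule bspec)
  then obtain E where E: "E \<in> sets unit_leb" "E \<subseteq> C" "\<And>\<phi>. \<phi> \<in> \<Phi> \<Longrightarrow> \<phi> (ind E) = \<phi> (ind C) / 2"
    by auto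
  have CE: "C - E \<in> sets unit_leb" "ind (C - E) = ind C - ind E"
    using C E(1) ind_Diff[OF C E(1,2)] by (simp_all only: sets.Diff)
  obtain D where D: "proportional_chain \<Phi> E D"
    using halvable_chain[OF half E(1)] ..
  obtain D' where D': "proportional_chain \<Phi> (C - E) D'"
    using halvable_chain[OF half CE(1)] ..
  have ends: "D 0 = {}" "D 1 = E" "D' 0 = {}" "D' 1 = C - E"
    using D D' by (auto simp: proportional_chain_def)
  define F where "F t = (E - D t) \<union> D' t" for t
  have F_sets: "F t \<in> sets unit_leb" "F t \<subseteq> C" if "t \<in> {0..1}" for t
    using proportional_chain_sets(1,2)[OF D that] proportional_chain_sets(1,2)[OF D' that] E(1,2)
    by (auto simp: F_def)
  have F_ind: "ind (F t) = ind E - ind (D t) + ind (D' t)" if "t \<in> {0..1}" for t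
  proof -
    note Dt = proportional_chain_sets(1,2)[OF D that] proportional_chain_sets(1,2)[OF D' that]
    have "ind (F t) = ind (E - D t) + ind (D' t)"
      unfolding F_def using Dt E(1) by (intro ind_Un) auto
    also have "ind (E - D t) = ind E - ind (D t)"
      using Dt E(1) by (intro ind_Diff) auto
    finally show ?thesis .
  qed
  have F_half: "\<phi> (ind (F t)) = \<phi> (ind C) / 2" if "t \<in> {0..1}" "\<phi> \<in> \<Phi>" for t \<phi>
  proof -
    have "\<phi> (ind (F t)) = \<phi> (ind E) - t * \<phi> (ind E) + t * (\<phi> (ind C) - \<phi> (ind E))"
      using proportional_chain_sets(3)[OF D that] proportional_chain_sets(3)[OF D' that]
      by (simp add: F_ind[OF that(1)] CE(2) blinfun.add_right blinfun.diff_right)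
    then show ?thesis
      by (simp add: E(3)[OF that(2)])
  qed
  have F_lip: "norm (ind (F t) - ind (F s)) \<le> 2 * \<bar>t - s\<bar>" if "s \<in> {0..1}" "t \<in> {0..1}" for s t
  proof -
    have *: "norm (ind (F t) - ind (F s)) \<le> 2 * (t - s)" if "s \<in> {0..1}" "t \<in> {0..1}" "s \<le> t" for s t
    proof -
      have "ind (F t) - ind (F s) = (ind (D' t) - ind (D' s)) - (ind (D t) - ind (D s))"
        using that by (simp add: F_ind)
      also have "norm \<dots> \<le> norm (ind (D' t) - ind (D' s)) + norm (ind (D t) - ind (D s))"
        by (rule norm_triangle_ineq4)
      also have "\<dots> \<le> (t - s) + (t - s)"
        by (intro add_mono proportional_chain_lipschitz[OF D' integ CE(1) that]
            proportional_chain_lipschitz[OF D integ E(1) that])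
      finally show ?thesis by simp
    qed
    show ?thesis
      using *[OF that] *[OF that(2,1)] by (cases "s \<le> t") (auto simp: norm_minus_commute)
  qed
  define p where "p t = \<psi> (ind (F t))" for t
  have "continuous_on {0..1} (\<lambda>t. ind (F t))"
  proof (rule continuous_onI)
    fix t e :: real assume "e > 0" "t \<in> {0..1}"
    have "dist (ind (F s)) (ind (F t)) \<le> e" if "s \<in> {0..1}" "dist s t < e / 2" for s
      using F_lip[OF \<open>t \<in> {0..1}\<close> that(1)] that(2) by (simp add: dist_norm)
    then show "\<exists>d>0. \<forall>s\<in>{0..1}. dist s t < d \<longrightarrow> dist (ind (F s)) (ind (F t)) \<le> e"
      using \<open>e > 0\<close> by (intro exI[of _ "e / 2"]) simp
  qed
  then have cont: "continuous_on {0..1} p"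
    unfolding p_def by (intro continuous_intros)
  have "p 0 = \<psi> (ind E)"
    by (simp add: p_def F_def ends)
  moreover have "p 1 = \<psi> (ind C) - \<psi> (ind E)"
    by (simp add: p_def F_def ends CE(2) blinfun.diff_right)
  ultimately have "p 0 \<le> \<psi> (ind C) / 2 \<and> \<psi> (ind C) / 2 \<le> p 1 \<or> p 1 \<le> \<psi> (ind C) / 2 \<and> \<psi> (ind C) / 2 \<le> p 0"
    by (auto simp: field_simps)
  then obtain t where t: "t \<in> {0..1}" "p t = \<psi> (ind C) / 2"
    using IVT'[of p 0 "\<psi> (ind C) / 2" 1] IVT2'[of p 1 "\<psi> (ind C) / 2" 0] cont by auto
  show "\<exists>D\<in>sets unit_leb. D \<subseteq> C \<and> (\<forall>\<phi>\<in>insert \<psi> \<Phi>. \<phi> (ind D) = \<phi> (ind C) / 2)"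
    using F_sets[OF t(1)] F_half[OF t(1)] t(2) by (intro bexI[of _ "F t"]) (auto simp: p_def)
qed

lemma halvable_finite:
  assumes "finite \<Phi>"
  shows "halvable (insert integ \<Phi>)"
  using assms
proof (induction \<Phi>)
  case empty
  then show ?case by (simp add: halvable_integ)
next
  case (insert \<psi> \<Phi>)
  then show ?case
    using halvable_insert[of "insert integ \<Phi>" \<psi>] by (simp add: insert_commute)
qed

lemma abs_L1_sum:
  assumes "finite I" "\<And>i. i \<in> I \<Longrightarrow> integrable unit_leb (f i)"
  shows "abs_L1 (\<lambda>t. \<Sum>i\<in>I. f i t) = (\<Sum>i\<in>I. abs_L1 (f i))"
  using assms
proof (induction I)
  case empty
  then show ?case by (simp add: abs_L1_zero)
next
  case (insert i I)
  then have "abs_L1 (f i) + abs_L1 (\<lambda>t. \<Sum>i\<in>I. f i t) = abs_L1 (\<lambda>t. f i t + (\<Sum>i\<in>I. f i t))"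
    by (intro abs_L1_add) auto
  then show ?case
    using insert by simp
qed

text \<open>A form of Lyapunov's convexity theorem: as far as finitely many functionals can see, a simple function
with values in \<open>[-1, 1]\<close> is a function with values \<open>\<plusminus>1\<close>. On the part of \<open>C\<close> where \<open>s\<close> equals
\<open>c\<close>, the proportion \<open>(1 + c) / 2\<close> is put into \<open>D\<close>.\<close>

lemma simple_function_to_sign:
  fixes \<Phi> :: "L1 dual set"
  assumes s: "bdd_simple 1 s" "\<And>t. t \<notin> C \<Longrightarrow> s t = 0" and C: "C \<in> sets unit_leb" and "finite \<Phi>"
  shows "\<exists>D\<in>sets unit_leb. D \<subseteq> C \<and> (\<forall>\<phi>\<in>\<Phi>. \<phi> (ind D) - \<phi> (ind (C - D)) = \<phi> (abs_L1 s))"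
proof -
  define R where "R = s ` C"
  have R: "finite R" "\<And>c. c \<in> R \<Longrightarrow> \<bar>c\<bar> \<le> 1"
    using s(1) by (auto simp: R_def bdd_simple_def intro: finite_subset[OF image_mono[OF subset_UNIV]])
  define Q where "Q c = {t \<in> C. s t = c}" for c
  have Q_sets: "Q c \<in> sets unit_leb" for c
  proof -
    have "s \<in> borel_measurable unit_leb"
      using s(1) by (simp add: bdd_simple_def)
    then have "{t \<in> space unit_leb. s t = c} \<in> sets unit_leb"
      by measurable
    moreover have "Q c = C \<inter> {t \<in> space unit_leb. s t = c}"
      using sets.sets_into_space[OF C] by (auto simp: Q_def)
    ultimately show ?thesis
      using C by simp
  qed
  have Q_disj: "disjoint_family_on Q R"
    by (auto simp: disjoint_family_on_def Q_def)
  have C_eq: "C = (\<Union>c\<in>R. Q c)"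
    by (auto simp: Q_def R_def)
  have "\<exists>D. D \<in> sets unit_leb \<and> D \<subseteq> Q c \<and> (\<forall>\<phi>\<in>insert integ \<Phi>. \<phi> (ind D) = (1 + c) / 2 * \<phi> (ind (Q c)))"
    if "c \<in> R" for c
  proof -
    have c: "(1 + c) / 2 \<in> {0..1}"
      using R(2)[OF that] by (auto simp: abs_le_iff)
    obtain D where D: "proportional_chain (insert integ \<Phi>) (Q c) D"
      using halvable_chain[OF halvable_finite[OF \<open>finite \<Phi>\<close>] Q_sets[of c]] ..
    show ?thesis
      using proportional_chain_sets[OF D c] by blast
  qed
  then obtain D where D: "\<And>c. c \<in> R \<Longrightarrow> D c \<in> sets unit_leb" "\<And>c. c \<in> R \<Longrightarrow> D c \<subseteq> Q c"
    "\<And>c \<phi>. c \<in> R \<Longrightarrow> \<phi> \<in> \<Phi> \<Longrightarrow> \<phi> (ind (D c)) = (1 + c) / 2 * \<phi> (ind (Q c))"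
    by (metis insertCI)
  define D\<^sub>0 where "D\<^sub>0 = (\<Union>c\<in>R. D c)"
  have D0: "D\<^sub>0 \<in> sets unit_leb" "D\<^sub>0 \<subseteq> C"
    using D R(1) by (auto simp: D\<^sub>0_def Q_def)
  have "disjoint_family_on D R"
    using Q_disj D(2) unfolding disjoint_family_on_def by blast
  then have ind_D0: "ind D\<^sub>0 = (\<Sum>c\<in>R. ind (D c))"
    unfolding D\<^sub>0_def using D(1) R(1) by (intro ind_finite_Union)
  have ind_C: "ind C = (\<Sum>c\<in>R. ind (Q c))"
    using ind_finite_Union[OF R(1) Q_sets Q_disj] C_eq by simp
  have abs_s: "abs_L1 s = (\<Sum>c\<in>R. c *\<^sub>R ind (Q c))"
  proof -
    have "s t = (\<Sum>c\<in>R. c * indicator (Q c) t)" for t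
    proof (cases "t \<in> C")
      case True
      have "(\<Sum>c\<in>R. c * indicator (Q c) t) = (\<Sum>c\<in>{s t}. c * indicator (Q c) t)"
        using R(1) True by (intro sum.mono_neutral_right) (auto simp: R_def Q_def)
      then show ?thesis
        using True by (simp add: Q_def)
    next
      case False
      then show ?thesis
        using s(2) by (simp add: Q_def)
    qed
    then have "abs_L1 s = abs_L1 (\<lambda>t. \<Sum>c\<in>R. c * indicator (Q c) t)"
      by (intro arg_cong[of _ _ abs_L1] ext)
    also have "\<dots> = (\<Sum>c\<in>R. abs_L1 (\<lambda>t. c * indicator (Q c) t))"
      using R(1) integrable_indicator_unit[OF Q_sets] by (intro abs_L1_sum) auto
    also have "\<dots> = (\<Sum>c\<in>R. c *\<^sub>R ind (Q c))"
      unfolding ind_def abs_L1_scaleR[OF integrable_indicator_unit[OF Q_sets]] ..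
    finally show ?thesis .
  qed
  have "\<phi> (ind D\<^sub>0) - \<phi> (ind (C - D\<^sub>0)) = \<phi> (abs_L1 s)" if "\<phi> \<in> \<Phi>" for \<phi>
  proof -
    have "\<phi> (ind D\<^sub>0) - \<phi> (ind (C - D\<^sub>0)) = 2 * \<phi> (ind D\<^sub>0) - \<phi> (ind C)"
      using C D0 by (simp add: ind_Diff blinfun.diff_right)
    also have "\<dots> = (\<Sum>c\<in>R. 2 * \<phi> (ind (D c)) - \<phi> (ind (Q c)))"
      by (simp add: ind_D0 ind_C blinfun.sum_right sum_subtractf sum_distrib_left)
    also have "\<dots> = (\<Sum>c\<in>R. c * \<phi> (ind (Q c)))"
      using D(3)[OF _ that] by (intro sum.cong) (auto simp: field_simps)
    also have "\<dots> = \<phi> (abs_L1 s)"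
      by (simp add: abs_s blinfun.sum_right blinfun.scaleR_right)
    finally show ?thesis .
  qed
  then show ?thesis
    using D0 by blast
qed

section \<open>Oscillation left by an operator that is not completely continuous\<close>

lemma weakly_null_witness:
  fixes T :: "L1 \<Rightarrow>\<^sub>L 'x::real_normed_vector"
  assumes "\<not> completely_continuous T"
  shows "\<exists>\<eta>>0. \<exists>f. (\<forall>l :: L1 dual. (\<lambda>k. l (f k)) \<longlonglongrightarrow> 0) \<and> (\<forall>k. \<eta> \<le> norm (T (f k)))"
proof -
  obtain v l where v: "\<And>\<phi> :: L1 dual. (\<lambda>n. \<phi> (v n)) \<longlonglongrightarrow> \<phi> l" and nc: "\<not> convergent (\<lambda>n. T (v n))"
    using assms unfolding completely_continuous_def weakly_convergent_def by auto
  have "\<not> (\<lambda>n. T (v n)) \<longlonglongrightarrow> T l"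
    using nc by (auto simp: convergent_def)
  then obtain \<eta> where \<eta>: "\<eta> > 0" and far: "\<And>N. \<exists>n\<ge>N. \<eta> \<le> norm (T (v n) - T l)"
    unfolding LIMSEQ_iff by (auto simp: not_less)
  have "infinite {n. \<eta> \<le> norm (T (v n) - T l)}"
    using far unfolding infinite_nat_iff_unbounded_le by auto
  then obtain r :: "nat \<Rightarrow> nat" where r: "strict_mono r" "\<And>n. r n \<in> {n. \<eta> \<le> norm (T (v n) - T l)}"
    using infinite_enumerate by blast
  define f where "f k = v (r k) - l" for k
  have "(\<lambda>k. \<phi> (f k)) \<longlonglongrightarrow> 0" for \<phi> :: "L1 dual"
  proof -
    have "(\<lambda>k. \<phi> (v (r k))) \<longlonglongrightarrow> \<phi> l"
      using LIMSEQ_subseq_LIMSEQ[OF v r(1)] by (simp add: o_def)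
    then show ?thesis
      by (simp add: f_def blinfun.diff_right LIM_zero)
  qed
  moreover have "\<eta> \<le> norm (T (f k))" for k
    using r(2)[of k] by (simp add: f_def blinfun.diff_right)
  ultimately show ?thesis
    using \<eta> by blast
qed

lemma norm_pairing_le: "bdd_meas K \<phi> \<Longrightarrow> norm (pairing \<phi>) \<le> K"
  using pairing_le bdd_meas_nonneg by (intro norm_blinfun_bound) auto

lemma pairing_commute:
  assumes "bdd_meas K \<phi>" "bdd_meas M \<psi>"
  shows "pairing \<phi> (abs_L1 \<psi>) = pairing \<psi> (abs_L1 \<phi>)"
  using assms by (simp add: pairing_abs integrable_bdd_meas mult.commute)

lemma tendsto_reindex_ge:
  fixes X :: "nat \<Rightarrow> 'a::topological_space"
  assumes "X \<longlonglongrightarrow> x" "\<And>k. k \<le> l k"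
  shows "(\<lambda>k. X (l k)) \<longlonglongrightarrow> x"
proof (rule filterlim_compose[OF assms(1)])
  show "filterlim l at_top sequentially"
    using assms(2) by (intro filterlim_at_top_mono[OF filterlim_ident]) auto
qed

text \<open>What remains of the failure of complete continuity. The last clause is the hereditary part: the
oscillation of \<open>T\<close> along the \<open>u k\<close> is visible on every subset of \<open>B\<close> of positive measure, in proportion
to its measure.\<close>

definition oscillating_on ::
  "(L1 \<Rightarrow>\<^sub>L 'x::real_normed_vector) \<Rightarrow> real set \<Rightarrow> real \<Rightarrow> (nat \<Rightarrow> 'x dual) \<Rightarrow> (nat \<Rightarrow> real \<Rightarrow> real) \<Rightarrow> bool"
  where "oscillating_on T B c v u \<longleftrightarrow>
    (\<forall>k. norm (v k) \<le> 2) \<and> (\<forall>f. (\<lambda>k. v k (T f)) \<longlonglongrightarrow> 0) \<and>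
    (\<forall>k. bdd_simple 1 (u k)) \<and> (\<forall>l :: L1 dual. (\<lambda>k. l (abs_L1 (u k))) \<longlonglongrightarrow> 0) \<and>
    (\<forall>C\<in>sets unit_leb. C \<subseteq> B \<longrightarrow> measure unit_leb C > 0 \<longrightarrow>
      (\<forall>\<^sub>F k in sequentially. c * measure unit_leb C \<le> v k (T (mult_op (indicator C) (abs_L1 (u k))))))"

text \<open>The truncations \<open>g k\<close> of a weakly null sequence \<open>f k\<close> need not be weakly null, but a weak* convergent
sequence of them has differences \<open>g k - g (l k)\<close> that are. The index \<open>l k\<close> is taken so large that the
subtracted term hardly matters for \<open>\<phi> k\<close>. In the same way \<open>\<phi> k\<close> is replaced by
\<open>\<phi> k - \<phi> (m k)\<close>, which is weak* null; here \<open>\<phi> (m k)\<close> hardly matters because the weak* limit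
\<open>\<Phi>\<close> of the functionals is small on a weakly null sequence.\<close>

lemma paired_differences:
  fixes \<phi> :: "nat \<Rightarrow> L1 dual" and f :: "nat \<Rightarrow> L1"
  assumes g: "\<And>k. bdd_simple M (g k)"
    and G: "\<And>u. (\<lambda>k. pairing (g k) u) \<longlonglongrightarrow> G u"
    and \<Phi>: "\<And>u. (\<lambda>k. \<phi> k u) \<longlonglongrightarrow> blinfun_apply \<Phi> u"
    and f: "\<And>l :: L1 dual. (\<lambda>k. l (f k)) \<longlonglongrightarrow> 0"
    and low: "\<And>k. 4 * \<alpha> \<le> \<phi> k (f k)"
    and close: "\<And>k j. \<bar>\<phi> k (f j - abs_L1 (g j))\<bar> \<le> \<alpha>" and "\<alpha> > 0"
  shows "\<exists>l m. (\<forall>k. k \<le> l k \<and> k \<le> m k) \<and>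
    (\<forall>\<xi> :: L1 dual. (\<lambda>k. \<xi> (abs_L1 (\<lambda>t. g k t - g (l k) t))) \<longlonglongrightarrow> 0) \<and>
    (\<forall>\<^sub>F k in sequentially. \<alpha> / 2 \<le> (\<phi> k - \<phi> (m k)) (abs_L1 (\<lambda>t. g k t - g (l k) t)))"
proof -
  note g_meas = bdd_simple_bdd_meas[OF g]
  note g_int = integrable_bdd_meas[OF g_meas]
  have "\<exists>l\<ge>k. \<bar>\<phi> k (abs_L1 (g l))\<bar> \<le> 2 * \<alpha>" for k
  proof -
    obtain L where "\<And>l. l \<ge> L \<Longrightarrow> \<bar>\<phi> k (f l)\<bar> < \<alpha>"
      using LIMSEQ_D[OF f[of "\<phi> k"] \<open>\<alpha> > 0\<close>] by auto
    then have "\<bar>\<phi> k (f (max k L))\<bar> < \<alpha>"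
      by simp
    then have "\<bar>\<phi> k (abs_L1 (g (max k L)))\<bar> \<le> 2 * \<alpha>"
      using close[of k "max k L"] by (simp add: blinfun.diff_right)
    then show ?thesis
      by (intro exI[of _ "max k L"]) simp
  qed
  then obtain l where l: "\<And>k. k \<le> l k" "\<And>k. \<bar>\<phi> k (abs_L1 (g (l k)))\<bar> \<le> 2 * \<alpha>"
    by metis
  define u where "u k = abs_L1 (\<lambda>t. g k t - g (l k) t)" for k
  have u_eq: "u k = abs_L1 (g k) - abs_L1 (g (l k))" for k
    by (simp add: u_def abs_L1_diff g_int)
  have u_null: "(\<lambda>k. \<xi> (u k)) \<longlonglongrightarrow> 0" for \<xi> :: "L1 dual"
  proof -
    obtain w where w: "bdd_meas (norm \<xi>) w" "\<xi> = pairing w"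
      using L1_dual_density[of \<xi>] by blast
    have "\<xi> (u k) = pairing (g k) (abs_L1 w) - pairing (g (l k)) (abs_L1 w)" for k
      using pairing_commute[OF w(1) g_meas] by (simp add: u_eq blinfun.diff_right w(2))
    moreover have "(\<lambda>k. pairing (g k) (abs_L1 w) - pairing (g (l k)) (abs_L1 w)) \<longlonglongrightarrow> G (abs_L1 w) - G (abs_L1 w)"
      by (intro tendsto_diff G tendsto_reindex_ge[OF G l(1)])
    ultimately show ?thesis by simp
  qed
  have u_low: "\<alpha> \<le> \<phi> k (u k)" for k
    using low[of k] close[of k k] l(2)[of k] by (simp add: u_eq blinfun.diff_right)
  have "\<exists>m\<ge>k. \<bar>\<phi> m (u k) - \<Phi> (u k)\<bar> \<le> \<alpha> / 4" for k
  proof -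
    obtain L where "\<And>m. m \<ge> L \<Longrightarrow> norm (\<phi> m (u k) - \<Phi> (u k)) < \<alpha> / 4"
      using LIMSEQ_D[OF \<Phi>[of "u k"], of "\<alpha> / 4"] \<open>\<alpha> > 0\<close> by auto
    then have "norm (\<phi> (max k L) (u k) - \<Phi> (u k)) < \<alpha> / 4"
      by simp
    then show ?thesis
      by (intro exI[of _ "max k L"]) simp
  qed
  then obtain m where m: "\<And>k. k \<le> m k" "\<And>k. \<bar>\<phi> (m k) (u k) - \<Phi> (u k)\<bar> \<le> \<alpha> / 4"
    by metis
  have "\<forall>\<^sub>F k in sequentially. \<bar>\<Phi> (u k)\<bar> < \<alpha> / 4"
    using tendstoD[OF u_null[of \<Phi>], of "\<alpha> / 4"] \<open>\<alpha> > 0\<close> by (simp add: dist_real_def)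
  then have "\<forall>\<^sub>F k in sequentially. \<alpha> / 2 \<le> (\<phi> k - \<phi> (m k)) (u k)"
  proof eventually_elim
    case (elim k)
    then show ?case
      using u_low[of k] m(2)[of k] unfolding blinfun.diff_left by linarith
  qed
  then show ?thesis
    using l(1) m(1) u_null unfolding u_def by (intro exI[of _ l] exI[of _ m]) simp
qed

text \<open>The functionals \<open>f \<mapsto> v k (T (u k f))\<close> have a weak* cluster point, represented by a bounded function
\<open>w\<close>. Its integral is at least \<open>2 * c\<close>, so \<open>w > c\<close> holds on a set \<open>B\<close> of positive measure.
Integrating \<open>w\<close> over a subset of \<open>B\<close> gives the lower bound there, with a factor two to spare for the
passage to the limit.\<close>

lemma oscillation_localizes:
  fixes T :: "L1 \<Rightarrow>\<^sub>L 'x::real_normed_vector"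
  assumes v: "\<And>k. norm (v k) \<le> 2" "\<And>f. (\<lambda>k. blinfun_apply (v k) (T f)) \<longlonglongrightarrow> 0"
    and u: "\<And>k. bdd_simple 1 (u k)" "\<And>l :: L1 dual. (\<lambda>k. l (abs_L1 (u k))) \<longlonglongrightarrow> 0"
    and low: "\<forall>\<^sub>F k in sequentially. 2 * c \<le> v k (T (abs_L1 (u k)))" and "c > 0"
  shows "\<exists>B r. strict_mono r \<and> B \<in> sets unit_leb \<and> measure unit_leb B > 0 \<and>
    oscillating_on T B (c / 2) (\<lambda>k. v (r k)) (\<lambda>k. u (r k))"
proof -
  define \<Lambda> where "\<Lambda> k = v k o\<^sub>L T o\<^sub>L mult_op (u k)" for k
  note u_meas = bdd_simple_bdd_meas[OF u(1)]
  have "norm (\<Lambda> k) \<le> 2 * norm T" for k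
  proof -
    have "norm (\<Lambda> k) \<le> norm (v k o\<^sub>L T) * norm (mult_op (u k))"
      unfolding \<Lambda>_def by (rule norm_blinfun_compose)
    also have "\<dots> \<le> (norm (v k) * norm T) * 1"
      using norm_blinfun_compose[of "v k" T] norm_mult_op_le[OF u_meas[of k]] by (intro mult_mono) auto
    also have "\<dots> \<le> 2 * norm T"
      using v(1)[of k] by (simp add: mult_right_mono)
    finally show ?thesis .
  qed
  then obtain r l where r: "strict_mono r" and l: "\<And>f. (\<lambda>k. \<Lambda> (r k) f) \<longlonglongrightarrow> blinfun_apply l f"
    using L1_dual_sequentially_compact[of \<Lambda>] by blast
  obtain w where w: "bdd_meas (norm l) w" "l = pairing w"
    using L1_dual_density[of l] by blast
  note w_int = integrable_bdd_meas[OF w(1)]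
  have one: "integrable unit_leb (\<lambda>_. 1 :: real)"
    by simp
  have low_l: "2 * c \<le> (\<integral>t. w t \<partial>unit_leb)"
  proof -
    have "\<forall>\<^sub>F k in sequentially. 2 * c \<le> v (r k) (T (abs_L1 (u (r k))))"
      using r low eventually_subseq by blast
    moreover have "\<Lambda> k (abs_L1 (\<lambda>_. 1)) = v k (T (abs_L1 (u k)))" for k
      by (simp add: \<Lambda>_def mult_op_abs[OF u_meas one])
    ultimately have "\<forall>\<^sub>F k in sequentially. 2 * c \<le> \<Lambda> (r k) (abs_L1 (\<lambda>_. 1))"
      by simp
    from tendsto_lowerbound[OF l this] have "2 * c \<le> l (abs_L1 (\<lambda>_. 1))"
      by simp
    then show ?thesis
      by (simp add: w(2) pairing_abs[OF w(1) one])
  qed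
  define B where "B = {t \<in> space unit_leb. c < w t}"
  have w_meas [measurable]: "w \<in> borel_measurable unit_leb"
    using w(1) by (simp add: bdd_meas_def)
  have B: "B \<in> sets unit_leb"
    unfolding B_def by measurable
  have "measure unit_leb B > 0"
  proof (rule ccontr)
    assume "\<not> measure unit_leb B > 0"
    then have "measure unit_leb B = 0"
      using measure_nonneg[of unit_leb B] by simp
    then have "B \<in> null_sets unit_leb"
      using B by (simp add: null_sets_def unit_leb.emeasure_eq_measure)
    from AE_not_in[OF this] AE_space have "AE t in unit_leb. w t \<le> c"
      by eventually_elim (auto simp: B_def)
    then have "(\<integral>t. w t \<partial>unit_leb) \<le> (\<integral>t. c \<partial>unit_leb)"
      using w_int by (intro integral_mono_AE) auto
    then show False
      using low_l \<open>c > 0\<close> by (simp add: measure_restrict_space)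
  qed
  moreover have "\<forall>\<^sub>F k in sequentially.
      c / 2 * measure unit_leb C \<le> v (r k) (T (mult_op (indicator C) (abs_L1 (u (r k)))))"
    if C: "C \<in> sets unit_leb" "C \<subseteq> B" "measure unit_leb C > 0" for C
  proof -
    note int_C = integrable_indicator_unit[OF C(1)]
    have "c * measure unit_leb C = (\<integral>t. c * indicator C t \<partial>unit_leb)"
      using C(1) by (simp add: sets_unit_leb_Int)
    also have "\<dots> \<le> (\<integral>t. w t * indicator C t \<partial>unit_leb)"
    proof (rule integral_mono)
      show "integrable unit_leb (\<lambda>t. w t * indicator C t)"
        by (rule bdd_meas_mult_integrable[OF w(1) int_C])
      show "c * indicator C t \<le> w t * indicator C t" for t
        using C(2) by (auto simp: B_def indicator_def)
    qed (use int_C in simp)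
    also have "\<dots> = l (ind C)"
      by (simp add: w(2) ind_def pairing_abs[OF w(1) int_C])
    finally have "c / 2 * measure unit_leb C < l (ind C)"
      using mult_pos_pos[OF \<open>c > 0\<close> C(3)] by simp
    then have "\<forall>\<^sub>F k in sequentially. c / 2 * measure unit_leb C < \<Lambda> (r k) (ind C)"
      using order_tendstoD(1)[OF l] by blast
    moreover have "\<Lambda> k (ind C) = v k (T (mult_op (indicator C) (abs_L1 (u k))))" for k
      by (simp add: \<Lambda>_def ind_def mult_op_abs[OF u_meas int_C]
          mult_op_abs[OF bdd_meas_indicator[OF C(1)] integrable_bdd_meas[OF u_meas]] mult.commute)
    ultimately show ?thesis
      by (auto elim!: eventually_mono)
  qed
  moreover have "(\<lambda>k. v (r k) (T f)) \<longlonglongrightarrow> 0" for f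
    using LIMSEQ_subseq_LIMSEQ[OF v(2) r] by (simp add: o_def)
  moreover have "(\<lambda>k. \<xi> (abs_L1 (u (r k)))) \<longlonglongrightarrow> 0" for \<xi> :: "L1 dual"
    using LIMSEQ_subseq_LIMSEQ[OF u(2) r] by (simp add: o_def)
  ultimately show ?thesis
    using B r u(1) v(1) unfolding oscillating_on_def by (intro exI[of _ B] exI[of _ r]) simp
qed

text \<open>The functionals are taken from \<open>Y\<close> so that they norm \<open>T (f k)\<close> up to the constant; \<open>\<epsilon>\<close> is the
truncation error that costs them at most \<open>\<alpha>\<close>.\<close>

lemma oscillation_of_non_completely_continuous:
  fixes T :: "L1 \<Rightarrow>\<^sub>L 'x::real_normed_vector"
  assumes norming: "norms_within Y UNIV \<tau>" and ncc: "\<not> completely_continuous T"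
  shows "\<exists>B c v u. B \<in> sets unit_leb \<and> measure unit_leb B > 0 \<and> c > 0 \<and>
    (\<forall>k. v k \<in> span Y) \<and> oscillating_on T B c v u"
proof -
  obtain \<eta> f where \<eta>: "\<eta> > 0" and f: "\<And>l :: L1 dual. (\<lambda>k. l (f k)) \<longlonglongrightarrow> 0"
    and Tf: "\<And>k. \<eta> \<le> norm (T (f k))"
    using weakly_null_witness[OF ncc] by blast
  have \<tau>: "\<tau> > 1" and Y: "\<And>y. y \<in> Y \<Longrightarrow> norm y = 1"
    using norming by (auto simp: norms_within_def)
  have "\<exists>y\<in>Y. norm (T (f k)) \<le> \<tau> * y (T (f k))" for k
    using norming by (auto simp: norms_within_def)
  then obtain y where y: "\<And>k. y k \<in> Y" "\<And>k. norm (T (f k)) \<le> \<tau> * blinfun_apply (y k) (T (f k))"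
    by metis
  define \<alpha> where "\<alpha> = \<eta> / (4 * \<tau>)"
  have \<alpha>: "\<alpha> > 0" and yTf: "4 * \<alpha> \<le> y k (T (f k))" for k
    using \<eta> \<tau> order.trans[OF Tf y(2), of k] by (auto simp: \<alpha>_def field_simps)
  define \<epsilon> where "\<epsilon> = \<alpha> / (norm T + 1)"
  have \<epsilon>: "\<epsilon> > 0" "norm T * \<epsilon> \<le> \<alpha>"
    using \<alpha> norm_ge_zero[of T] by (auto simp: \<epsilon>_def field_simps add_pos_nonneg)
  obtain M N where M: "M > 0" and "\<And>k. k \<ge> N \<Longrightarrow> \<exists>s. bdd_simple M s \<and> norm (f k - abs_L1 s) \<le> \<epsilon>"
    using weakly_null_simple_approximation[OF f \<epsilon>(1)] by blast
  then have "\<exists>s. bdd_simple M s \<and> norm (f (k + N) - abs_L1 s) \<le> \<epsilon>" for k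
    by simp
  then obtain g\<^sub>0 where g0: "\<And>k. bdd_simple M (g\<^sub>0 k)" "\<And>k. norm (f (k + N) - abs_L1 (g\<^sub>0 k)) \<le> \<epsilon>"
    by metis
  obtain r\<^sub>1 G where r1: "strict_mono r\<^sub>1" and G: "\<And>u. (\<lambda>k. pairing (g\<^sub>0 (r\<^sub>1 k)) u) \<longlonglongrightarrow> blinfun_apply G u"
    using L1_dual_sequentially_compact[of "\<lambda>k. pairing (g\<^sub>0 k)" M] norm_pairing_le[OF bdd_simple_bdd_meas[OF g0(1)]]
    by blast
  have y_norm: "norm (y k o\<^sub>L T) \<le> norm T" for k
    using norm_blinfun_compose[of "y k" T] Y[OF y(1)[of k]] by simp
  obtain r\<^sub>2 \<Phi> where r2: "strict_mono r\<^sub>2"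
    and \<Phi>: "\<And>u. (\<lambda>k. (y (r\<^sub>1 (r\<^sub>2 k) + N) o\<^sub>L T) u) \<longlonglongrightarrow> blinfun_apply \<Phi> u"
    using L1_dual_sequentially_compact[of "\<lambda>k. y (r\<^sub>1 k + N) o\<^sub>L T" "norm T"] y_norm by blast
  define q where "q k = r\<^sub>1 (r\<^sub>2 k)" for k
  define g where "g k = g\<^sub>0 (q k)" for k
  define z where "z k = y (q k + N)" for k
  have q: "strict_mono (\<lambda>k. q k + N)"
    using strict_mono_o[OF r1 r2] by (auto simp: q_def strict_mono_def)
  have gs: "bdd_simple M (g k)" for k
    by (simp add: g_def g0)
  have "\<exists>l m. (\<forall>k. k \<le> l k \<and> k \<le> m k) \<and>
    (\<forall>\<xi> :: L1 dual. (\<lambda>k. \<xi> (abs_L1 (\<lambda>t. g k t - g (l k) t))) \<longlonglongrightarrow> 0) \<and>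
    (\<forall>\<^sub>F k in sequentially. \<alpha> / 2 \<le> ((z k o\<^sub>L T) - (z (m k) o\<^sub>L T)) (abs_L1 (\<lambda>t. g k t - g (l k) t)))"
  proof (rule paired_differences[OF gs])
    show "(\<lambda>k. pairing (g k) u) \<longlonglongrightarrow> G u" for u
      using LIMSEQ_subseq_LIMSEQ[OF G r2] by (simp add: o_def g_def q_def)
    show "(\<lambda>k. (z k o\<^sub>L T) u) \<longlonglongrightarrow> \<Phi> u" for u
      using \<Phi> by (simp add: z_def q_def)
    show "(\<lambda>k. l (f (q k + N))) \<longlonglongrightarrow> 0" for l :: "L1 dual"
      using LIMSEQ_subseq_LIMSEQ[OF f q] by (simp add: o_def)
    show "4 * \<alpha> \<le> (z k o\<^sub>L T) (f (q k + N))" for k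
      using yTf by (simp add: z_def)
    show "\<bar>(z k o\<^sub>L T) (f (q j + N) - abs_L1 (g j))\<bar> \<le> \<alpha>" for k j
    proof -
      have "\<bar>(z k o\<^sub>L T) (f (q j + N) - abs_L1 (g j))\<bar> \<le> norm (z k o\<^sub>L T) * norm (f (q j + N) - abs_L1 (g j))"
        using norm_blinfun[of "z k o\<^sub>L T"] by (metis real_norm_def)
      also have "\<dots> \<le> norm T * \<epsilon>"
        using y_norm g0(2) by (intro mult_mono) (auto simp: z_def g_def)
      finally show ?thesis
        using \<epsilon>(2) by linarith
    qed
  qed (rule \<alpha>)
  then obtain l m where lm: "\<And>k. k \<le> l k" "\<And>k. k \<le> m k"
    and null: "\<And>\<xi> :: L1 dual. (\<lambda>k. \<xi> (abs_L1 (\<lambda>t. g k t - g (l k) t))) \<longlonglongrightarrow> 0"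
    and low: "\<forall>\<^sub>F k in sequentially. \<alpha> / 2 \<le> ((z k o\<^sub>L T) - (z (m k) o\<^sub>L T)) (abs_L1 (\<lambda>t. g k t - g (l k) t))"
    by auto
  define v where "v k = z k - z (m k)" for k
  define u where "u k t = (g k t - g (l k) t) / (2 * M)" for k t
  define d where "d k t = g k t - g (l k) t" for k t
  have d_int: "integrable unit_leb (d k)" for k
    unfolding d_def using integrable_bdd_meas[OF bdd_simple_bdd_meas[OF gs]] by simp
  have u_eq: "abs_L1 (u k) = (1 / (2 * M)) *\<^sub>R abs_L1 (d k)" for k
    using abs_L1_scaleR[OF d_int[of k], of "1 / (2 * M)"] by (simp add: u_def [abs_def] d_def [abs_def])
  have us: "bdd_simple 1 (u k)" for k
  proof -
    have gk: "\<bar>g i t\<bar> \<le> M" "finite (range (g i))" "g i \<in> borel_measurable unit_leb" for i t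
      using gs[of i] by (auto simp: bdd_simple_def)
    have "\<bar>u k t\<bar> \<le> 1" for t
      using gk(1)[of k t] gk(1)[of "l k" t] M by (auto simp: u_def abs_le_iff field_simps)
    moreover have "range (u k) \<subseteq> (\<lambda>(a, b). (a - b) / (2 * M)) ` (range (g k) \<times> range (g (l k)))"
      by (auto simp: u_def)
    then have "finite (range (u k))"
      by (rule finite_subset) (use gk(2) in blast)
    ultimately show ?thesis
      using gk(3) by (simp add: bdd_simple_def u_def [abs_def])
  qed
  have "\<exists>B r. strict_mono r \<and> B \<in> sets unit_leb \<and> measure unit_leb B > 0 \<and>
    oscillating_on T B (\<alpha> / (8 * M) / 2) (\<lambda>k. v (r k)) (\<lambda>k. u (r k))"
  proof (rule oscillation_localizes)
    show "norm (v k) \<le> 2" for k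
      using norm_triangle_ineq4[of "z k" "z (m k)"] Y[OF y(1)] by (simp add: v_def z_def)
    show "(\<lambda>k. v k (T h)) \<longlonglongrightarrow> 0" for h
    proof -
      have z_lim: "(\<lambda>k. z k (T h)) \<longlonglongrightarrow> \<Phi> h"
        using \<Phi>[of h] by (simp add: z_def q_def)
      from tendsto_diff[OF z_lim tendsto_reindex_ge[OF z_lim lm(2)]] show ?thesis
        by (simp add: v_def blinfun.diff_left)
    qed
    show "(\<lambda>k. \<xi> (abs_L1 (u k))) \<longlonglongrightarrow> 0" for \<xi> :: "L1 dual"
      using tendsto_mult_right_zero[OF null[of \<xi>], of "1 / (2 * M)"]
      by (simp add: u_eq blinfun.scaleR_right d_def [abs_def])
    show "\<forall>\<^sub>F k in sequentially. 2 * (\<alpha> / (8 * M)) \<le> v k (T (abs_L1 (u k)))"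
      using low
    proof eventually_elim
      case (elim k)
      then have "1 / (2 * M) * (\<alpha> / 2) \<le> 1 / (2 * M) * v k (T (abs_L1 (d k)))"
        using M by (intro mult_left_mono) (auto simp: v_def d_def [abs_def] blinfun.diff_left)
      then show ?case
        by (simp add: u_eq blinfun.scaleR_right)
    qed
    show "\<alpha> / (8 * M) > 0"
      using \<alpha> M by simp
  qed (rule us)
  then obtain B r where "B \<in> sets unit_leb" "measure unit_leb B > 0"
    "oscillating_on T B (\<alpha> / (8 * M) / 2) (\<lambda>k. v (r k)) (\<lambda>k. u (r k))"
    by blast
  moreover have "v k \<in> span Y" for k
    unfolding v_def z_def by (intro span_diff span_base y)
  moreover have "\<alpha> / (8 * M) / 2 > 0"
    using \<alpha> M by simp
  ultimately show ?thesis
    by meson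
qed

section \<open>The splitting step\<close>

lemma bdd_simple_mono: "bdd_simple a s \<Longrightarrow> a \<le> b \<Longrightarrow> bdd_simple b s"
  unfolding bdd_simple_def by (meson order.trans)

lemma bdd_simple_add:
  assumes "bdd_simple a s" "bdd_simple b r"
  shows "bdd_simple (a + b) (\<lambda>t. s t + r t)"
proof -
  have "range (\<lambda>t. s t + r t) \<subseteq> (\<lambda>(x, y). x + y) ` (range s \<times> range r)"
    by auto
  then have "finite (range (\<lambda>t. s t + r t))"
    by (rule finite_subset) (use assms in \<open>auto simp: bdd_simple_def\<close>)
  moreover have "\<bar>s t + r t\<bar> \<le> a + b" for t
    using assms abs_triangle_ineq[of "s t" "r t"] by (smt (verit) bdd_simple_def)
  moreover have "(\<lambda>t. s t + r t) \<in> borel_measurable unit_leb"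
    using assms by (intro borel_measurable_add) (auto simp: bdd_simple_def)
  ultimately show ?thesis
    by (simp add: bdd_simple_def)
qed

lemma bdd_simple_scale:
  assumes "bdd_simple a s"
  shows "bdd_simple (\<bar>c\<bar> * a) (\<lambda>t. c * s t)"
proof -
  have "range (\<lambda>t. c * s t) = (\<lambda>x. c * x) ` range s"
    by auto
  then show ?thesis
    using assms by (auto simp: bdd_simple_def abs_mult intro: mult_left_mono)
qed

lemma bdd_simple_indicator_mult:
  assumes "bdd_simple a s" "C \<in> sets unit_leb"
  shows "bdd_simple a (\<lambda>t. indicator C t * s t)"
proof -
  have "range (\<lambda>t. indicator C t * s t) \<subseteq> insert 0 (range s)"
    by (auto simp: indicator_def)
  then have "finite (range (\<lambda>t. indicator C t * s t))"
    by (rule finite_subset) (use assms in \<open>auto simp: bdd_simple_def\<close>)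
  moreover have "0 \<le> a"
    using bdd_meas_nonneg[OF bdd_simple_bdd_meas[OF assms(1)]] .
  ultimately show ?thesis
    using assms by (auto simp: bdd_simple_def indicator_def)
qed

text \<open>The supremum norm on simple functions supported in \<open>C\<close>, as a relation on classes of functions.\<close>

definition simple_on :: "real set \<Rightarrow> L1 \<Rightarrow> real \<Rightarrow> bool" where
  "simple_on C f a \<longleftrightarrow> (\<exists>s. bdd_simple a s \<and> (\<forall>t. t \<notin> C \<longrightarrow> s t = 0) \<and> f = abs_L1 s)"

lemma simple_on_zero: "simple_on C 0 0"
  unfolding simple_on_def
  by (intro exI[of _ "\<lambda>_. 0"]) (simp add: bdd_simple_def abs_L1_zero)

lemma simple_on_mono: "simple_on C f a \<Longrightarrow> a \<le> b \<Longrightarrow> simple_on C f b"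
  unfolding simple_on_def using bdd_simple_mono by blast

lemma simple_on_add:
  assumes "simple_on C f a" "simple_on C g b"
  shows "simple_on C (f + g) (a + b)"
proof -
  obtain s r where s: "bdd_simple a s" "\<And>t. t \<notin> C \<Longrightarrow> s t = 0" "f = abs_L1 s"
    and r: "bdd_simple b r" "\<And>t. t \<notin> C \<Longrightarrow> r t = 0" "g = abs_L1 r"
    using assms unfolding simple_on_def by auto
  have "f + g = abs_L1 (\<lambda>t. s t + r t)"
    using s r by (simp add: abs_L1_add integrable_bdd_meas[OF bdd_simple_bdd_meas])
  then show ?thesis
    unfolding simple_on_def using bdd_simple_add[OF s(1) r(1)] s(2) r(2)
    by (intro exI[of _ "\<lambda>t. s t + r t"]) simp
qed

lemma simple_on_scale:
  assumes "simple_on C f a"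
  shows "simple_on C (c *\<^sub>R f) (\<bar>c\<bar> * a)"
proof -
  obtain s where s: "bdd_simple a s" "\<And>t. t \<notin> C \<Longrightarrow> s t = 0" "f = abs_L1 s"
    using assms unfolding simple_on_def by auto
  have "c *\<^sub>R f = abs_L1 (\<lambda>t. c * s t)"
    using s by (simp add: abs_L1_scaleR integrable_bdd_meas[OF bdd_simple_bdd_meas])
  then show ?thesis
    unfolding simple_on_def using bdd_simple_scale[OF s(1)] s(2)
    by (intro exI[of _ "\<lambda>t. c * s t"]) simp
qed

lemma norm_simple_on: "simple_on C f a \<Longrightarrow> norm f \<le> a"
  unfolding simple_on_def using norm_bdd_meas_le bdd_simple_bdd_meas by blast

lemma simple_on_mult_op:
  assumes "bdd_simple a s" "C \<in> sets unit_leb"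
  shows "simple_on C (mult_op (indicator C) (abs_L1 s)) a"
proof -
  have "mult_op (indicator C) (abs_L1 s) = abs_L1 (\<lambda>t. indicator C t * s t)"
    by (rule mult_op_abs[OF bdd_meas_indicator[OF assms(2)] integrable_bdd_meas[OF bdd_simple_bdd_meas[OF assms(1)]]])
  then show ?thesis
    unfolding simple_on_def using bdd_simple_indicator_mult[OF assms]
    by (intro exI[of _ "\<lambda>t. indicator C t * s t"]) simp
qed

lemma simple_on_to_halves:
  fixes \<Phi> :: "L1 dual set"
  assumes f: "simple_on C f 1" and C: "C \<in> sets unit_leb" and "finite \<Phi>" and int0: "integ f = 0"
  shows "\<exists>D\<in>sets unit_leb. D \<subseteq> C \<and> measure unit_leb D = measure unit_leb (C - D) \<and>
    (\<forall>\<phi>\<in>\<Phi>. \<phi> (ind D - ind (C - D)) = \<phi> f)"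
proof -
  obtain s where s: "bdd_simple 1 s" "\<And>t. t \<notin> C \<Longrightarrow> s t = 0" "f = abs_L1 s"
    using f unfolding simple_on_def by auto
  obtain D where D: "D \<in> sets unit_leb" "D \<subseteq> C"
    "\<forall>\<phi>\<in>insert integ \<Phi>. \<phi> (ind D) - \<phi> (ind (C - D)) = \<phi> (abs_L1 s)"
    using simple_function_to_sign[OF s(1,2) C, of "insert integ \<Phi>"] \<open>finite \<Phi>\<close> by auto
  have "integ (ind D) - integ (ind (C - D)) = 0"
    using D(3) int0 s(3) by simp
  then have "measure unit_leb D = measure unit_leb (C - D)"
    using integ_ind[OF D(1)] integ_ind[of "C - D"] C D(1) by simp
  moreover have "\<forall>\<phi>\<in>\<Phi>. \<phi> (ind D - ind (C - D)) = \<phi> f"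
    using D(3) s(3) by (simp add: blinfun.diff_right)
  ultimately show ?thesis
    using D(1,2) by blast
qed

lemma finite_functional_correction:
  fixes \<Phi> :: "L1 dual set"
  assumes "finite \<Phi>"
  shows "\<exists>K\<ge>0. \<forall>f a. simple_on C f a \<longrightarrow>
    (\<exists>e. (\<forall>\<phi>\<in>\<Phi>. blinfun_apply \<phi> e = blinfun_apply \<phi> f) \<and> simple_on C e (K * (\<Sum>\<phi>\<in>\<Phi>. \<bar>blinfun_apply \<phi> f\<bar>)))"
proof (rule controlled_correction[where L = blinfun_apply, OF assms])
  fix \<phi> :: "L1 dual"
  show "linear (blinfun_apply \<phi>)"
    by (rule bounded_linear.linear[OF blinfun.bounded_linear_right])
  show "\<exists>b\<ge>0. \<forall>f a. simple_on C f a \<longrightarrow> \<bar>blinfun_apply \<phi> f\<bar> \<le> b * a"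
  proof (intro exI[of _ "norm \<phi>"] conjI allI impI)
    fix f a assume "simple_on C f a"
    then have "norm \<phi> * norm f \<le> norm \<phi> * a"
      using norm_simple_on by (intro mult_left_mono) auto
    then show "\<bar>\<phi> f\<bar> \<le> norm \<phi> * a"
      using norm_blinfun[of \<phi> f] by simp
  qed simp
qed (auto intro: simple_on_zero simple_on_mono simple_on_add simple_on_scale)

lemma finite_evaluation_correction:
  fixes \<Y> :: "'x::real_normed_vector dual set" and F :: "'x set"
  assumes "finite F" "subspace \<Y>"
  shows "\<exists>K\<ge>0. \<forall>y\<in>\<Y>. \<exists>e\<in>\<Y>. (\<forall>x\<in>F. blinfun_apply e x = blinfun_apply y x) \<and> norm e \<le> K * (\<Sum>x\<in>F. \<bar>blinfun_apply y x\<bar>)"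
proof -
  define P where "P y a \<longleftrightarrow> y \<in> \<Y> \<and> norm y \<le> a" for y :: "'x dual" and a :: real
  have "\<exists>K\<ge>0. \<forall>y a. P y a \<longrightarrow> (\<exists>e. (\<forall>x\<in>F. blinfun_apply e x = blinfun_apply y x) \<and> P e (K * (\<Sum>x\<in>F. \<bar>blinfun_apply y x\<bar>)))"
  proof (rule controlled_correction[where L = "\<lambda>x y. blinfun_apply y x", OF assms(1)])
    fix x :: 'x
    show "linear (\<lambda>y. blinfun_apply y x)"
      by (rule bounded_linear.linear[OF blinfun.bounded_linear_left])
    show "\<exists>b\<ge>0. \<forall>y a. P y a \<longrightarrow> \<bar>blinfun_apply y x\<bar> \<le> b * a"
    proof (intro exI[of _ "norm x"] conjI allI impI)
      fix y a assume "P y a"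
      then show "\<bar>blinfun_apply y x\<bar> \<le> norm x * a"
        using order.trans[OF norm_blinfun[of y x] mult_right_mono[OF _ norm_ge_zero]]
        by (simp add: P_def mult.commute)
    qed simp
  next
    show "P (u + v) (a + b)" if "P u a" "P v b" for u v a b
      using that norm_triangle_mono[of u a v b] by (simp add: P_def subspace_add[OF assms(2)])
    show "P (c *\<^sub>R u) (\<bar>c\<bar> * a)" if "P u a" for u a c
      using that by (simp add: P_def subspace_scale[OF assms(2)] mult_left_mono)
  qed (auto simp: P_def subspace_0[OF assms(2)])
  then obtain K where K: "K \<ge> 0"
    "\<And>y a. P y a \<Longrightarrow> \<exists>e. (\<forall>x\<in>F. blinfun_apply e x = blinfun_apply y x) \<and> P e (K * (\<Sum>x\<in>F. \<bar>blinfun_apply y x\<bar>))"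
    by blast
  have "\<exists>e\<in>\<Y>. (\<forall>x\<in>F. blinfun_apply e x = blinfun_apply y x) \<and> norm e \<le> K * (\<Sum>x\<in>F. \<bar>blinfun_apply y x\<bar>)" if "y \<in> \<Y>" for y
    using K(2)[of y "norm y"] that by (auto simp: P_def)
  then show ?thesis
    using K(1) by blast
qed

lemma tendsto_sum_abs_zero:
  fixes X :: "'i \<Rightarrow> nat \<Rightarrow> real"
  assumes "\<And>i. i \<in> I \<Longrightarrow> X i \<longlonglongrightarrow> 0"
  shows "(\<lambda>k. K * (\<Sum>i\<in>I. \<bar>X i k\<bar>)) \<longlonglongrightarrow> 0"
proof -
  have "(\<lambda>k. K * (\<Sum>i\<in>I. \<bar>X i k\<bar>)) \<longlonglongrightarrow> K * (\<Sum>i\<in>I. \<bar>0\<bar>)"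
    using assms by (intro tendsto_intros)
  then show ?thesis by simp
qed

text \<open>For large \<open>k\<close> all requirements hold up to small errors: \<open>v k\<close> is small on \<open>T f\<close> for the finitely many
\<open>f\<close> in question, and the restriction of \<open>u k\<close> to each \<open>C i\<close> is almost annihilated by the integral
and by the \<open>z o\<^sub>L T\<close>, while \<open>v k\<close> still sees it. Small corrections make these relations exact. Lyapunov's
theorem then turns the corrected function on \<open>C i\<close> into the difference of the indicators of two halves,
preserving the value under the normalized functional \<open>x\<close>. That value is the same
multiple of the measure for all sets because the corrected functions can be scaled down beforehand.\<close>

lemma splitting_step:
  fixes T :: "L1 \<Rightarrow>\<^sub>L 'x::real_normed_vector" and Z :: "'x dual set"
    and C :: "'i \<Rightarrow> real set"
  assumes osc: "oscillating_on T B c v u" and "c > 0" and v: "\<And>k. v k \<in> \<Y>" and \<Y>: "subspace \<Y>"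
    and I: "finite I" "I \<noteq> {}"
    and C: "\<And>i. i \<in> I \<Longrightarrow> C i \<in> sets unit_leb \<and> C i \<subseteq> B \<and> measure unit_leb (C i) > 0"
    and F: "finite F" and Z: "finite Z" and G: "finite G" "\<epsilon> > 0"
  obtains x :: "'x dual" and D :: "'i \<Rightarrow> real set"
  where "x \<in> \<Y>" "norm x = 1" "\<And>f. f \<in> F \<Longrightarrow> x (T f) = 0" "\<And>g. g \<in> G \<Longrightarrow> \<bar>x (T g)\<bar> \<le> \<epsilon>"
    "\<And>i. i \<in> I \<Longrightarrow> D i \<in> sets unit_leb" "\<And>i. i \<in> I \<Longrightarrow> D i \<subseteq> C i"
    "\<And>i. i \<in> I \<Longrightarrow> measure unit_leb (D i) = measure unit_leb (C i - D i)"
    "\<And>i z. i \<in> I \<Longrightarrow> z \<in> Z \<Longrightarrow> z (T (ind (D i) - ind (C i - D i))) = 0"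
    "\<And>i. i \<in> I \<Longrightarrow> x (T (ind (D i) - ind (C i - D i))) = c / 12 * measure unit_leb (C i)"
proof -
  have v_norm: "\<And>k. norm (v k) \<le> 2" and v_null: "\<And>f. (\<lambda>k. v k (T f)) \<longlonglongrightarrow> 0"
    and u: "\<And>k. bdd_simple 1 (u k)" and u_null: "\<And>l :: L1 dual. (\<lambda>k. l (abs_L1 (u k))) \<longlonglongrightarrow> 0"
    and low: "\<And>C. C \<in> sets unit_leb \<Longrightarrow> C \<subseteq> B \<Longrightarrow> measure unit_leb C > 0 \<Longrightarrow>
      \<forall>\<^sub>F k in sequentially. c * measure unit_leb C \<le> v k (T (mult_op (indicator C) (abs_L1 (u k))))"
    using osc unfolding oscillating_on_def by auto
  obtain K where K: "K \<ge> 0"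
    "\<And>y. y \<in> \<Y> \<Longrightarrow> \<exists>e\<in>\<Y>. (\<forall>x\<in>T ` F. blinfun_apply e x = blinfun_apply y x) \<and> norm e \<le> K * (\<Sum>x\<in>T ` F. \<bar>blinfun_apply y x\<bar>)"
    using finite_evaluation_correction[OF finite_imageI[OF F] \<Y>] by metis
  define \<alpha> where "\<alpha> k = K * (\<Sum>x\<in>T ` F. \<bar>blinfun_apply (v k) x\<bar>)" for k
  have \<alpha>: "\<alpha> \<longlonglongrightarrow> 0"
    unfolding \<alpha>_def [abs_def] using v_null by (intro tendsto_sum_abs_zero) auto
  have "\<exists>e\<in>\<Y>. (\<forall>x\<in>T ` F. blinfun_apply e x = blinfun_apply (v k) x) \<and> norm e \<le> \<alpha> k" for k
    using K(2)[OF v] by (simp add: \<alpha>_def)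
  then obtain e where e: "\<And>k. e k \<in> \<Y>" "\<And>k f. f \<in> F \<Longrightarrow> blinfun_apply (e k) (T f) = v k (T f)"
    "\<And>k. norm (e k) \<le> \<alpha> k"
    by (metis imageI)
  define w where "w k = v k - e k" for k
  have w_Y: "w k \<in> \<Y>" for k
    unfolding w_def by (intro subspace_diff \<Y> v e)
  have w_F: "w k (T f) = 0" if "f \<in> F" for k f
    using e(2)[OF that] by (simp add: w_def blinfun.diff_left)
  define \<Phi> where "\<Phi> = insert integ ((\<lambda>z. z o\<^sub>L T) ` Z)"
  have fin\<Phi>: "finite \<Phi>"
    using Z by (simp add: \<Phi>_def)
  have "\<exists>K\<ge>0. \<forall>f a. simple_on (C i) f a \<longrightarrow>
    (\<exists>e. (\<forall>\<phi>\<in>\<Phi>. blinfun_apply \<phi> e = blinfun_apply \<phi> f) \<and> simple_on (C i) e (K * (\<Sum>\<phi>\<in>\<Phi>. \<bar>blinfun_apply \<phi> f\<bar>)))" for i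
    by (rule finite_functional_correction[OF fin\<Phi>])
  then obtain L where L: "\<And>i. L i \<ge> 0" "\<And>i f a. simple_on (C i) f a \<Longrightarrow>
    \<exists>e. (\<forall>\<phi>\<in>\<Phi>. blinfun_apply \<phi> e = blinfun_apply \<phi> f) \<and> simple_on (C i) e (L i * (\<Sum>\<phi>\<in>\<Phi>. \<bar>blinfun_apply \<phi> f\<bar>))"
    by metis
  define g where "g i k = mult_op (indicator (C i)) (abs_L1 (u k))" for i k
  have g_simple: "simple_on (C i) (g i k) 1" if "i \<in> I" for i k
    unfolding g_def using simple_on_mult_op[OF u] C[OF that] by blast
  have g_null: "(\<lambda>k. \<phi> (g i k)) \<longlonglongrightarrow> 0" for \<phi> :: "L1 dual" and i
    using u_null[of "\<phi> o\<^sub>L mult_op (indicator (C i))"] by (simp add: g_def)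
  define \<beta> where "\<beta> i k = L i * (\<Sum>\<phi>\<in>\<Phi>. \<bar>blinfun_apply \<phi> (g i k)\<bar>)" for i k
  have \<beta>: "\<beta> i \<longlonglongrightarrow> 0" for i
    unfolding \<beta>_def [abs_def] by (intro tendsto_sum_abs_zero g_null)
  have "\<exists>d. (\<forall>\<phi>\<in>\<Phi>. blinfun_apply \<phi> d = blinfun_apply \<phi> (g i k)) \<and> simple_on (C i) d (\<beta> i k)" if "i \<in> I" for i k
    unfolding \<beta>_def by (rule L(2)[OF g_simple[OF that]])
  then obtain d where d: "\<And>i k \<phi>. i \<in> I \<Longrightarrow> \<phi> \<in> \<Phi> \<Longrightarrow> blinfun_apply \<phi> (d i k) = \<phi> (g i k)"
    "\<And>i k. i \<in> I \<Longrightarrow> simple_on (C i) (d i k) (\<beta> i k)"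
    by metis
  \<comment> \<open>the factor keeps the corrected function bounded by one once the correction is\<close>
  define h where "h i k = (1 / 2) *\<^sub>R (g i k - d i k)" for i k
  have h_\<Phi>: "\<phi> (h i k) = 0" if "i \<in> I" "\<phi> \<in> \<Phi>" for i k \<phi>
    using d(1)[OF that] by (simp add: h_def blinfun.bilinear_simps)
  have h_simple: "simple_on (C i) (h i k) 1" if "i \<in> I" "\<beta> i k \<le> 1" for i k
  proof -
    have "simple_on (C i) (g i k + (-1) *\<^sub>R d i k) (1 + \<bar>-1\<bar> * \<beta> i k)"
      by (intro simple_on_add simple_on_scale g_simple d that)
    from simple_on_scale[OF this, of "1 / 2"]
    have "simple_on (C i) (h i k) (1 / 2 * (1 + \<beta> i k))"
      by (simp add: h_def)
    then show ?thesis
      by (rule simple_on_mono) (use that(2) in simp)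
  qed
  define m where "m i = measure unit_leb (C i)" for i
  have m: "m i > 0" if "i \<in> I" for i
    using C[OF that] by (simp add: m_def)
  have h_low: "c / 4 * m i \<le> w k (T (h i k))"
    if i: "i \<in> I" and ev: "c * m i \<le> v k (T (g i k))" "\<alpha> k \<le> 1" "\<alpha> k * norm T \<le> c / 4 * m i"
      "3 * norm T * \<beta> i k \<le> c / 4 * m i" for i k
  proof -
    have "\<bar>e k (T (g i k))\<bar> \<le> norm (e k) * norm (T (g i k))"
      using norm_blinfun[of "e k" "T (g i k)"] by simp
    also have "\<dots> \<le> \<alpha> k * (norm T * 1)"
      using e(3)[of k] order.trans[OF norm_ge_zero e(3)[of k]] norm_simple_on[OF g_simple[OF i], of k]
      by (intro mult_mono order.trans[OF norm_blinfun]) (auto intro: mult_left_mono)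
    finally have eg: "\<bar>e k (T (g i k))\<bar> \<le> c / 4 * m i"
      using ev(3) by simp
    have "norm (w k) \<le> 3"
      using norm_triangle_ineq4[of "v k" "e k"] v_norm[of k] e(3)[of k] ev(2) by (simp add: w_def)
    then have "\<bar>w k (T (d i k))\<bar> \<le> 3 * (norm T * \<beta> i k)"
      using norm_simple_on[OF d(2)[OF i], of k]
      by (intro order.trans[OF norm_blinfun[of "w k" "T (d i k)", unfolded real_norm_def]]
          mult_mono order.trans[OF norm_blinfun]) (auto intro: mult_left_mono)
    then have wd: "\<bar>w k (T (d i k))\<bar> \<le> c / 4 * m i"
      using ev(4) by simp
    have "w k (T (h i k)) = (v k (T (g i k)) - e k (T (g i k)) - w k (T (d i k))) / 2"
      by (simp add: h_def w_def blinfun.bilinear_simps)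
    then show ?thesis
      using ev(1) eg wd by (simp add: field_simps abs_le_iff)
  qed
  obtain i\<^sub>0 where i0: "i\<^sub>0 \<in> I"
    using I(2) by blast
  \<comment> \<open>a lower bound for the norm of \<open>w k\<close>, so that normalizing it keeps \<open>x\<close> small on \<open>T ` G\<close>\<close>
  define b where "b = c / 4 * m i\<^sub>0 / (norm T + 1)"
  have T1: "norm T + 1 > 0"
    using norm_ge_zero[of T] by linarith
  have b: "b > 0"
    using \<open>c > 0\<close> m[OF i0] T1 by (simp add: b_def)
  have small: "\<forall>\<^sub>F k in sequentially. X k \<le> y" if "X \<longlonglongrightarrow> 0" "y > 0" for X :: "nat \<Rightarrow> real" and y
    using order_tendstoD(2)[OF that] by (rule eventually_mono) simp
  have w_null: "(\<lambda>k. \<bar>w k (T f)\<bar>) \<longlonglongrightarrow> 0" for f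
  proof -
    have "(\<lambda>k. e k (T f)) \<longlonglongrightarrow> 0"
    proof (rule Lim_null_comparison)
      show "\<forall>\<^sub>F k in sequentially. norm (e k (T f)) \<le> \<alpha> k * norm (T f)"
        by (intro always_eventually allI order.trans[OF norm_blinfun] mult_right_mono e(3) norm_ge_zero)
      show "(\<lambda>k. \<alpha> k * norm (T f)) \<longlonglongrightarrow> 0"
        by (rule tendsto_mult_left_zero[OF \<alpha>])
    qed
    from tendsto_diff[OF v_null[of f] this] show ?thesis
      by (simp add: w_def blinfun.diff_left tendsto_rabs_zero)
  qed
  have "\<forall>\<^sub>F k in sequentially. \<alpha> k \<le> 1 \<and> (\<forall>g\<in>G. \<bar>w k (T g)\<bar> \<le> \<epsilon> * b) \<and>
      (\<forall>i\<in>I. c * m i \<le> v k (T (g i k)) \<and> \<alpha> k * norm T \<le> c / 4 * m i \<and>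
        3 * norm T * \<beta> i k \<le> c / 4 * m i \<and> \<beta> i k \<le> 1)"
  proof (intro eventually_conj eventually_ball_finite ballI I G)
    show "\<forall>\<^sub>F k in sequentially. \<alpha> k \<le> 1"
      by (rule small[OF \<alpha>]) simp
    show "\<forall>\<^sub>F k in sequentially. \<bar>w k (T g)\<bar> \<le> \<epsilon> * b" for g
      using G(2) b by (intro small w_null) simp
    fix i assume i: "i \<in> I"
    have pos: "c / 4 * m i > 0"
      using \<open>c > 0\<close> m[OF i] by simp
    show "\<forall>\<^sub>F k in sequentially. c * m i \<le> v k (T (g i k))"
      unfolding m_def g_def using C[OF i] by (intro low) auto
    show "\<forall>\<^sub>F k in sequentially. \<alpha> k * norm T \<le> c / 4 * m i"
      using tendsto_mult_left_zero[OF \<alpha>, of "norm T"] by (rule small[OF _ pos])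
    show "\<forall>\<^sub>F k in sequentially. 3 * norm T * \<beta> i k \<le> c / 4 * m i"
      using tendsto_mult_right_zero[OF \<beta>[of i], of "3 * norm T"] by (rule small[OF _ pos])
    show "\<forall>\<^sub>F k in sequentially. \<beta> i k \<le> 1"
      by (rule small[OF \<beta>]) simp
  qed
  then obtain k where k: "\<alpha> k \<le> 1" "\<And>g. g \<in> G \<Longrightarrow> \<bar>w k (T g)\<bar> \<le> \<epsilon> * b"
    "\<And>i. i \<in> I \<Longrightarrow> c * m i \<le> v k (T (g i k))" "\<And>i. i \<in> I \<Longrightarrow> \<alpha> k * norm T \<le> c / 4 * m i"
    "\<And>i. i \<in> I \<Longrightarrow> 3 * norm T * \<beta> i k \<le> c / 4 * m i" "\<And>i. i \<in> I \<Longrightarrow> \<beta> i k \<le> 1"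
    unfolding eventually_sequentially by blast
  have wh: "c / 4 * m i \<le> w k (T (h i k))" if "i \<in> I" for i
    using that k by (intro h_low) auto
  have w_le: "norm (w k) \<le> 3"
    using norm_triangle_ineq4[of "v k" "e k"] v_norm[of k] e(3)[of k] k(1) by (simp add: w_def)
  have w_ge: "b \<le> norm (w k)"
  proof -
    have "w k (T (h i\<^sub>0 k)) \<le> norm (w k) * norm (T (h i\<^sub>0 k))"
      using norm_blinfun[of "w k" "T (h i\<^sub>0 k)"] by simp
    also have "norm (T (h i\<^sub>0 k)) \<le> norm T * 1"
      using norm_simple_on[OF h_simple[OF i0 k(6)[OF i0]]]
      by (intro order.trans[OF norm_blinfun] mult_left_mono) auto
    then have "norm (w k) * norm (T (h i\<^sub>0 k)) \<le> norm (w k) * (norm T + 1)"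
      by (intro mult_left_mono) auto
    finally have "c / 4 * m i\<^sub>0 \<le> norm (w k) * (norm T + 1)"
      using wh[OF i0] by linarith
    then show ?thesis
      using T1 unfolding b_def by (simp only: pos_divide_le_eq)
  qed
  define x where "x = w k /\<^sub>R norm (w k)"
  have w0: "norm (w k) > 0"
    using w_ge b by linarith
  have x_app: "x a = w k a / norm (w k)" for a
    by (simp add: x_def blinfun.scaleR_left divide_inverse_commute)
  have "\<exists>D. D \<in> sets unit_leb \<and> D \<subseteq> C i \<and> measure unit_leb D = measure unit_leb (C i - D) \<and>
      (\<forall>z\<in>Z. z (T (ind D - ind (C i - D))) = 0) \<and>
      x (T (ind D - ind (C i - D))) = c / 12 * measure unit_leb (C i)" if i: "i \<in> I" for i
  proof -
    \<comment> \<open>normalizing costs at most a factor 3, a bound for the norm of \<open>w k\<close>\<close>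
    have "c / 12 * m i = c / 4 * m i / 3"
      by simp
    also have "\<dots> \<le> w k (T (h i k)) / norm (w k)"
      using wh[OF i] w_le w0 \<open>c > 0\<close> m[OF i] by (intro frac_le) (auto intro: order.trans[OF _ wh[OF i]])
    finally have xh: "c / 12 * m i \<le> x (T (h i k))"
      by (simp add: x_app)
    have pos: "0 < c / 12 * m i"
      using \<open>c > 0\<close> m[OF i] by simp
    define s where "s = c / 12 * m i / x (T (h i k))"
    have s: "0 \<le> s" "s \<le> 1" "s * x (T (h i k)) = c / 12 * m i"
      using xh pos by (auto simp: s_def divide_le_eq_1)
    have "simple_on (C i) (s *\<^sub>R h i k) (\<bar>s\<bar> * 1)"
      by (intro simple_on_scale h_simple i k)
    then have sh: "simple_on (C i) (s *\<^sub>R h i k) 1"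
      by (rule simple_on_mono) (use s in simp)
    have "integ (s *\<^sub>R h i k) = 0"
      using h_\<Phi>[OF i, of integ k] by (simp add: \<Phi>_def blinfun.scaleR_right)
    then obtain D where D: "D \<in> sets unit_leb" "D \<subseteq> C i" "measure unit_leb D = measure unit_leb (C i - D)"
      "\<And>\<phi>. \<phi> \<in> insert (x o\<^sub>L T) \<Phi> \<Longrightarrow> \<phi> (ind D - ind (C i - D)) = \<phi> (s *\<^sub>R h i k)"
      using simple_on_to_halves[OF sh _ finite.insertI[OF fin\<Phi>]] C[OF i] by metis
    have "z (T (ind D - ind (C i - D))) = 0" if "z \<in> Z" for z
    proof -
      have "z o\<^sub>L T \<in> \<Phi>"
        using that by (simp add: \<Phi>_def)
      then show ?thesis
        using D(4)[of "z o\<^sub>L T"] h_\<Phi>[OF i, of "z o\<^sub>L T" k] by (simp add: blinfun.scaleR_right)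
    qed
    moreover have "x (T (ind D - ind (C i - D))) = c / 12 * m i"
      using D(4)[of "x o\<^sub>L T"] s(3) by (simp add: blinfun.scaleR_right)
    ultimately show ?thesis
      using D(1-3) unfolding m_def by blast
  qed
  then obtain D where "\<And>i. i \<in> I \<Longrightarrow> D i \<in> sets unit_leb \<and> D i \<subseteq> C i \<and>
      measure unit_leb (D i) = measure unit_leb (C i - D i) \<and>
      (\<forall>z\<in>Z. blinfun_apply z (T (ind (D i) - ind (C i - D i))) = 0) \<and>
      blinfun_apply x (T (ind (D i) - ind (C i - D i))) = c / 12 * measure unit_leb (C i)"
    by metis
  moreover have "x \<in> \<Y>"
    unfolding x_def by (intro subspace_scale \<Y> w_Y)
  moreover have "norm x = 1"
    using w0 by (simp add: x_def)
  moreover have "x (T f) = 0" if "f \<in> F" for f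
    using w_F[OF that] by (simp add: x_app)
  moreover have "\<bar>x (T g)\<bar> \<le> \<epsilon>" if "g \<in> G" for g
  proof -
    have "\<bar>w k (T g)\<bar> \<le> \<epsilon> * norm (w k)"
      using order.trans[OF k(2)[OF that] mult_left_mono[OF w_ge]] G(2) by simp
    then show ?thesis
      using w0 by (simp add: x_app pos_divide_le_eq)
  qed
  ultimately show thesis
    by (intro that[of x D]) simp_all
qed

section \<open>Haar systems and the basis of summable sequences\<close>

lemma dyadic_splittingD:
  assumes "dyadic_splitting A" "k \<in> {1..2 ^ n}"
  shows "A n k \<in> sets unit_leb"
    "A (Suc n) (2 * k - 1) \<union> A (Suc n) (2 * k) = A n k"
    "A (Suc n) (2 * k - 1) \<inter> A (Suc n) (2 * k) = {}"
    "measure unit_leb (A (Suc n) (2 * k - 1)) = measure unit_leb (A (Suc n) (2 * k))"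
    "2 * k - 1 \<in> {1..2 ^ Suc n}" "2 * k \<in> {1..2 ^ Suc n}"
  using assms unfolding dyadic_splitting_def by auto

lemma dyadic_index_cases:
  fixes j :: nat
  assumes "j \<in> {1..2 ^ Suc n}"
  obtains k where "k \<in> {1..2 ^ n}" "j = 2 * k - 1 \<or> j = 2 * k"
proof
  show "(j + 1) div 2 \<in> {1..2 ^ n}"
    using assms by auto
  show "j = 2 * ((j + 1) div 2) - 1 \<or> j = 2 * ((j + 1) div 2)"
    using assms by (cases "even j") (auto elim!: evenE oddE)
qed

lemma measure_dyadic_splitting:
  assumes A: "dyadic_splitting A" and "k \<in> {1..2 ^ n}"
  shows "measure unit_leb (A n k) = measure unit_leb (A 0 1) / 2 ^ n"
  using assms(2)
proof (induction n arbitrary: k)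
  case (Suc n)
  then obtain j where j: "j \<in> {1..2 ^ n}" "k = 2 * j - 1 \<or> k = 2 * j"
    by (elim dyadic_index_cases)
  note J = dyadic_splittingD[OF A j(1)]
  have "measure unit_leb (A n j) =
      measure unit_leb (A (Suc n) (2 * j - 1)) + measure unit_leb (A (Suc n) (2 * j))"
    unfolding J(2)[symmetric]
    using J(3) dyadic_splittingD(1)[OF A J(5)] dyadic_splittingD(1)[OF A J(6)]
    by (intro unit_leb.finite_measure_Union)
  then have "measure unit_leb (A (Suc n) k) = measure unit_leb (A n j) / 2"
    using J(4) j(2) by auto
  then show ?case
    using Suc.IH[OF j(1)] by simp
qed simp

lemma abs_L1_scaled_ind:
  assumes "E \<in> sets unit_leb"
  shows "abs_L1 (\<lambda>t. c * indicator E t) = c *\<^sub>R ind E"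
  unfolding ind_def by (rule abs_L1_scaleR[OF integrable_indicator_unit[OF assms], symmetric])

lemma haar_1:
  assumes "dyadic_splitting A"
  shows "haar A 1 = (1 / measure unit_leb (A 0 1)) *\<^sub>R ind (A 0 1)"
proof -
  have "A 0 1 \<in> sets unit_leb"
    using dyadic_splittingD(1)[OF assms, of 1 0] by simp
  moreover have "haar_fun A 1 = (\<lambda>t. 1 / measure unit_leb (A 0 1) * indicator (A 0 1) t)"
    by (intro ext) (simp only: haar_fun_1 times_divide_eq_left mult_1)
  ultimately show ?thesis
    unfolding haar_def by (simp only: abs_L1_scaled_ind)
qed

lemma haar_dyadic:
  assumes A: "dyadic_splitting A" and k: "k \<in> {1..2 ^ n}"
  shows "haar A (2 ^ n + k) = (2 ^ n / measure unit_leb (A 0 1)) *\<^sub>R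
    (ind (A (Suc n) (2 * k - 1)) - ind (A (Suc n) (2 * k)))"
proof -
  note K = dyadic_splittingD[OF A k]
  note int = integrable_indicator_unit[OF dyadic_splittingD(1)[OF A K(5)]]
    integrable_indicator_unit[OF dyadic_splittingD(1)[OF A K(6)]]
  have "haar_fun A (2 ^ n + k) = (\<lambda>t. 2 ^ n / measure unit_leb (A 0 1) *
      (indicator (A (Suc n) (2 * k - 1)) t - indicator (A (Suc n) (2 * k)) t))"
    using k by (intro ext haar_fun_dyadic) auto
  then have "haar A (2 ^ n + k) = abs_L1 (\<lambda>t. 2 ^ n / measure unit_leb (A 0 1) *
      (indicator (A (Suc n) (2 * k - 1)) t - indicator (A (Suc n) (2 * k)) t))"
    by (simp only: haar_def)
  also have "\<dots> = (2 ^ n / measure unit_leb (A 0 1)) *\<^sub>R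
      abs_L1 (\<lambda>t. indicator (A (Suc n) (2 * k - 1)) t - indicator (A (Suc n) (2 * k)) t)"
    by (rule abs_L1_scaleR[symmetric]) (intro Bochner_Integration.integrable_diff int)
  also have "abs_L1 (\<lambda>t. indicator (A (Suc n) (2 * k - 1)) t - indicator (A (Suc n) (2 * k)) t) =
      ind (A (Suc n) (2 * k - 1)) - ind (A (Suc n) (2 * k))"
    unfolding ind_def by (rule abs_L1_diff[symmetric, OF int])
  finally show ?thesis .
qed

text \<open>A branch of the dyadic tree: \<open>\<sigma> n\<close> decides whether it continues into the first or the second half.\<close>

fun dyadic_path :: "(nat \<Rightarrow> bool) \<Rightarrow> nat \<Rightarrow> nat" where
  "dyadic_path \<sigma> 0 = 1"
| "dyadic_path \<sigma> (Suc n) = (if \<sigma> n then 2 * dyadic_path \<sigma> n - 1 else 2 * dyadic_path \<sigma> n)"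

lemma dyadic_path_range: "dyadic_path \<sigma> n \<in> {1..2 ^ n}"
  by (induction n) auto

lemma path_indicator_step:
  fixes \<sigma> :: "nat \<Rightarrow> bool"
  assumes A: "dyadic_splitting A"
  defines "\<mu> \<equiv> measure unit_leb (A 0 1)"
  shows "(2 ^ Suc n / \<mu>) *\<^sub>R ind (A (Suc n) (dyadic_path \<sigma> (Suc n))) =
    (2 ^ n / \<mu>) *\<^sub>R ind (A n (dyadic_path \<sigma> n)) +
    (if \<sigma> n then 1 else - 1 :: real) *\<^sub>R haar A (2 ^ n + dyadic_path \<sigma> n)"
proof -
  define k where "k = dyadic_path \<sigma> n"
  have k: "k \<in> {1..2 ^ n}"
    unfolding k_def by (rule dyadic_path_range)
  note K = dyadic_splittingD[OF A k]
  have "ind (A n k) = ind (A (Suc n) (2 * k - 1)) + ind (A (Suc n) (2 * k))"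
    unfolding K(2)[symmetric]
    by (rule ind_Un[OF dyadic_splittingD(1)[OF A K(5)] dyadic_splittingD(1)[OF A K(6)] K(3)])
  moreover have "(2 * a) *\<^sub>R x = a *\<^sub>R (x + y) + a *\<^sub>R (x - y)"
    "(2 * a) *\<^sub>R y = a *\<^sub>R (x + y) - a *\<^sub>R (x - y)" for a :: real and x y :: L1
    by (simp_all add: algebra_simps scaleR_2 flip: scaleR_scaleR)
  ultimately show ?thesis
    unfolding dyadic_path.simps k_def[symmetric] haar_dyadic[OF A k] \<mu>_def by simp
qed

text \<open>The normalized indicators of the sets along a branch are elements of norm one, and expand as
\<open>h\<^sub>1\<close> plus a signed sum of one Haar function from each block. Choosing the branch chooses the
signs, so that a linear combination of the functionals takes the value \<open>\<delta> * (\<Sum>n. \<bar>a n\<bar>)\<close>, up to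
sign, on such an element.\<close>

lemma l1_basis_of_haar_biorthogonal:
  fixes \<phi> :: "nat \<Rightarrow> L1 dual"
  assumes A: "dyadic_splitting A" and C: "\<And>n. norm (\<phi> n) \<le> C" and "\<delta> > 0"
    and dual: "\<And>n m h. h \<in> haar_block A m \<Longrightarrow> \<phi> n h = \<delta> * (if n = m then 1 else 0)"
  shows "equivalent_l1_basis \<phi>"
proof -
  define \<mu> where "\<mu> = measure unit_leb (A 0 1)"
  have \<mu>: "\<mu> > 0"
    using A by (simp add: \<mu>_def dyadic_splitting_def)
  define R where "R \<sigma> n = (2 ^ n / \<mu>) *\<^sub>R ind (A n (dyadic_path \<sigma> n))" for \<sigma> n
  have norm_R: "norm (R \<sigma> n) = 1" for \<sigma> n
    using \<mu> dyadic_splittingD(1)[OF A dyadic_path_range[of \<sigma> n]]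
      measure_dyadic_splitting[OF A dyadic_path_range[of \<sigma> n]]
    by (simp add: R_def norm_ind \<mu>_def)
  have \<phi>_R: "\<phi> m (R \<sigma> n) = (if m = 0 then \<delta> else if m \<le> n then (if \<sigma> (m - 1) then \<delta> else - \<delta>) else 0)" for m \<sigma> n
  proof (induction n)
    case 0
    have "R \<sigma> 0 = haar A 1"
      using haar_1[OF A] by (simp add: R_def \<mu>_def)
    then show ?case
      using dual[of "haar A 1" 0 m] by (simp add: haar_block_0)
  next
    case (Suc n)
    have "haar A (2 ^ n + dyadic_path \<sigma> n) \<in> haar_block A (Suc n)"
      using dyadic_path_range[of \<sigma> n] by (auto simp: haar_block_Suc)
    from dual[OF this, of m] show ?case
      using Suc unfolding R_def \<mu>_def path_indicator_step[OF A]
      by (auto simp: blinfun.add_right blinfun.scaleR_right le_Suc_eq)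
  qed
  have lower: "\<delta> * (\<Sum>n | a n \<noteq> 0. \<bar>a n\<bar>) \<le> norm (\<Sum>n | a n \<noteq> 0. a n *\<^sub>R \<phi> n)"
    if fin: "finite {n. a n \<noteq> 0}" for a :: "nat \<Rightarrow> real"
  proof -
    obtain N where N: "{n. a n \<noteq> 0} \<subseteq> {..N}"
      using fin finite_nat_iff_bounded_le by blast
    \<comment> \<open>the sign of the first term cannot be chosen; the others are adapted to it\<close>
    define s :: real where "s = (if a 0 \<ge> 0 then 1 else - 1)"
    define \<sigma> where "\<sigma> n \<longleftrightarrow> s * a (Suc n) \<ge> 0" for n
    have term_eq: "a n * \<phi> n (R \<sigma> N) = s * (\<delta> * \<bar>a n\<bar>)" if "a n \<noteq> 0" for n
    proof -
      have "n \<le> N"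
        using N that by auto
      then show ?thesis
        by (cases n) (auto simp: \<phi>_R s_def \<sigma>_def)
    qed
    have "(\<Sum>n | a n \<noteq> 0. a n *\<^sub>R \<phi> n) (R \<sigma> N) = (\<Sum>n | a n \<noteq> 0. a n * \<phi> n (R \<sigma> N))"
      by (simp add: blinfun.sum_left blinfun.scaleR_left)
    also have "\<dots> = (\<Sum>n | a n \<noteq> 0. s * (\<delta> * \<bar>a n\<bar>))"
      using term_eq by (intro sum.cong) auto
    also have "\<dots> = s * (\<delta> * (\<Sum>n | a n \<noteq> 0. \<bar>a n\<bar>))"
      by (simp add: sum_distrib_left)
    finally have "\<bar>(\<Sum>n | a n \<noteq> 0. a n *\<^sub>R \<phi> n) (R \<sigma> N)\<bar> = \<delta> * (\<Sum>n | a n \<noteq> 0. \<bar>a n\<bar>)"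
      using \<open>\<delta> > 0\<close> by (simp add: s_def abs_mult sum_nonneg)
    then show ?thesis
      using norm_blinfun[of "\<Sum>n | a n \<noteq> 0. a n *\<^sub>R \<phi> n" "R \<sigma> N"] by (simp add: norm_R)
  qed
  have upper: "norm (\<Sum>n | a n \<noteq> 0. a n *\<^sub>R \<phi> n) \<le> (\<bar>C\<bar> + 1) * (\<Sum>n | a n \<noteq> 0. \<bar>a n\<bar>)"
    for a :: "nat \<Rightarrow> real"
  proof -
    have "norm (a n *\<^sub>R \<phi> n) \<le> (\<bar>C\<bar> + 1) * \<bar>a n\<bar>" for n
      using C[of n] mult_left_mono[of "norm (\<phi> n)" "\<bar>C\<bar> + 1" "\<bar>a n\<bar>"] by (simp add: mult.commute)
    then show ?thesis
      by (simp only: sum_distrib_left) (intro order.trans[OF norm_sum] sum_mono)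
  qed
  show ?thesis
    unfolding equivalent_l1_basis_def using lower upper \<open>\<delta> > 0\<close>
    by (intro exI[of _ \<delta>] exI[of _ "\<bar>C\<bar> + 1"]) auto
qed

lemma equivalent_l1_basis_of_adjoint:
  fixes T :: "'a::real_normed_vector \<Rightarrow>\<^sub>L 'b::real_normed_vector"
  assumes x: "\<And>n. norm (x n) = 1" and adj: "equivalent_l1_basis (\<lambda>n. adjoint_op T (x n))"
  shows "equivalent_l1_basis x"
proof -
  obtain c where c: "c > 0" and low: "\<And>a :: nat \<Rightarrow> real. finite {n. a n \<noteq> 0} \<Longrightarrow>
      c * (\<Sum>n | a n \<noteq> 0. \<bar>a n\<bar>) \<le> norm (\<Sum>n | a n \<noteq> 0. a n *\<^sub>R adjoint_op T (x n))"
    using adj unfolding equivalent_l1_basis_def by blast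
  have T1: "norm T + 1 > 0"
    using norm_ge_zero[of T] by linarith
  have lower: "c / (norm T + 1) * (\<Sum>n | a n \<noteq> 0. \<bar>a n\<bar>) \<le> norm (\<Sum>n | a n \<noteq> 0. a n *\<^sub>R x n)"
    if fin: "finite {n. a n \<noteq> 0}" for a :: "nat \<Rightarrow> real"
  proof -
    have "(\<Sum>n | a n \<noteq> 0. a n *\<^sub>R adjoint_op T (x n)) = (\<Sum>n | a n \<noteq> 0. a n *\<^sub>R x n) o\<^sub>L T"
      by (intro blinfun_eqI) (simp add: adjoint_op_def blinfun.sum_left blinfun.scaleR_left)
    then have "c * (\<Sum>n | a n \<noteq> 0. \<bar>a n\<bar>) \<le> norm (\<Sum>n | a n \<noteq> 0. a n *\<^sub>R x n) * norm T"
      using low[OF fin] norm_blinfun_compose[of "\<Sum>n | a n \<noteq> 0. a n *\<^sub>R x n" T] by simp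
    also have "\<dots> \<le> norm (\<Sum>n | a n \<noteq> 0. a n *\<^sub>R x n) * (norm T + 1)"
      by (intro mult_left_mono) auto
    finally show ?thesis
      using T1 by (simp add: pos_divide_le_eq)
  qed
  have upper: "norm (\<Sum>n | a n \<noteq> 0. a n *\<^sub>R x n) \<le> 1 * (\<Sum>n | a n \<noteq> 0. \<bar>a n\<bar>)" for a :: "nat \<Rightarrow> real"
    using norm_sum[of "\<lambda>n. a n *\<^sub>R x n" "{n. a n \<noteq> 0}"] x by simp
  show ?thesis
    unfolding equivalent_l1_basis_def using lower upper c T1
    by (intro exI[of _ "c / (norm T + 1)"] exI[of _ 1]) auto
qed

text \<open>The points of convergence form a closed subspace, and the limit is a functional that vanishes on \<open>D\<close>.\<close>

lemma weak_star_null_L1: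
  fixes \<phi> :: "nat \<Rightarrow> L1 dual" and D :: "nat \<Rightarrow> L1"
  assumes K: "\<And>n. norm (\<phi> n) \<le> K"
    and D: "\<And>V. closed V \<Longrightarrow> subspace V \<Longrightarrow> range D \<subseteq> V \<Longrightarrow> V = UNIV"
    and null: "\<And>j. (\<lambda>n. \<phi> n (D j)) \<longlonglongrightarrow> 0"
  shows "weak_star_null \<phi>"
proof -
  have "{u. convergent (\<lambda>n. \<phi> n u)} = UNIV"
  proof (rule D[OF closed_pointwise_limit_set[OF K] subspace_pointwise_convergent])
    show "range D \<subseteq> {u. convergent (\<lambda>n. \<phi> n u)}"
      using null by (auto simp: convergent_def)
  qed
  then have "convergent (\<lambda>n. \<phi> n u)" for u
    by blast
  then obtain l :: "L1 dual" where l: "\<And>u. (\<lambda>n. \<phi> n u) \<longlonglongrightarrow> l u"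
    using pointwise_limit_functional[of \<phi> K, OF K] by blast
  have "{u. l u = 0} = UNIV"
  proof (rule D)
    show "closed {u. l u = 0}"
      by (intro closed_Collect_eq continuous_intros)
    show "subspace {u. l u = 0}"
      by (auto simp: subspace_def blinfun.bilinear_simps)
    show "range D \<subseteq> {u. l u = 0}"
      using LIMSEQ_unique[OF l null] by auto
  qed
  then have "l u = 0" for u
    by blast
  then show ?thesis
    using l by (simp add: weak_star_null_def)
qed

section \<open>The construction\<close>

text \<open>A stage of the construction consists of the sets of one level of the splitting, the functional of that
level, its norming set, all functionals that later Haar functions have to be annihilated by, and all
Haar functions up to that level.\<close>

type_synonym 'x stage = "(nat \<Rightarrow> real set) \<times> 'x dual \<times> 'x dual set \<times> 'x dual set \<times> L1 set"

definition admissible_stage ::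
  "(L1 \<Rightarrow>\<^sub>L 'x::real_normed_vector) \<Rightarrow> 'x dual set \<Rightarrow> (nat \<Rightarrow> real) \<Rightarrow> real set \<Rightarrow> real \<Rightarrow> nat \<Rightarrow> 'x stage \<Rightarrow> bool"
  where "admissible_stage T \<Y> \<tau> B \<mu> n = (\<lambda>(A, x, N, Z, F).
    (\<forall>k\<in>{1..2 ^ n}. A k \<in> sets unit_leb \<and> A k \<subseteq> B \<and> measure unit_leb (A k) = \<mu> / 2 ^ n) \<and>
    x \<in> \<Y> \<and> norm x = 1 \<and> finite F \<and> finite Z \<and> insert x N \<subseteq> Z \<and>
    norms_within N (span (T ` F)) (\<tau> n))"

text \<open>For the sets of level \<open>n + 1\<close>, with \<open>\<mu>\<close> the measure of the whole, this is the Haar function with index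
\<open>2 ^ n + k\<close>.\<close>

definition haar_element :: "real \<Rightarrow> nat \<Rightarrow> (nat \<Rightarrow> real set) \<Rightarrow> nat \<Rightarrow> L1" where
  "haar_element \<mu> n A k = (2 ^ n / \<mu>) *\<^sub>R (ind (A (2 * k - 1)) - ind (A (2 * k)))"

text \<open>Orthogonality is built in from two sides: new functionals vanish on the images of old Haar functions,
and old functionals vanish on the images of new ones. The sequence \<open>D\<close> serves weak* convergence to zero.\<close>

definition refines_stage ::
  "(L1 \<Rightarrow>\<^sub>L 'x::real_normed_vector) \<Rightarrow> (nat \<Rightarrow> L1) \<Rightarrow> real \<Rightarrow> real \<Rightarrow> nat \<Rightarrow> 'x stage \<Rightarrow> 'x stage \<Rightarrow> bool"
  where "refines_stage T D \<delta> \<mu> n = (\<lambda>(A, x, N, Z, F) (A', x', N', Z', F').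
    (\<forall>k\<in>{1..2 ^ n}. A' (2 * k - 1) \<union> A' (2 * k) = A k \<and> A' (2 * k - 1) \<inter> A' (2 * k) = {} \<and>
      measure unit_leb (A' (2 * k - 1)) = measure unit_leb (A' (2 * k))) \<and>
    F' = F \<union> haar_element \<mu> n A' ` {1..2 ^ n} \<and> Z \<subseteq> Z' \<and>
    (\<forall>f\<in>F. blinfun_apply x' (T f) = 0) \<and> (\<forall>j\<le>n. \<bar>blinfun_apply x' (T (D j))\<bar> \<le> 1 / real (Suc n)) \<and>
    (\<forall>k\<in>{1..2 ^ n}. blinfun_apply x' (T (haar_element \<mu> n A' k)) = \<delta> \<and>
      (\<forall>z\<in>Z. blinfun_apply z (T (haar_element \<mu> n A' k)) = 0)))"

lemma exists_refinement:
  fixes T :: "L1 \<Rightarrow>\<^sub>L 'x::real_normed_vector"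
  assumes osc: "oscillating_on T B c v u" and "c > 0" and v: "\<And>k. v k \<in> \<Y>" and \<Y>: "subspace \<Y>"
    and "\<mu> > 0" and \<tau>: "\<And>n. \<tau> n > 1" and st: "admissible_stage T \<Y> \<tau> B \<mu> n s"
  shows "\<exists>s'. admissible_stage T \<Y> \<tau> B \<mu> (Suc n) s' \<and> refines_stage T D (c / 12) \<mu> n s s'"
proof -
  obtain A x N Z F where s: "s = (A, x, N, Z, F)"
    by (cases s) auto
  have A: "\<And>k. k \<in> {1..2 ^ n} \<Longrightarrow> A k \<in> sets unit_leb \<and> A k \<subseteq> B \<and> measure unit_leb (A k) = \<mu> / 2 ^ n"
    and F: "finite F" and Z: "finite Z"
    using st by (auto simp: admissible_stage_def s)
  have A_pos: "A k \<in> sets unit_leb \<and> A k \<subseteq> B \<and> measure unit_leb (A k) > 0" if "k \<in> {1..2 ^ n}" for k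
    using A[OF that] \<open>\<mu> > 0\<close> by simp
  have fin: "finite {1..2 ^ n :: nat}" "{1..2 ^ n :: nat} \<noteq> {}" "finite (D ` {..n})" "1 / real (Suc n) > 0"
    by simp_all
  show ?thesis
  proof (rule splitting_step[where C = A, OF osc \<open>c > 0\<close> v \<Y> fin(1,2) A_pos F Z fin(3,4)])
    fix x' and E :: "nat \<Rightarrow> real set"
    assume x': "x' \<in> \<Y>" "norm x' = 1" "\<And>f. f \<in> F \<Longrightarrow> blinfun_apply x' (T f) = 0"
      "\<And>g. g \<in> D ` {..n} \<Longrightarrow> \<bar>blinfun_apply x' (T g)\<bar> \<le> 1 / real (Suc n)"
      and E: "\<And>k. k \<in> {1..2 ^ n} \<Longrightarrow> E k \<in> sets unit_leb" "\<And>k. k \<in> {1..2 ^ n} \<Longrightarrow> E k \<subseteq> A k"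
        "\<And>k. k \<in> {1..2 ^ n} \<Longrightarrow> measure unit_leb (E k) = measure unit_leb (A k - E k)"
      and ZE: "\<And>k z. k \<in> {1..2 ^ n} \<Longrightarrow> z \<in> Z \<Longrightarrow> blinfun_apply z (T (ind (E k) - ind (A k - E k))) = 0"
      and xE: "\<And>k. k \<in> {1..2 ^ n} \<Longrightarrow>
        blinfun_apply x' (T (ind (E k) - ind (A k - E k))) = c / 12 * measure unit_leb (A k)"
    define A' where "A' j = (if odd j then E ((j + 1) div 2) else A (j div 2) - E (j div 2))" for j
    have A'_odd: "A' (2 * k - 1) = E k" and A'_even: "A' (2 * k) = A k - E k" if "k \<in> {1..2 ^ n}" for k
      using that by (auto simp: A'_def)
    define F' where "F' = F \<union> haar_element \<mu> n A' ` {1..2 ^ n}"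
    have fin_F': "finite F'"
      using F by (simp add: F'_def)
    obtain N' where N': "finite N'" "norms_within N' (span (T ` F')) (\<tau> (Suc n))"
      using finite_norming_set[OF finite_imageI[OF fin_F'] \<tau> x'(2)] by blast
    define s' where "s' = (A', x', N', insert x' (Z \<union> N'), F')"
    have scaled: "blinfun_apply z (T (haar_element \<mu> n A' k)) =
        2 ^ n / \<mu> * blinfun_apply z (T (ind (E k) - ind (A k - E k)))" if "k \<in> {1..2 ^ n}" for z k
      unfolding haar_element_def A'_odd[OF that] A'_even[OF that] by (simp add: blinfun.scaleR_right)
    have meas_E: "measure unit_leb (E k) = \<mu> / 2 ^ Suc n" "measure unit_leb (A k - E k) = \<mu> / 2 ^ Suc n"
      if "k \<in> {1..2 ^ n}" for k
    proof -
      have "measure unit_leb (A k - E k) = measure unit_leb (A k) - measure unit_leb (E k)"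
        using A[OF that] E[OF that] by (intro unit_leb.finite_measure_Diff) auto
      then show "measure unit_leb (E k) = \<mu> / 2 ^ Suc n" "measure unit_leb (A k - E k) = \<mu> / 2 ^ Suc n"
        using A[OF that] E[OF that] by (auto simp: field_simps)
    qed
    have "admissible_stage T \<Y> \<tau> B \<mu> (Suc n) s'"
    proof -
      have "A' j \<in> sets unit_leb \<and> A' j \<subseteq> B \<and> measure unit_leb (A' j) = \<mu> / 2 ^ Suc n"
        if "j \<in> {1..2 ^ Suc n}" for j
      proof -
        obtain k where k: "k \<in> {1..2 ^ n}" "j = 2 * k - 1 \<or> j = 2 * k"
          using \<open>j \<in> _\<close> by (rule dyadic_index_cases)
        then have "A' j = E k \<or> A' j = A k - E k"
          using A'_odd A'_even by auto
        then show ?thesis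
          using A[OF k(1)] E[OF k(1)] meas_E[OF k(1)] by auto
      qed
      then show ?thesis
        using x'(1,2) fin_F' Z N' by (auto simp: admissible_stage_def s'_def)
    qed
    moreover have "refines_stage T D (c / 12) \<mu> n s s'"
    proof -
      have "A' (2 * k - 1) \<union> A' (2 * k) = A k \<and> A' (2 * k - 1) \<inter> A' (2 * k) = {} \<and>
        measure unit_leb (A' (2 * k - 1)) = measure unit_leb (A' (2 * k))" if "k \<in> {1..2 ^ n}" for k
        unfolding A'_odd[OF that] A'_even[OF that] using E(2,3)[OF that] by auto
      moreover have "blinfun_apply x' (T (haar_element \<mu> n A' k)) = c / 12" if "k \<in> {1..2 ^ n}" for k
        unfolding scaled[OF that] xE[OF that] using A[OF that] \<open>\<mu> > 0\<close> by simp
      moreover have "blinfun_apply z (T (haar_element \<mu> n A' k)) = 0" if "k \<in> {1..2 ^ n}" "z \<in> Z" for k z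
        unfolding scaled[OF that(1)] ZE[OF that] by simp
      ultimately show ?thesis
        using x'(3,4) by (simp add: refines_stage_def s s'_def F'_def subset_insertI2)
    qed
    ultimately show ?thesis by blast
  qed
qed

text \<open>The first functional has to take the value \<open>c / 12\<close> on \<open>T h\<^sub>1\<close> too. Split \<open>B\<close> once, with a functional
that vanishes on \<open>T (ind B)\<close>: then its value on the difference of the two halves is twice its value on
one of them, and that half is the root of the splitting.\<close>

lemma exists_initial_stage:
  fixes T :: "L1 \<Rightarrow>\<^sub>L 'x::real_normed_vector"
  assumes osc: "oscillating_on T B c v u" and "c > 0" and v: "\<And>k. v k \<in> \<Y>" and \<Y>: "subspace \<Y>"
    and B: "B \<in> sets unit_leb" "measure unit_leb B > 0" and "\<tau> 0 > 1"
  shows "\<exists>A\<^sub>0 x N Z. measure unit_leb A\<^sub>0 > 0 \<and>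
    blinfun_apply x (T ((1 / measure unit_leb A\<^sub>0) *\<^sub>R ind A\<^sub>0)) = c / 12 \<and>
    admissible_stage T \<Y> \<tau> B (measure unit_leb A\<^sub>0) 0
      (\<lambda>_. A\<^sub>0, x, N, Z, {(1 / measure unit_leb A\<^sub>0) *\<^sub>R ind A\<^sub>0})"
proof -
  obtain x A\<^sub>0 where x: "x \<in> \<Y>" "norm x = 1" "blinfun_apply x (T (ind B)) = 0"
    and A0: "A\<^sub>0 \<in> sets unit_leb" "A\<^sub>0 \<subseteq> B" "measure unit_leb A\<^sub>0 = measure unit_leb (B - A\<^sub>0)"
    and xA: "blinfun_apply x (T (ind A\<^sub>0 - ind (B - A\<^sub>0))) = c / 12 * measure unit_leb B"
  proof (rule splitting_step[OF osc \<open>c > 0\<close> v \<Y>, where I = "{()}" and C = "\<lambda>_. B" and F = "{ind B}"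
        and Z = "{}" and G = "{}" and \<epsilon> = 1])
    fix x and E :: "unit \<Rightarrow> real set"
    assume "x \<in> \<Y>" "norm x = 1" "\<And>f. f \<in> {ind B} \<Longrightarrow> blinfun_apply x (T f) = 0"
      "\<And>i. i \<in> {()} \<Longrightarrow> E i \<in> sets unit_leb" "\<And>i. i \<in> {()} \<Longrightarrow> E i \<subseteq> B"
      "\<And>i. i \<in> {()} \<Longrightarrow> measure unit_leb (E i) = measure unit_leb (B - E i)"
      "\<And>i. i \<in> {()} \<Longrightarrow> blinfun_apply x (T (ind (E i) - ind (B - E i))) = c / 12 * measure unit_leb B"
    then show thesis
      by (intro that[of x "E ()"]) simp_all
  qed (use B in simp_all)
  define \<mu> where "\<mu> = measure unit_leb A\<^sub>0"
  have \<mu>: "measure unit_leb B = 2 * \<mu>"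
    using unit_leb.finite_measure_Diff[OF B(1) A0(1,2)] A0(3) by (simp add: \<mu>_def)
  then have "\<mu> > 0"
    using B(2) by simp
  have "ind A\<^sub>0 - ind (B - A\<^sub>0) = 2 *\<^sub>R ind A\<^sub>0 - ind B"
    using ind_Diff[OF B(1) A0(1,2)] by (simp add: scaleR_2)
  then have "2 * blinfun_apply x (T (ind A\<^sub>0)) = c / 12 * (2 * \<mu>)"
    using xA x(3) \<mu> by (simp add: blinfun.diff_right blinfun.scaleR_right)
  then have x_val: "blinfun_apply x (T ((1 / \<mu>) *\<^sub>R ind A\<^sub>0)) = c / 12"
    using \<open>\<mu> > 0\<close> by (simp add: blinfun.scaleR_right field_simps)
  obtain N where N: "finite N" "norms_within N (span (T ` {(1 / \<mu>) *\<^sub>R ind A\<^sub>0})) (\<tau> 0)"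
    using finite_norming_set[of "T ` {(1 / \<mu>) *\<^sub>R ind A\<^sub>0}", OF _ \<open>\<tau> 0 > 1\<close> x(2)] by auto
  have "admissible_stage T \<Y> \<tau> B \<mu> 0 (\<lambda>_. A\<^sub>0, x, N, insert x N, {(1 / \<mu>) *\<^sub>R ind A\<^sub>0})"
    using A0(1,2) x(1,2) N by (simp add: admissible_stage_def \<mu>_def subset_insertI)
  then show ?thesis
    using x_val \<open>\<mu> > 0\<close> unfolding \<mu>_def by blast
qed

text \<open>The stages are chosen one after another. In a stage of index \<open>n\<close> the accumulated Haar functions are exactly
those of the first \<open>n + 1\<close> blocks, and the accumulated functionals contain all \<open>x m\<close> with \<open>m \<le> n\<close>; so
\<open>x n\<close> vanishes on the images of the earlier blocks by its own choice, and on those of the later ones by theirs.\<close>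

lemma exists_haar_biorthogonal_system:
  fixes T :: "L1 \<Rightarrow>\<^sub>L 'x::real_normed_vector"
  assumes osc: "oscillating_on T B c v u" and "c > 0" and v: "\<And>k. v k \<in> \<Y>" and \<Y>: "subspace \<Y>"
    and B: "B \<in> sets unit_leb" "measure unit_leb B > 0" and \<tau>: "\<And>n. \<tau> n > 1"
  obtains A :: "nat \<Rightarrow> nat \<Rightarrow> real set" and x :: "nat \<Rightarrow> 'x dual" and N :: "nat \<Rightarrow> 'x dual set"
  where "dyadic_splitting A" "\<And>n. x n \<in> \<Y>" "\<And>n. norm (x n) = 1"
    "\<And>n m h. h \<in> haar_block A m \<Longrightarrow> blinfun_apply (x n) (T h) = c / 12 * (if n = m then 1 else 0)"
    "\<And>n j. j \<le> n \<Longrightarrow> \<bar>blinfun_apply (x (Suc n)) (T (D j))\<bar> \<le> 1 / real (Suc n)"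
    "\<And>n. finite (N n)" "\<And>n. norms_within (N n) (span (\<Union>j\<le>n. T ` haar_block A j)) (\<tau> n)"
    "\<And>n. T ` haar_block A (Suc n) \<subseteq> preannihilator (N n)"
proof -
  define \<delta> where "\<delta> = c / 12"
  obtain A\<^sub>0 x\<^sub>0 N\<^sub>0 Z\<^sub>0 where A0: "measure unit_leb A\<^sub>0 > 0"
    and x0: "blinfun_apply x\<^sub>0 (T ((1 / measure unit_leb A\<^sub>0) *\<^sub>R ind A\<^sub>0)) = \<delta>"
    and st0: "admissible_stage T \<Y> \<tau> B (measure unit_leb A\<^sub>0) 0
      (\<lambda>_. A\<^sub>0, x\<^sub>0, N\<^sub>0, Z\<^sub>0, {(1 / measure unit_leb A\<^sub>0) *\<^sub>R ind A\<^sub>0})"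
    using exists_initial_stage[where \<tau> = \<tau>, OF osc \<open>c > 0\<close> v \<Y> B \<tau>] unfolding \<delta>_def by blast
  define \<mu> where "\<mu> = measure unit_leb A\<^sub>0"
  define s\<^sub>0 where "s\<^sub>0 = (\<lambda>_ :: nat. A\<^sub>0, x\<^sub>0, N\<^sub>0, Z\<^sub>0, {(1 / \<mu>) *\<^sub>R ind A\<^sub>0})"
  have \<mu>: "\<mu> > 0"
    using A0 by (simp add: \<mu>_def)
  have "\<exists>S. \<forall>n. (admissible_stage T \<Y> \<tau> B \<mu> n (S n) \<and> (n = 0 \<longrightarrow> S n = s\<^sub>0)) \<and>
      refines_stage T D \<delta> \<mu> n (S n) (S (Suc n))"
  proof (rule dependent_nat_choice)
    show "\<exists>s. admissible_stage T \<Y> \<tau> B \<mu> 0 s \<and> (0 = (0::nat) \<longrightarrow> s = s\<^sub>0)"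
      using st0 by (simp add: s\<^sub>0_def \<mu>_def)
    show "\<exists>s'. (admissible_stage T \<Y> \<tau> B \<mu> (Suc n) s' \<and> (Suc n = 0 \<longrightarrow> s' = s\<^sub>0)) \<and>
        refines_stage T D \<delta> \<mu> n s s'"
      if "admissible_stage T \<Y> \<tau> B \<mu> n s \<and> (n = 0 \<longrightarrow> s = s\<^sub>0)" for s n
      using exists_refinement[where \<tau> = \<tau> and n = n and s = s and D = D, OF osc \<open>c > 0\<close> v \<Y> \<mu> \<tau>] that by (simp add: \<delta>_def)
  qed
  then obtain S where S: "\<And>n. admissible_stage T \<Y> \<tau> B \<mu> n (S n)" "S 0 = s\<^sub>0"
    "\<And>n. refines_stage T D \<delta> \<mu> n (S n) (S (Suc n))"
    by blast
  define A where "A n = fst (S n)" for n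
  define x where "x n = fst (snd (S n))" for n
  define N where "N n = fst (snd (snd (S n)))" for n
  define Z where "Z n = fst (snd (snd (snd (S n))))" for n
  define F where "F n = snd (snd (snd (snd (S n))))" for n
  have S_eq: "S n = (A n, x n, N n, Z n, F n)" for n
    by (simp add: A_def x_def N_def Z_def F_def)
  note adm = S(1)[unfolded admissible_stage_def S_eq case_prod_conv]
    and ref = S(3)[unfolded refines_stage_def S_eq case_prod_conv]
  have adm_x: "x n \<in> \<Y>" "norm (x n) = 1" and adm_Z: "finite (Z n)" "insert (x n) (N n) \<subseteq> Z n"
    and adm_N: "norms_within (N n) (span (T ` F n)) (\<tau> n)" for n
    using adm[of n] by - ((elim conjE, assumption)+)
  have ref_F: "F (Suc n) = F n \<union> haar_element \<mu> n (A (Suc n)) ` {1..2 ^ n}"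
    and ref_Z: "Z n \<subseteq> Z (Suc n)"
    and ref_x: "\<forall>f\<in>F n. blinfun_apply (x (Suc n)) (T f) = 0"
    and ref_D: "\<forall>j\<le>n. \<bar>blinfun_apply (x (Suc n)) (T (D j))\<bar> \<le> 1 / real (Suc n)"
    and ref_haar: "\<forall>k\<in>{1..2 ^ n}. blinfun_apply (x (Suc n)) (T (haar_element \<mu> n (A (Suc n)) k)) = \<delta> \<and>
      (\<forall>z\<in>Z n. blinfun_apply z (T (haar_element \<mu> n (A (Suc n)) k)) = 0)" for n
    using ref[of n] by - ((elim conjE, assumption)+)
  have A_0: "A 0 k = A\<^sub>0" "x 0 = x\<^sub>0" "F 0 = {(1 / \<mu>) *\<^sub>R ind A\<^sub>0}" for k
    using S(2) by (simp_all add: A_def x_def F_def s\<^sub>0_def)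
  have split: "dyadic_splitting A"
    unfolding dyadic_splitting_def using adm ref A0 A_0(1) by simp
  have block_0: "haar_block A 0 = {(1 / \<mu>) *\<^sub>R ind A\<^sub>0}"
    using haar_1[OF split] by (simp add: haar_block_0 A_0(1) \<mu>_def)
  have block_Suc: "haar_block A (Suc n) = haar_element \<mu> n (A (Suc n)) ` {1..2 ^ n}" for n
    unfolding haar_block_Suc haar_element_def
    using haar_dyadic[OF split] by (intro image_cong) (simp_all add: A_0(1) \<mu>_def)
  have F_eq: "F n = (\<Union>j\<le>n. haar_block A j)" for n
  proof (induction n)
    case 0
    then show ?case by (simp add: A_0(3) block_0)
  next
    case (Suc n)
    have "F (Suc n) = F n \<union> haar_block A (Suc n)"
      unfolding block_Suc by (rule ref_F)
    then show ?case
      using Suc by (simp add: atMost_Suc Un_commute)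
  qed
  have Z_mono: "Z m \<subseteq> Z n" if "m \<le> n" for m n
    using ref_Z that by (rule lift_Suc_mono_le)
  have ann: "blinfun_apply z (T h) = 0" if "z \<in> Z n" "h \<in> haar_block A (Suc n)" for z h n
    using ref_haar[of n] that unfolding block_Suc by auto
  have dual: "blinfun_apply (x n) (T h) = \<delta> * (if n = m then 1 else 0)" if h: "h \<in> haar_block A m" for n m h
  proof (cases n m rule: linorder_cases)
    case equal
    show ?thesis
    proof (cases m)
      case 0
      then show ?thesis
        using h x0 equal by (simp add: block_0 A_0(2) \<mu>_def)
    next
      case (Suc k)
      then show ?thesis
        using h ref_haar[of k] equal by (auto simp: block_Suc)
    qed
  next
    case less
    then obtain k where k: "m = Suc k" "n \<le> k"
      by (cases m) auto
    have "x n \<in> Z k"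
      using adm_Z(2)[of n] Z_mono[OF k(2)] by auto
    then show ?thesis
      using ann[of "x n" k h] h less by (simp add: k(1))
  next
    case greater
    then obtain k where k: "n = Suc k" "m \<le> k"
      by (cases n) auto
    have "h \<in> F k"
      using h k(2) by (auto simp: F_eq)
    then show ?thesis
      using ref_x[of k] greater by (simp add: k(1))
  qed
  show thesis
  proof (rule that[OF split])
    show "norms_within (N n) (span (\<Union>j\<le>n. T ` haar_block A j)) (\<tau> n)" for n
      using adm_N[of n] by (simp add: F_eq image_UN)
    show "T ` haar_block A (Suc n) \<subseteq> preannihilator (N n)" for n
      using ann[of _ n] adm_Z(2)[of n] by (auto simp: preannihilator_def)
    show "finite (N n)" for n
      using adm_Z[of n] by (auto intro: finite_subset)
    show "\<bar>blinfun_apply (x (Suc n)) (T (D j))\<bar> \<le> 1 / real (Suc n)" if "j \<le> n" for n j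
      using ref_D[of n] that by simp
    show "blinfun_apply (x n) (T h) = c / 12 * (if n = m then 1 else 0)" if "h \<in> haar_block A m" for n m h
      using dual[OF that] by (simp add: \<delta>_def)
    show "x n \<in> \<Y>" "norm (x n) = 1" for n
      by (rule adm_x)+
  qed
qed

text \<open>If \<open>z\<close> norms \<open>u\<close> up to \<open>\<tau> n\<close> and vanishes on \<open>w\<close>, then \<open>z u = z (u + w) \<le> norm (u + w)\<close>.\<close>

lemma haar_image_fdd:
  fixes T :: "L1 \<Rightarrow>\<^sub>L 'x::banach"
  assumes \<tau>: "convergent_prod \<tau>" "\<And>n. \<tau> n > 1"
    and norming: "\<And>n. norms_within (N n) (span (\<Union>j\<le>n. T ` haar_block A j)) (\<tau> n)"
    and ann: "\<And>n. T ` haar_block A (Suc n) \<subseteq> preannihilator (N n)"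
  shows "fdd_of_closed_span (\<lambda>n. span (T ` haar_block A n)) (prodinf \<tau>)"
proof (rule fdd_from_one_step_estimates[OF _ _ \<tau>])
  fix n
  have "finite (haar_block A n)"
    unfolding haar_block_def by (intro finite_imageI) simp
  then show "\<exists>B. finite B \<and> span (T ` haar_block A n) = span B"
    by (intro exI[of _ "T ` haar_block A n"]) simp
next
  fix n u w
  assume u: "u \<in> span (\<Union>j\<le>n. span (T ` haar_block A j))" and w: "w \<in> span (T ` haar_block A (Suc n))"
  have "span (\<Union>j\<le>n. span (T ` haar_block A j)) \<subseteq> span (\<Union>j\<le>n. T ` haar_block A j)"
    by (intro span_minimal UN_least span_mono) auto
  then obtain z where z: "z \<in> N n" "norm u \<le> \<tau> n * z u"
    using u norming[of n] unfolding norms_within_def by blast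
  have "z w = 0"
  proof -
    have "span (T ` haar_block A (Suc n)) \<subseteq> {v. z v = 0}"
      using ann[of n] z(1)
      by (intro span_minimal) (auto simp: preannihilator_def subspace_def blinfun.bilinear_simps)
    then show ?thesis using w by blast
  qed
  then have "z u = z (u + w)"
    by (simp add: blinfun.add_right)
  also have "\<dots> \<le> norm z * norm (u + w)"
    using norm_blinfun[of z "u + w"] by simp
  also have "norm z = 1"
    using z(1) norming[of n] by (auto simp: norms_within_def)
  finally have "\<tau> n * z u \<le> \<tau> n * norm (u + w)"
    using \<tau>(2)[of n] by (intro mult_left_mono) auto
  then show "norm u \<le> \<tau> n * norm (u + w)"
    using z(2) by linarith
qed

theorem theorem1:
  fixes Y :: "'x::banach dual set" and \<Y> :: "'x dual set"
    and T :: "L1 \<Rightarrow>\<^sub>L 'x" and \<tau> :: "nat \<Rightarrow> real" and \<tau>\<^sub>0 :: real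
  assumes "\<tau>\<^sub>0 > 1" and "Y \<subseteq> sphere 0 1" and "norms_within Y UNIV \<tau>\<^sub>0"
    and "subspace \<Y>" and "Y \<subseteq> \<Y>"
    and "\<not> completely_continuous T"
    and "\<forall>n. \<tau> n > 1"
  shows
    "(\<exists>(A :: nat \<Rightarrow> nat \<Rightarrow> real set) (x :: nat \<Rightarrow> 'x dual)
        (p :: nat \<Rightarrow> nat) (z :: nat \<Rightarrow> nat \<Rightarrow> 'x dual) (\<delta> :: real).
        dyadic_splitting A \<and>
        (\<forall>n. x n \<in> sphere 0 1 \<inter> \<Y>) \<and>
        (\<forall>n. \<forall>i\<in>{1..p n}. z n i \<in> sphere 0 1) \<and>
        \<delta> > 0 \<and>
        (\<forall>n m. \<forall>h\<in>haar_block A m. x n (T h) = \<delta> * (if n = m then 1 else 0)) \<and>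
        weak_star_null (\<lambda>n. adjoint_op T (x n)) \<and>
        equivalent_l1_basis (\<lambda>n. adjoint_op T (x n)) \<and>
        (\<forall>n. norms_within (z n ` {1..p n}) (span (\<Union>j\<le>n. T ` haar_block A j)) (\<tau> n)) \<and>
        (\<forall>n. T ` haar_block A (Suc n) \<subseteq> preannihilator (z n ` {1..p n})))
     \<and>
     (\<forall>x :: nat \<Rightarrow> 'x dual.
        (\<forall>n. x n \<in> sphere 0 1 \<inter> \<Y>) \<and> equivalent_l1_basis (\<lambda>n. adjoint_op T (x n))
        \<longrightarrow> equivalent_l1_basis x)
     \<and>
     (convergent_prod \<tau> \<longrightarrow>
       (\<forall>(A :: nat \<Rightarrow> nat \<Rightarrow> real set) (p :: nat \<Rightarrow> nat) (z :: nat \<Rightarrow> nat \<Rightarrow> 'x dual).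
          dyadic_splitting A \<and>
          (\<forall>n. \<forall>i\<in>{1..p n}. z n i \<in> sphere 0 1) \<and>
          (\<forall>n. norms_within (z n ` {1..p n}) (span (\<Union>j\<le>n. T ` haar_block A j)) (\<tau> n)) \<and>
          (\<forall>n. T ` haar_block A (Suc n) \<subseteq> preannihilator (z n ` {1..p n}))
          \<longrightarrow> fdd_of_closed_span (\<lambda>n. span (T ` haar_block A n)) (prodinf \<tau>)))"
proof (intro conjI impI allI)
  have \<tau>: "\<And>n. \<tau> n > 1"
    using assms(7) by blast
  obtain D :: "nat \<Rightarrow> L1" where
    D: "\<And>V. closed V \<Longrightarrow> subspace V \<Longrightarrow> range D \<subseteq> V \<Longrightarrow> V = UNIV"
    using L1_separable by blast
  obtain B c v u where B: "B \<in> sets unit_leb" "measure unit_leb B > 0" and "c > 0"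
    and v_span: "\<And>k. v k \<in> span Y" and osc: "oscillating_on T B c v u"
    using oscillation_of_non_completely_continuous[OF assms(3,6)] by blast
  have v: "v k \<in> \<Y>" for k
    using span_minimal[OF assms(5,4)] v_span by blast
  show "\<exists>(A :: nat \<Rightarrow> nat \<Rightarrow> real set) (x :: nat \<Rightarrow> 'x dual)
        (p :: nat \<Rightarrow> nat) (z :: nat \<Rightarrow> nat \<Rightarrow> 'x dual) (\<delta> :: real).
        dyadic_splitting A \<and>
        (\<forall>n. x n \<in> sphere 0 1 \<inter> \<Y>) \<and>
        (\<forall>n. \<forall>i\<in>{1..p n}. z n i \<in> sphere 0 1) \<and>
        \<delta> > 0 \<and>
        (\<forall>n m. \<forall>h\<in>haar_block A m. x n (T h) = \<delta> * (if n = m then 1 else 0)) \<and>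
        weak_star_null (\<lambda>n. adjoint_op T (x n)) \<and>
        equivalent_l1_basis (\<lambda>n. adjoint_op T (x n)) \<and>
        (\<forall>n. norms_within (z n ` {1..p n}) (span (\<Union>j\<le>n. T ` haar_block A j)) (\<tau> n)) \<and>
        (\<forall>n. T ` haar_block A (Suc n) \<subseteq> preannihilator (z n ` {1..p n}))"
  proof (rule exists_haar_biorthogonal_system[where \<tau> = \<tau> and D = D, OF osc \<open>c > 0\<close> v assms(4) B \<tau>])
    fix A x and N :: "nat \<Rightarrow> 'x dual set"
    assume A: "dyadic_splitting A" and x: "\<And>n. x n \<in> \<Y>" "\<And>n. norm (x n) = 1"
      and dual: "\<And>n m h. h \<in> haar_block A m \<Longrightarrow> blinfun_apply (x n) (T h) = c / 12 * (if n = m then 1 else 0)"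
      and xD: "\<And>n j. j \<le> n \<Longrightarrow> \<bar>blinfun_apply (x (Suc n)) (T (D j))\<bar> \<le> 1 / real (Suc n)"
      and N: "\<And>n. finite (N n)" "\<And>n. norms_within (N n) (span (\<Union>j\<le>n. T ` haar_block A j)) (\<tau> n)"
        "\<And>n. T ` haar_block A (Suc n) \<subseteq> preannihilator (N n)"
    define \<phi> where "\<phi> n = adjoint_op T (x n)" for n
    have \<phi>_app: "blinfun_apply (\<phi> n) f = x n (T f)" for n f
      by (simp add: \<phi>_def adjoint_op_def)
    have \<phi>_norm: "norm (\<phi> n) \<le> norm T" for n
      using norm_blinfun_compose[of "x n" T] x(2)[of n] by (simp add: \<phi>_def adjoint_op_def)
    have "weak_star_null \<phi>"
    proof (rule weak_star_null_L1[OF \<phi>_norm D])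
      fix j
      have "(\<lambda>n. \<phi> (Suc n) (D j)) \<longlonglongrightarrow> 0"
      proof (rule Lim_null_comparison)
        show "\<forall>\<^sub>F n in sequentially. norm (\<phi> (Suc n) (D j)) \<le> 1 / real (Suc n)"
          using eventually_ge_at_top[of j] by eventually_elim (simp add: \<phi>_app xD del: of_nat_Suc)
        show "(\<lambda>n. 1 / real (Suc n)) \<longlonglongrightarrow> 0"
          by (rule LIMSEQ_Suc[OF lim_1_over_n])
      qed
      then show "(\<lambda>n. \<phi> n (D j)) \<longlonglongrightarrow> 0"
        by (rule LIMSEQ_imp_Suc)
    qed
    moreover have "equivalent_l1_basis \<phi>"
      by (rule l1_basis_of_haar_biorthogonal[OF A \<phi>_norm, of "c / 12"])
        (use \<open>c > 0\<close> dual in \<open>simp_all add: \<phi>_app\<close>)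
    moreover have "\<exists>z. z ` {1..card (N n)} = N n" for n
      using ex_bij_betw_nat_finite_1[OF N(1)[of n]] by (auto simp: bij_betw_def)
    then obtain z where z: "\<And>n. z n ` {1..card (N n)} = N n"
      by metis
    have "z n i \<in> sphere 0 1" if "i \<in> {1..card (N n)}" for n i
      using imageI[OF that, of "z n"] N(2)[of n] unfolding z norms_within_def by blast
    ultimately show ?thesis
      using A x dual N(2,3) \<open>c > 0\<close> unfolding \<phi>_def
      by (intro exI[of _ A] exI[of _ x] exI[of _ "\<lambda>n. card (N n)"] exI[of _ z] exI[of _ "c / 12"]
          conjI allI ballI) (simp_all only: z, simp_all)
  qed
next
  fix x :: "nat \<Rightarrow> 'x dual"
  assume "(\<forall>n. x n \<in> sphere 0 1 \<inter> \<Y>) \<and> equivalent_l1_basis (\<lambda>n. adjoint_op T (x n))"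
  then show "equivalent_l1_basis x"
    by (intro equivalent_l1_basis_of_adjoint[of x T]) auto
next
  fix A :: "nat \<Rightarrow> nat \<Rightarrow> real set" and p :: "nat \<Rightarrow> nat" and z :: "nat \<Rightarrow> nat \<Rightarrow> 'x dual"
  assume conv: "convergent_prod \<tau>" and
    "dyadic_splitting A \<and> (\<forall>n. \<forall>i\<in>{1..p n}. z n i \<in> sphere 0 1) \<and>
      (\<forall>n. norms_within (z n ` {1..p n}) (span (\<Union>j\<le>n. T ` haar_block A j)) (\<tau> n)) \<and>
      (\<forall>n. T ` haar_block A (Suc n) \<subseteq> preannihilator (z n ` {1..p n}))"
  then show "fdd_of_closed_span (\<lambda>n. span (T ` haar_block A n)) (prodinf \<tau>)"
    using assms(7) by (intro haar_image_fdd[where N = "\<lambda>n. z n ` {1..p n}"]) auto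
qed

end
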